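(* For an exact Courant algebroid $E\to M$, $\dim M\ge2$, with (semi-Riemannian) generalised metric $\mathcal G$ and divergence operator $\mathrm{div}$, let $D=D^{\mathcal G,\mathrm{div}}$ be the canonical generalised Levi-Civita connection and define the generalised Kretschmann scalar $$|\mathcal{R}m^D|^2_{\mathcal G}=\mathcal G^{II'}\mathcal G^{JJ'}\mathcal G^{KK'}\mathcal G^{LL'}\,\mathcal{R}m^D_{IJKL}\,\mathcal{R}m^D_{I'J'K'L'}\in C^\infty(M),$$ where the sum is over all components with respect to a local frame of $E$. Then $|\mathcal{R}m^D|^2_{\mathcal G}$ is a (non-trivial) geometric invariant of the pair $(\mathcal G,\mathrm{div})$; that is: (i) if $F:E\to E'$ is an isomorphism of exact Courant algebroids covering a diffeomorphism $f:M\to M'$ which maps $(\mathcal G,\mathrm{div})$ to $(\mathcal G',\mathrm{div}')$, then $|\mathcal{R}m^{D'}|^2_{\mathcal G'}\circ f=|\mathcal{R}m^{D}|^2_{\mathcal G}$, where $D'=D^{\mathcal G',\mathrm{div}'}$; and (ii) the invariant is not identically zero, i.e. there exist data $(E,\mathcal G,\mathrm{div})$ for which the function $|\mathcal{R}m^D|^2_{\mathcal G}$ does not vanish identically.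
   Context: **Setting.** $(E,\pi,\langle\cdot,\cdot\rangle,[\cdot,\cdot])$ is an exact Courant algebroid over $M$: the bracket is the Dorfman bracket and $0\to T^*M\to E\xrightarrow{\pi}TM\to0$ is exact. A (semi-Riemannian) generalised metric is a nondegenerate symmetric bilinear form $\mathcal G$ on $E$ such that the endomorphism $\mathcal G^{\mathrm{End}}$ defined by $\langle\mathcal G^{\mathrm{End}}u,v\rangle=\mathcal G(u,v)$ is an involution and $\mathcal G|_{T^*M}$ is nondegenerate. $E_\pm$ are the $\pm1$-eigenbundles of $\mathcal G^{\mathrm{End}}$, so $E=E_+\oplus E_-$ orthogonally and $\mathcal G=\pm\langle\cdot,\cdot\rangle$ on $E_\pm$. The maps $\pi_\pm=\pi|_{E_\pm}:E_\pm\to TM$ are isomorphisms, and $g$ is the semi-Riemannian metric on $M$ with $(\pi_\pm)^*g=\mathcal G|_{E_\pm\times E_\pm}$. $\nabla$ is the Levi-Civita connection of $g$. The scalar product is normalised so that $E$ is identified with $TM\oplus T^*M$ with $\langle X+\xi,Y+\zeta\rangle=\frac12(\xi(Y)+\zeta(X))$ and the Dorfman bracket $[X+\xi,Y+\zeta]_H=\mathcal L_XY+\mathcal L_X\zeta-\iota_Yd\xi+H(X,Y,\cdot)$ twisted by a closed three-form $H$, via $\phi|_{E_\pm}=(1\pm g)\circ\pi_\pm$. $(\mathcal G^{IJ})$ denotes the inverse of the matrix $(\mathcal G_{IJ})$ of $\mathcal G$ in a local frame $(e_I)$ of $E$. **Generalised connections.** A generalised connection is an $\mathbb R$-bilinear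 map $D:\Gamma(E)\times\Gamma(E)\to\Gamma(E)$, $(u,v)\mapsto D_uv$, $C^\infty(M)$-linear in $u$, with $D_u(fv)=(\pi(u)f)v+fD_uv$ and $\pi(u)\langle v,w\rangle=\langle D_uv,w\rangle+\langle v,D_uw\rangle$. Its torsion is $T(u,v,w)=\langle D_uv-D_vu-[u,v],w\rangle+\langle D_wu,v\rangle$. It is metric if $D\mathcal G=0$ (equivalently $D$ preserves $E_\pm$); a generalised Levi-Civita connection is a torsion-free metric generalised connection. A divergence operator is an $\mathbb R$-linear map $\mathrm{div}:\Gamma(E)\to C^\infty(M)$ with $\mathrm{div}(fv)=\pi(v)f+f\,\mathrm{div}(v)$; $D$ has divergence $\mathrm{div}^D(v)=\mathrm{tr}(u\mapsto D_uv)$. The metric divergence is $\mathrm{div}^{\mathcal G}=\mathrm{div}^g\circ\pi$, with $\mathrm{div}^g$ the divergence of $g$ on vector fields. **Canonical generalised Levi-Civita connection.** Let $\widetilde D$ be the generalised connection with $\widetilde D_u=\pi_\pm^{-1}\circ\nabla_{\pi(u)}\circ\pi_\pm$ on $\Gamma(E_\pm)$ for $u\in\Gamma(E_\pm)$, and $\widetilde D_u=[u,\cdot]_\mp$ on $\Gamma(E_\mp)$ for $u\in\Gamma(E_\pm)$ (subscripts on brackets denote projection to $E_\mp$). Its torsion $\widetilde T$ is totally skew; $D^0$ is defined by $\langle D^0_uv,w\rangle=\langle\widetilde D_uv,w\rangle-\frac13\widetilde T(u,v,w)$; it is a generalised Levi-Civita connection with divergence $\mathrm{div}^{\mathcal G}$.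 Let $\mathfrak{so}(E)_{\mathcal G}^{\langle1\rangle}$ be the bundle of $S\in E^*\otimes\mathfrak{so}(E)$, $S_u$ preserving $E_\pm$, with $\sum_{\mathrm{cycl}}\langle S_uv,w\rangle=0$; put $\mathrm{tr}(S)(v)=\mathrm{tr}(u\mapsto S_uv)$. $D^{\mathcal G,\mathrm{div}}$ is the unique generalised Levi-Civita connection with divergence $\mathrm{div}$ such that $D^{\mathcal G,\mathrm{div}}-D^0$ is pointwise orthogonal, with respect to the scalar product induced by $\langle\cdot,\cdot\rangle$, to $\ker(\mathrm{tr}:\mathfrak{so}(E)_{\mathcal G}^{\langle1\rangle}\to E^* )$. **Curvature.** With $D^2_{v,w}=D_vD_w-D_{D_vw}$ the generalised Riemann tensor is the section of $\mathrm{Sym}^2\Lambda^2E^*$ $$\mathcal{R}m^D(a,b,v,w)=\tfrac12\Big\{\langle(D^2_{v,w}-D^2_{w,v})b,a\rangle+\langle(D^2_{b,a}-D^2_{a,b})v,w\rangle-\mathrm{tr}_E(\langle Dv,w\rangle\langle Db,a\rangle)\Big\},$$ where $\mathrm{tr}_E(\langle Dv,w\rangle\langle Db,a\rangle)=\sum_I\langle D_{e_I}v,w\rangle\langle D_{e^I}b,a\rangle$ for a local frame $(e_I)$ of $E$ and the frame $(e^I)$ with $\langle e^I,e_J\rangle=\delta^I_J$. *)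

theory Defs
  imports "HOL-Analysis.Analysis"
begin

section \<open>Smooth manifolds\<close>

text \<open>\<open>Ck k S f\<close> is meant for open sets \<open>S\<close> of a finite-dimensional space.\<close>

primrec Ck :: "nat \<Rightarrow> 'a::real_normed_vector set \<Rightarrow> ('a \<Rightarrow> 'b::real_normed_vector) \<Rightarrow> bool" where
  "Ck 0 S f \<longleftrightarrow> continuous_on S f"
| "Ck (Suc k) S f \<longleftrightarrow>
     (\<forall>x\<in>S. f differentiable (at x)) \<and> (\<forall>v. Ck k S (\<lambda>x. frechet_derivative f (at x) v))"

definition smooth_on :: "'a::real_normed_vector set \<Rightarrow> ('a \<Rightarrow> 'b::real_normed_vector) \<Rightarrow> bool" where
  "smooth_on S f \<longleftrightarrow> (\<forall>k. Ck k S f)"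

text \<open>A manifold of dimension \<open>CARD('n)\<close> is a Hausdorff, second countable type \<open>'m\<close> with an atlas
  (not necessarily maximal) of pairs (chart domain, chart map); the values of a chart map outside
  its domain are irrelevant.\<close>

type_synonym ('m, 'n) chart = "'m set \<times> ('m \<Rightarrow> real^'n)"

definition mfd_smooth_on ::
  "('m, 'n::finite) chart set \<Rightarrow> 'm set \<Rightarrow> ('m \<Rightarrow> 'b::real_normed_vector) \<Rightarrow> bool" where
  "mfd_smooth_on A W f \<longleftrightarrow> (\<forall>(U, \<phi>)\<in>A. smooth_on (\<phi> ` (U \<inter> W)) (f \<circ> inv_into U \<phi>))"

definition smooth_atlas ::
  "('m::{t2_space,second_countable_topology}, 'n::finite) chart set \<Rightarrow> bool" where
  "smooth_atlas A \<longleftrightarrow>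
     (\<forall>(U, \<phi>)\<in>A. open U \<and> open (\<phi> ` U) \<and> homeomorphism U (\<phi> ` U) \<phi> (inv_into U \<phi>)) \<and>
     (\<Union>(U, \<phi>)\<in>A. U) = UNIV \<and>
     (\<forall>(V, \<psi>)\<in>A. mfd_smooth_on A V \<psi>)"

abbreviation smooth_fun :: "('m, 'n::finite) chart set \<Rightarrow> ('m \<Rightarrow> real) \<Rightarrow> bool" where
  "smooth_fun A \<equiv> mfd_smooth_on A UNIV"

definition smooth_map ::
  "('m::topological_space, 'n::finite) chart set \<Rightarrow> ('m2::topological_space, 'n2::finite) chart set
     \<Rightarrow> ('m \<Rightarrow> 'm2) \<Rightarrow> bool" where
  "smooth_map A A' f \<longleftrightarrow> continuous_on UNIV f \<and> (\<forall>(V, \<psi>)\<in>A'. mfd_smooth_on A (f -` V) (\<psi> \<circ> f))"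

definition diffeomorphism ::
  "('m::topological_space, 'n::finite) chart set \<Rightarrow> ('m2::topological_space, 'n2::finite) chart set
     \<Rightarrow> ('m \<Rightarrow> 'm2) \<Rightarrow> bool" where
  "diffeomorphism A A' f \<longleftrightarrow> bij f \<and> smooth_map A A' f \<and> smooth_map A' A (inv f)"

text \<open>Tangent vectors at \<open>p\<close> are the derivations \<open>\<Sum>i. x$i * \<partial>/\<partial>\<phi>$i\<close> of the algebra of smooth
  functions, extended by \<open>0\<close> to functions that are not smooth so that equality in the type
  \<open>('m \<Rightarrow> real) \<Rightarrow> real\<close> is equality of tangent vectors. The vector space operations are pointwise.\<close>

type_synonym 'm tangent = "('m \<Rightarrow> real) \<Rightarrow> real"

definition tangent_space :: "('m, 'n::finite) chart set \<Rightarrow> 'm \<Rightarrow> 'm tangent set" where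
  "tangent_space A p =
     {X. \<exists>(U, \<phi>)\<in>A. \<exists>x. p \<in> U \<and>
        X = (\<lambda>f. if smooth_fun A f then frechet_derivative (f \<circ> inv_into U \<phi>) (at (\<phi> p)) x else 0)}"

definition cotangent_space :: "('m, 'n::finite) chart set \<Rightarrow> 'm \<Rightarrow> ('m tangent \<Rightarrow> real) set" where
  "cotangent_space A p =
     {\<xi>. \<forall>X\<in>tangent_space A p. \<forall>Y\<in>tangent_space A p. \<forall>a b.
        \<xi> (\<lambda>f. a * X f + b * Y f) = a * \<xi> X + b * \<xi> Y}"

type_synonym 'm vfield = "'m \<Rightarrow> 'm tangent"

definition vector_fields :: "('m, 'n::finite) chart set \<Rightarrow> 'm vfield set" where
  "vector_fields A =
     {X. (\<forall>p. X p \<in> tangent_space A p) \<and> (\<forall>f. smooth_fun A f \<longrightarrow> smooth_fun A (\<lambda>p. X p f))}"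

definition vf_add :: "'m vfield \<Rightarrow> 'm vfield \<Rightarrow> 'm vfield" where
  "vf_add X Y = (\<lambda>p f. X p f + Y p f)"

definition vf_mult :: "('m \<Rightarrow> real) \<Rightarrow> 'm vfield \<Rightarrow> 'm vfield" where
  "vf_mult h X = (\<lambda>p f. h p * X p f)"

text \<open>Real linearity of \<open>N\<close> is the case of constant \<open>h\<close>.\<close>

definition levi_civita ::
  "('m, 'n::finite) chart set \<Rightarrow> ('m \<Rightarrow> 'm tangent \<Rightarrow> 'm tangent \<Rightarrow> real)
     \<Rightarrow> ('m vfield \<Rightarrow> 'm vfield \<Rightarrow> 'm vfield) \<Rightarrow> bool" where
  "levi_civita A g N \<longleftrightarrow>
     (\<forall>X\<in>vector_fields A. \<forall>Y\<in>vector_fields A. N X Y \<in> vector_fields A) \<and>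
     (\<forall>X\<in>vector_fields A. \<forall>X'\<in>vector_fields A. \<forall>Y\<in>vector_fields A.
        N (vf_add X X') Y = vf_add (N X Y) (N X' Y) \<and>
        N Y (vf_add X X') = vf_add (N Y X) (N Y X')) \<and>
     (\<forall>h X Y. smooth_fun A h \<and> X \<in> vector_fields A \<and> Y \<in> vector_fields A \<longrightarrow>
        N (vf_mult h X) Y = vf_mult h (N X Y) \<and>
        N X (vf_mult h Y) = vf_add (vf_mult (\<lambda>p. X p h) Y) (vf_mult h (N X Y))) \<and>
     (\<forall>X\<in>vector_fields A. \<forall>Y\<in>vector_fields A. \<forall>Z\<in>vector_fields A. \<forall>p.
        X p (\<lambda>q. g q (Y q) (Z q)) = g p (N X Y p) (Z p) + g p (Y p) (N X Z p)) \<and>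
     (\<forall>X\<in>vector_fields A. \<forall>Y\<in>vector_fields A. \<forall>p f. smooth_fun A f \<longrightarrow>
        N X Y p f - N Y X p f = X p (\<lambda>q. Y q f) - Y p (\<lambda>q. X q f))"


section \<open>Exact Courant algebroids\<close>

text \<open>The fibre \<open>E\<^sub>p\<close> over every point is the vector space \<open>real^'k\<close>. This is no restriction on a
  vector bundle of rank \<open>CARD('k)\<close>: it amounts to choosing a basis in every single fibre, with no
  regularity in \<open>p\<close> whatsoever. The smooth structure of the bundle is carried only by the local
  trivialisations in \<open>trivs\<close>, so the bundle need not be trivial and a section \<open>s :: 'm \<Rightarrow> real^'k\<close>
  is smooth if it is so in these trivialisations. \<open>anchor C p u f\<close> is the derivative of \<open>f\<close> along
  the tangent vector \<open>\<pi>(u)\<close>.\<close>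

record ('m, 'n, 'k) courant =
  atlas :: "('m, 'n) chart set"
  trivs :: "('m set \<times> ('m \<Rightarrow> real^'k \<Rightarrow> real^'k)) set"
  anchor :: "'m \<Rightarrow> real^'k \<Rightarrow> 'm tangent"
  pairing :: "'m \<Rightarrow> real^'k \<Rightarrow> real^'k \<Rightarrow> real"
  dorfman :: "('m \<Rightarrow> real^'k) \<Rightarrow> ('m \<Rightarrow> real^'k) \<Rightarrow> ('m \<Rightarrow> real^'k)"

type_synonym ('m, 'k) sect = "'m \<Rightarrow> real^'k"
type_synonym ('m, 'k) conn = "('m, 'k) sect \<Rightarrow> ('m, 'k) sect \<Rightarrow> ('m, 'k) sect"
type_synonym ('m, 'k) form = "'m \<Rightarrow> real^'k \<Rightarrow> real^'k \<Rightarrow> real"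

definition vector_bundle ::
  "('m::{t2_space,second_countable_topology}, 'n::finite, 'k::finite) courant \<Rightarrow> bool" where
  "vector_bundle C \<longleftrightarrow>
     (\<forall>(W, \<tau>)\<in>trivs C. open W \<and> (\<forall>p\<in>W. linear (\<tau> p) \<and> bij (\<tau> p))) \<and>
     (\<Union>(W, \<tau>)\<in>trivs C. W) = UNIV \<and>
     (\<forall>(W, \<tau>)\<in>trivs C. \<forall>(W', \<tau>')\<in>trivs C. \<forall>x.
        mfd_smooth_on (atlas C) (W \<inter> W') (\<lambda>p. \<tau>' p (inv (\<tau> p) x)))"

definition section_on ::
  "('m, 'n::finite, 'k::finite) courant \<Rightarrow> 'm set \<Rightarrow> ('m, 'k) sect \<Rightarrow> bool" where
  "section_on C U s \<longleftrightarrow> (\<forall>(W, \<tau>)\<in>trivs C. mfd_smooth_on (atlas C) (U \<inter> W) (\<lambda>p. \<tau> p (s p)))"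

definition sections :: "('m, 'n::finite, 'k::finite) courant \<Rightarrow> ('m, 'k) sect set" where
  "sections C = {s. section_on C UNIV s}"

definition smooth_metric :: "('m, 'n::finite, 'k::finite) courant \<Rightarrow> ('m, 'k) form \<Rightarrow> bool" where
  "smooth_metric C h \<longleftrightarrow>
     (\<forall>p. bilinear (h p) \<and> (\<forall>u v. h p u v = h p v u) \<and> (\<forall>u. (\<forall>v. h p u v = 0) \<longrightarrow> u = 0)) \<and>
     (\<forall>u\<in>sections C. \<forall>v\<in>sections C. smooth_fun (atlas C) (\<lambda>p. h p (u p) (v p)))"

definition anchor_sec :: "('m, 'n::finite, 'k::finite) courant \<Rightarrow> ('m, 'k) sect \<Rightarrow> 'm vfield" where
  "anchor_sec C u = (\<lambda>p. anchor C p (u p))"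

text \<open>The Leibniz rule \<open>[u, fv] = (\<pi>(u)f) v + f [u, v]\<close> and \<open>\<pi>[u, v] = [\<pi>u, \<pi>v]\<close> are consequences of
  the last three axioms.\<close>

definition courant_algebroid ::
  "('m::{t2_space,second_countable_topology}, 'n::finite, 'k::finite) courant \<Rightarrow> bool" where
  "courant_algebroid C \<longleftrightarrow>
     smooth_atlas (atlas C) \<and> vector_bundle C \<and> smooth_metric C (pairing C) \<and>
     (\<forall>p. \<forall>u. anchor C p u \<in> tangent_space (atlas C) p) \<and>
     (\<forall>p f. linear (\<lambda>u. anchor C p u f)) \<and>
     (\<forall>u\<in>sections C. anchor_sec C u \<in> vector_fields (atlas C)) \<and>
     (\<forall>u\<in>sections C. \<forall>v\<in>sections C. dorfman C u v \<in> sections C) \<and>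
     (\<forall>u\<in>sections C. \<forall>v\<in>sections C. \<forall>w\<in>sections C. \<forall>a b.
        dorfman C (\<lambda>p. a *\<^sub>R u p + b *\<^sub>R v p) w =
          (\<lambda>p. a *\<^sub>R dorfman C u w p + b *\<^sub>R dorfman C v w p) \<and>
        dorfman C w (\<lambda>p. a *\<^sub>R u p + b *\<^sub>R v p) =
          (\<lambda>p. a *\<^sub>R dorfman C w u p + b *\<^sub>R dorfman C w v p)) \<and>
     (\<forall>u\<in>sections C. \<forall>v\<in>sections C. \<forall>w\<in>sections C.
        dorfman C u (dorfman C v w) =
          (\<lambda>p. dorfman C (dorfman C u v) w p + dorfman C v (dorfman C u w) p)) \<and>
     (\<forall>u\<in>sections C. \<forall>v\<in>sections C. \<forall>w\<in>sections C. \<forall>p.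
        anchor C p (u p) (\<lambda>q. pairing C q (v q) (w q)) =
          pairing C p (dorfman C u v p) (w p) + pairing C p (v p) (dorfman C u w p)) \<and>
     (\<forall>u\<in>sections C. \<forall>v\<in>sections C. \<forall>w\<in>sections C. \<forall>p.
        anchor C p (u p) (\<lambda>q. pairing C q (v q) (w q)) =
          pairing C p (u p) (dorfman C v w p + dorfman C w v p))"

text \<open>A covector \<open>\<xi>\<close> is viewed as the element of \<open>E\<close> with \<open>\<langle>\<xi>, v\<rangle> = \<xi>(\<pi>(v)) / 2\<close>, in accordance with the
  normalisation \<open>\<langle>X + \<xi>, Y + \<zeta>\<rangle> = (\<xi>(Y) + \<zeta>(X)) / 2\<close>; the map from covectors to \<open>E\<close> is injective
  because \<open>\<pi>\<close> is surjective. Exactness forces \<open>CARD('k) = 2 * CARD('n)\<close>.\<close>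

definition exact_courant_algebroid ::
  "('m::{t2_space,second_countable_topology}, 'n::finite, 'k::finite) courant \<Rightarrow> bool" where
  "exact_courant_algebroid C \<longleftrightarrow> courant_algebroid C \<and>
     (\<forall>p. range (anchor C p) = tangent_space (atlas C) p \<and>
        {u. anchor C p u = (\<lambda>f. 0)} =
          {u. \<exists>\<xi>\<in>cotangent_space (atlas C) p. \<forall>v. pairing C p u v = \<xi> (anchor C p v) / 2})"

text \<open>\<open>F p\<close> is the linear map from the fibre over \<open>p\<close> to the fibre over \<open>f p\<close>.\<close>

definition push_sec ::
  "('m \<Rightarrow> 'm2) \<Rightarrow> ('m \<Rightarrow> real^'k \<Rightarrow> real^'k) \<Rightarrow> ('m, 'k::finite) sect \<Rightarrow> ('m2, 'k) sect" where
  "push_sec f F s = (\<lambda>q. F (inv f q) (s (inv f q)))"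

definition courant_isomorphism ::
  "('m::{t2_space,second_countable_topology}, 'n::finite, 'k::finite) courant
     \<Rightarrow> ('m2::{t2_space,second_countable_topology}, 'n, 'k) courant
     \<Rightarrow> ('m \<Rightarrow> 'm2) \<Rightarrow> ('m \<Rightarrow> real^'k \<Rightarrow> real^'k) \<Rightarrow> bool" where
  "courant_isomorphism C C' f F \<longleftrightarrow>
     diffeomorphism (atlas C) (atlas C') f \<and>
     (\<forall>p. linear (F p) \<and> bij (F p)) \<and>
     (\<forall>(W, \<tau>)\<in>trivs C. \<forall>(W', \<tau>')\<in>trivs C'. \<forall>x.
        mfd_smooth_on (atlas C) (W \<inter> f -` W') (\<lambda>p. \<tau>' (f p) (F p (inv (\<tau> p) x)))) \<and>
     (\<forall>p u h. smooth_fun (atlas C') h \<longrightarrow> anchor C' (f p) (F p u) h = anchor C p u (h \<circ> f)) \<and>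
     (\<forall>p u v. pairing C' (f p) (F p u) (F p v) = pairing C p u v) \<and>
     (\<forall>u\<in>sections C. \<forall>v\<in>sections C.
        dorfman C' (push_sec f F u) (push_sec f F v) = push_sec f F (dorfman C u v))"


section \<open>Generalised metrics\<close>

definition metric_endo ::
  "('m, 'n::finite, 'k::finite) courant \<Rightarrow> ('m, 'k) form \<Rightarrow> 'm \<Rightarrow> real^'k \<Rightarrow> real^'k" where
  "metric_endo C G p u = (THE w. \<forall>v. pairing C p w v = G p u v)"

text \<open>In an exact Courant algebroid the image of the cotangent bundle is the kernel of \<open>\<pi>\<close>.\<close>

definition generalised_metric ::
  "('m, 'n::finite, 'k::finite) courant \<Rightarrow> ('m, 'k) form \<Rightarrow> bool" where
  "generalised_metric C G \<longleftrightarrow> smooth_metric C G \<and>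
     (\<forall>p u. metric_endo C G p (metric_endo C G p u) = u) \<and>
     (\<forall>p u. anchor C p u = (\<lambda>f. 0) \<and> (\<forall>v. anchor C p v = (\<lambda>f. 0) \<longrightarrow> G p u v = 0) \<longrightarrow> u = 0)"

text \<open>The sign \<open>\<epsilon>\<close> below is \<open>1\<close> or \<open>-1\<close>; it selects \<open>E\<^sub>+\<close> or \<open>E\<^sub>-\<close>.\<close>

definition eigenspace ::
  "('m, 'n::finite, 'k::finite) courant \<Rightarrow> ('m, 'k) form \<Rightarrow> real \<Rightarrow> 'm \<Rightarrow> (real^'k) set" where
  "eigenspace C G \<epsilon> p = {u. metric_endo C G p u = \<epsilon> *\<^sub>R u}"

definition proj ::
  "('m, 'n::finite, 'k::finite) courant \<Rightarrow> ('m, 'k) form \<Rightarrow> real \<Rightarrow> 'm \<Rightarrow> real^'k \<Rightarrow> real^'k" where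
  "proj C G \<epsilon> p u = (1/2) *\<^sub>R (u + \<epsilon> *\<^sub>R metric_endo C G p u)"

definition proj_sec ::
  "('m, 'n::finite, 'k::finite) courant \<Rightarrow> ('m, 'k) form \<Rightarrow> real \<Rightarrow> ('m, 'k) sect \<Rightarrow> ('m, 'k) sect" where
  "proj_sec C G \<epsilon> u = (\<lambda>p. proj C G \<epsilon> p (u p))"

text \<open>The inverse of \<open>\<pi>\<close> restricted to the \<open>\<epsilon>\<close>-eigenspace.\<close>

definition lift ::
  "('m, 'n::finite, 'k::finite) courant \<Rightarrow> ('m, 'k) form \<Rightarrow> real \<Rightarrow> 'm \<Rightarrow> 'm tangent \<Rightarrow> real^'k" where
  "lift C G \<epsilon> p X = (THE u. u \<in> eigenspace C G \<epsilon> p \<and> anchor C p u = X)"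

text \<open>The metric \<open>g\<close> on \<open>M\<close> whose pullback along \<open>\<pi>\<close> agrees with \<open>G\<close> on both eigenbundles.\<close>

definition base_metric ::
  "('m, 'n::finite, 'k::finite) courant \<Rightarrow> ('m, 'k) form \<Rightarrow> 'm \<Rightarrow> 'm tangent \<Rightarrow> 'm tangent \<Rightarrow> real" where
  "base_metric C G p X Y =
     (THE r. \<forall>\<epsilon>\<in>{1, -1}. \<forall>u\<in>eigenspace C G \<epsilon> p. \<forall>v\<in>eigenspace C G \<epsilon> p.
        anchor C p u = X \<and> anchor C p v = Y \<longrightarrow> G p u v = r)"


section \<open>Generalised connections and divergence operators\<close>

definition generalised_connection ::
  "('m, 'n::finite, 'k::finite) courant \<Rightarrow> ('m, 'k) conn \<Rightarrow> bool" where
  "generalised_connection C D \<longleftrightarrow>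
     (\<forall>u\<in>sections C. \<forall>v\<in>sections C. D u v \<in> sections C) \<and>
     (\<forall>u\<in>sections C. \<forall>v\<in>sections C. \<forall>w\<in>sections C. \<forall>a b.
        D (\<lambda>p. a *\<^sub>R u p + b *\<^sub>R v p) w = (\<lambda>p. a *\<^sub>R D u w p + b *\<^sub>R D v w p) \<and>
        D w (\<lambda>p. a *\<^sub>R u p + b *\<^sub>R v p) = (\<lambda>p. a *\<^sub>R D w u p + b *\<^sub>R D w v p)) \<and>
     (\<forall>h u v. smooth_fun (atlas C) h \<and> u \<in> sections C \<and> v \<in> sections C \<longrightarrow>
        D (\<lambda>p. h p *\<^sub>R u p) v = (\<lambda>p. h p *\<^sub>R D u v p) \<and>
        D u (\<lambda>p. h p *\<^sub>R v p) = (\<lambda>p. anchor C p (u p) h *\<^sub>R v p + h p *\<^sub>R D u v p)) \<and>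
     (\<forall>u\<in>sections C. \<forall>v\<in>sections C. \<forall>w\<in>sections C. \<forall>p.
        anchor C p (u p) (\<lambda>q. pairing C q (v q) (w q)) =
          pairing C p (D u v p) (w p) + pairing C p (v p) (D u w p))"

definition torsion ::
  "('m, 'n::finite, 'k::finite) courant \<Rightarrow> ('m, 'k) conn
     \<Rightarrow> ('m, 'k) sect \<Rightarrow> ('m, 'k) sect \<Rightarrow> ('m, 'k) sect \<Rightarrow> 'm \<Rightarrow> real" where
  "torsion C D u v w p =
     pairing C p (D u v p - D v u p - dorfman C u v p) (w p) + pairing C p (D w u p) (v p)"

definition metric_connection ::
  "('m, 'n::finite, 'k::finite) courant \<Rightarrow> ('m, 'k) form \<Rightarrow> ('m, 'k) conn \<Rightarrow> bool" where
  "metric_connection C G D \<longleftrightarrow>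
     (\<forall>u\<in>sections C. \<forall>v\<in>sections C. \<forall>w\<in>sections C. \<forall>p.
        anchor C p (u p) (\<lambda>q. G q (v q) (w q)) = G p (D u v p) (w p) + G p (v p) (D u w p))"

definition generalised_levi_civita ::
  "('m, 'n::finite, 'k::finite) courant \<Rightarrow> ('m, 'k) form \<Rightarrow> ('m, 'k) conn \<Rightarrow> bool" where
  "generalised_levi_civita C G D \<longleftrightarrow>
     generalised_connection C D \<and> metric_connection C G D \<and>
     (\<forall>u\<in>sections C. \<forall>v\<in>sections C. \<forall>w\<in>sections C. \<forall>p. torsion C D u v w p = 0)"

definition divergence_operator ::
  "('m, 'n::finite, 'k::finite) courant \<Rightarrow> (('m, 'k) sect \<Rightarrow> 'm \<Rightarrow> real) \<Rightarrow> bool" where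
  "divergence_operator C dv \<longleftrightarrow>
     (\<forall>v\<in>sections C. smooth_fun (atlas C) (dv v)) \<and>
     (\<forall>u\<in>sections C. \<forall>v\<in>sections C. \<forall>a b.
        dv (\<lambda>p. a *\<^sub>R u p + b *\<^sub>R v p) = (\<lambda>p. a * dv u p + b * dv v p)) \<and>
     (\<forall>h v. smooth_fun (atlas C) h \<and> v \<in> sections C \<longrightarrow>
        dv (\<lambda>p. h p *\<^sub>R v p) = (\<lambda>p. anchor C p (v p) h + h p * dv v p))"

text \<open>\<open>(D\<^sub>x v)(p)\<close> for \<open>x\<close> in the fibre over \<open>p\<close>; it is well defined because \<open>D\<close> is tensorial in its
  first argument.\<close>

definition conn_at ::
  "('m, 'n::finite, 'k::finite) courant \<Rightarrow> ('m, 'k) conn \<Rightarrow> 'm \<Rightarrow> real^'k \<Rightarrow> ('m, 'k) sect \<Rightarrow> real^'k" where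
  "conn_at C D p x v = (THE y. \<exists>u\<in>sections C. u p = x \<and> y = D u v p)"

definition endo_trace :: "(real^'k \<Rightarrow> real^'k::finite) \<Rightarrow> real" where
  "endo_trace L = trace (matrix L)"

definition has_divergence ::
  "('m, 'n::finite, 'k::finite) courant \<Rightarrow> ('m, 'k) conn \<Rightarrow> (('m, 'k) sect \<Rightarrow> 'm \<Rightarrow> real) \<Rightarrow> bool" where
  "has_divergence C D dv \<longleftrightarrow>
     (\<forall>v\<in>sections C. \<forall>p. dv v p = endo_trace (\<lambda>x. conn_at C D p x v))"

text \<open>For a basis \<open>e\<close> of the fibre, the basis dual to it with respect to the bilinear form \<open>h\<close>,
  \<open>h (dual_basis h e i) (e j) = \<delta>\<^sub>i\<^sub>j\<close>.\<close>

definition gram_inv :: "(real^'k \<Rightarrow> real^'k \<Rightarrow> real) \<Rightarrow> ('k \<Rightarrow> real^'k::finite) \<Rightarrow> real^'k^'k" where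
  "gram_inv h e = matrix_inv (\<chi> i j. h (e i) (e j))"

definition dual_basis ::
  "(real^'k \<Rightarrow> real^'k \<Rightarrow> real) \<Rightarrow> ('k \<Rightarrow> real^'k) \<Rightarrow> 'k \<Rightarrow> real^'k::finite" where
  "dual_basis h e i = (\<Sum>j\<in>UNIV. (gram_inv h e $ i $ j) *\<^sub>R e j)"

definition std_basis :: "'k \<Rightarrow> real^'k::finite" where
  "std_basis i = axis i 1"


section \<open>The canonical generalised Levi-Civita connection\<close>

text \<open>On homogeneous sections only one of the four terms survives: \<open>\<pi>\<^sub>\<epsilon>\<^sup>-\<^sup>1 \<circ> N\<^bsub>\<pi>(u)\<^esub> \<circ> \<pi>\<^sub>\<epsilon>\<close> if \<open>u\<close> and \<open>v\<close>
  lie in the same eigenbundle and the projection of \<open>[u, v]\<close> to the eigenbundle of \<open>v\<close> otherwise.\<close>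

definition pre_connection ::
  "('m, 'n::finite, 'k::finite) courant \<Rightarrow> ('m, 'k) form
     \<Rightarrow> ('m vfield \<Rightarrow> 'm vfield \<Rightarrow> 'm vfield) \<Rightarrow> ('m, 'k) conn" where
  "pre_connection C G N u v = (\<lambda>p. \<Sum>\<epsilon>\<in>{1, -1}.
     lift C G \<epsilon> p
       (N (anchor_sec C (proj_sec C G \<epsilon> u)) (anchor_sec C (proj_sec C G \<epsilon> v)) p) +
     proj C G (-\<epsilon>) p (dorfman C (proj_sec C G \<epsilon> u) (proj_sec C G (-\<epsilon>) v) p))"

definition base_connection ::
  "('m, 'n::finite, 'k::finite) courant \<Rightarrow> ('m, 'k) form \<Rightarrow> ('m, 'k) conn \<Rightarrow> bool" where
  "base_connection C G D0 \<longleftrightarrow>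
     (\<exists>N. levi_civita (atlas C) (base_metric C G) N \<and>
       (\<forall>u\<in>sections C. \<forall>v\<in>sections C. D0 u v \<in> sections C \<and>
         (\<forall>w\<in>sections C. \<forall>p.
           pairing C p (D0 u v p) (w p) =
             pairing C p (pre_connection C G N u v p) (w p)
               - 1/3 * torsion C (pre_connection C G N) u v w p)))"

text \<open>The fibre at \<open>p\<close> of the bundle \<open>so(E)\<^sub>G\<^sup>\<langle>\<^sup>1\<^sup>\<rangle>\<close>.\<close>

definition so_prolong ::
  "('m, 'n::finite, 'k::finite) courant \<Rightarrow> ('m, 'k) form \<Rightarrow> 'm \<Rightarrow> (real^'k \<Rightarrow> real^'k \<Rightarrow> real^'k) set" where
  "so_prolong C G p = {S. bilinear S \<and>
     (\<forall>u v w. pairing C p (S u v) w = - pairing C p v (S u w)) \<and>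
     (\<forall>\<epsilon>\<in>{1, -1}. \<forall>u. \<forall>v\<in>eigenspace C G \<epsilon> p. S u v \<in> eigenspace C G \<epsilon> p) \<and>
     (\<forall>u v w. pairing C p (S u v) w + pairing C p (S v w) u + pairing C p (S w u) v = 0)}"

definition trace_kernel ::
  "('m, 'n::finite, 'k::finite) courant \<Rightarrow> ('m, 'k) form \<Rightarrow> 'm \<Rightarrow> (real^'k \<Rightarrow> real^'k \<Rightarrow> real^'k) set" where
  "trace_kernel C G p = {S \<in> so_prolong C G p. \<forall>v. endo_trace (\<lambda>u. S u v) = 0}"

text \<open>The scalar product induced by \<open>\<langle>\<cdot>,\<cdot>\<rangle>\<close> on \<open>E\<^sup>* \<otimes> End(E)\<close>; it does not depend on the basis.\<close>

definition tensor_pairing ::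
  "('m, 'n::finite, 'k::finite) courant \<Rightarrow> 'm
     \<Rightarrow> (real^'k \<Rightarrow> real^'k \<Rightarrow> real^'k) \<Rightarrow> (real^'k \<Rightarrow> real^'k \<Rightarrow> real^'k) \<Rightarrow> real" where
  "tensor_pairing C p S K =
     (\<Sum>I\<in>UNIV. \<Sum>J\<in>UNIV. pairing C p (S (std_basis I) (std_basis J))
        (K (dual_basis (pairing C p) std_basis I) (dual_basis (pairing C p) std_basis J)))"

text \<open>Such a \<open>D\<close> is unique as an operation on smooth sections; as a HOL function it is arbitrary on
  maps that are not smooth sections, hence a predicate. The same applies to \<open>N\<close> and \<open>D0\<close> above.\<close>

definition canonical_connection ::
  "('m, 'n::finite, 'k::finite) courant \<Rightarrow> ('m, 'k) form \<Rightarrow> (('m, 'k) sect \<Rightarrow> 'm \<Rightarrow> real)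
     \<Rightarrow> ('m, 'k) conn \<Rightarrow> bool" where
  "canonical_connection C G dv D \<longleftrightarrow>
     generalised_levi_civita C G D \<and> has_divergence C D dv \<and>
     (\<exists>D0 S. base_connection C G D0 \<and>
        (\<forall>p. bilinear (S p) \<and>
           (\<forall>u\<in>sections C. \<forall>v\<in>sections C. D u v p - D0 u v p = S p (u p) (v p)) \<and>
           (\<forall>K\<in>trace_kernel C G p. tensor_pairing C p (S p) K = 0)))"


section \<open>The generalised Riemann tensor and the generalised Kretschmann scalar\<close>

definition second_deriv :: "('m, 'k::finite) conn
     \<Rightarrow> ('m, 'k) sect \<Rightarrow> ('m, 'k) sect \<Rightarrow> ('m, 'k) sect \<Rightarrow> ('m, 'k) sect" where
  "second_deriv D v w b = (\<lambda>p. D v (D w b) p - D (D v w) b p)"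

definition riemann ::
  "('m, 'n::finite, 'k::finite) courant \<Rightarrow> ('m, 'k) conn
     \<Rightarrow> ('m, 'k) sect \<Rightarrow> ('m, 'k) sect \<Rightarrow> ('m, 'k) sect \<Rightarrow> ('m, 'k) sect \<Rightarrow> 'm \<Rightarrow> real" where
  "riemann C D a b v w p = 1/2 *
     (pairing C p (second_deriv D v w b p - second_deriv D w v b p) (a p)
      + pairing C p (second_deriv D b a v p - second_deriv D a b v p) (w p)
      - (\<Sum>I\<in>UNIV. pairing C p (conn_at C D p (std_basis I) v) (w p) *
           pairing C p (conn_at C D p (dual_basis (pairing C p) std_basis I) b) (a p)))"

text \<open>The value of the generalised Riemann tensor on elements of the fibre over \<open>p\<close>; it is well
  defined for torsion-free \<open>D\<close>.\<close>

definition riemann_at ::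
  "('m, 'n::finite, 'k::finite) courant \<Rightarrow> ('m, 'k) conn \<Rightarrow> 'm
     \<Rightarrow> real^'k \<Rightarrow> real^'k \<Rightarrow> real^'k \<Rightarrow> real^'k \<Rightarrow> real" where
  "riemann_at C D p x y z t =
     (THE r. \<exists>a\<in>sections C. \<exists>b\<in>sections C. \<exists>v\<in>sections C. \<exists>w\<in>sections C.
        a p = x \<and> b p = y \<and> v p = z \<and> w p = t \<and> r = riemann C D a b v w p)"

definition local_frame ::
  "('m::topological_space, 'n::finite, 'k::finite) courant \<Rightarrow> 'm set \<Rightarrow> ('k \<Rightarrow> ('m, 'k) sect) \<Rightarrow> bool" where
  "local_frame C U e \<longleftrightarrow> open U \<and> (\<forall>I. section_on C U (e I)) \<and>
     (\<forall>p\<in>U. inj (\<lambda>I. e I p) \<and> independent (range (\<lambda>I. e I p)))"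

definition kretschmann_in_frame ::
  "('m, 'n::finite, 'k::finite) courant \<Rightarrow> ('m, 'k) form \<Rightarrow> ('m, 'k) conn
     \<Rightarrow> ('k \<Rightarrow> ('m, 'k) sect) \<Rightarrow> 'm \<Rightarrow> real" where
  "kretschmann_in_frame C G D e p =
     (let Ginv = gram_inv (G p) (\<lambda>I. e I p);
          Rm = (\<lambda>I J K L. riemann_at C D p (e I p) (e J p) (e K p) (e L p))
      in \<Sum>I\<in>UNIV. \<Sum>J\<in>UNIV. \<Sum>K\<in>UNIV. \<Sum>L\<in>UNIV. \<Sum>I'\<in>UNIV. \<Sum>J'\<in>UNIV. \<Sum>K'\<in>UNIV. \<Sum>L'\<in>UNIV.
           Ginv $ I $ I' * Ginv $ J $ J' * Ginv $ K $ K' * Ginv $ L $ L' *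
             Rm I J K L * Rm I' J' K' L')"

text \<open>The common value at \<open>p\<close> of the expression above in all local frames defined near \<open>p\<close>.\<close>

definition kretschmann ::
  "('m::topological_space, 'n::finite, 'k::finite) courant \<Rightarrow> ('m, 'k) form \<Rightarrow> ('m, 'k) conn \<Rightarrow> 'm \<Rightarrow> real" where
  "kretschmann C G D p =
     (THE r. \<exists>U e. local_frame C U e \<and> p \<in> U \<and> r = kretschmann_in_frame C G D e p)"

definition maps_metric_div ::
  "('m, 'n::finite, 'k::finite) courant \<Rightarrow> ('m \<Rightarrow> 'm2) \<Rightarrow> ('m \<Rightarrow> real^'k \<Rightarrow> real^'k)
     \<Rightarrow> ('m, 'k) form \<Rightarrow> (('m, 'k) sect \<Rightarrow> 'm \<Rightarrow> real)
     \<Rightarrow> ('m2, 'k) form \<Rightarrow> (('m2, 'k) sect \<Rightarrow> 'm2 \<Rightarrow> real) \<Rightarrow> bool" where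
  "maps_metric_div C f F G dv G' dv' \<longleftrightarrow>
     (\<forall>p u v. G' (f p) (F p u) (F p v) = G p u v) \<and>
     (\<forall>s\<in>sections C. dv' (push_sec f F s) \<circ> f = dv s)"

definition kretschmann_data ::
  "('m::{t2_space,second_countable_topology}, 'n::finite, 'k::finite) courant \<Rightarrow> ('m, 'k) form
     \<Rightarrow> (('m, 'k) sect \<Rightarrow> 'm \<Rightarrow> real) \<Rightarrow> ('m, 'k) conn \<Rightarrow> bool" where
  "kretschmann_data C G dv D \<longleftrightarrow>
     exact_courant_algebroid C \<and> generalised_metric C G \<and> divergence_operator C dv \<and>
     canonical_connection C G dv D"

end

theory Submission
  imports Defs
begin

text \<open>The generalised Riemann tensor of a torsion-free generalised connection is tensorial in all four
  arguments, so its contraction with the inverse of \<open>G\<close> can be computed in any frame and is smooth.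

  For invariance it suffices that an isomorphism carries \<open>D\<close> to \<open>D'\<close>. The Levi-Civita connection of the
  base metric is natural because the difference of two candidates, lowered with the metric, is
  symmetric in its first two and skew in its last two arguments; hence the connection \<open>D\<^sup>0\<close> is natural.
  The difference of \<open>D\<close> and the pull-back of \<open>D'\<close> is then a traceless element of the first prolongation
  of \<open>so(E)\<^sub>G\<close> that is orthogonal to all such elements. The scalar product on the traceless elements
  is nondegenerate in every signature: test against \<open>x \<otimes> (y \<and> z)\<close> with \<open>x, y, z\<close> in one eigenbundle,
  corrected by its totally skew part and its trace.

  For non-triviality take \<open>TM \<oplus> T\<^sup>*M\<close> over flat space with \<open>H = 0\<close>, the Euclidean metric and
  \<open>D = D\<^sup>0 + S\<close>, where \<open>S\<close> is the constant pure-trace tensor of a unit vector \<open>e\<^sub>1 \<in> E\<^sub>+\<close>. As \<open>G\<close> is positive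
  definite, the scalar is a sum of squares, and \<open>Rm(e\<^sub>1, e\<^sub>2, e\<^sub>1, e\<^sub>2) = -1/2\<close>.\<close>

subsection \<open>Calculus of smooth functions\<close>

text \<open>Brackets, connections and divergences act on global sections, so every fibrewise
  statement (tensoriality, the value of the curvature at a point) needs global sections through
  prescribed fibre vectors. These come from bump functions, hence the calculus on charts. The
  pairing has split signature and \<open>G\<close> may be indefinite, so traces are contractions
  with an inverse Gram matrix, which do not depend on the basis and are carried along by isometries.
  Indefiniteness is also the obstacle to uniqueness: a subspace may meet its orthogonal complement,
  so a traceless tensor orthogonal to all traceless ones vanishes only by a special argument. The
  tensor \<open>P u \<and> \<tau>\<close>, with \<open>P\<close> an eigenprojection, has a double
  use: its scalar product with \<open>S\<close> is \<open>-2 tr(S)(\<tau>)\<close>. Hence it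
  corrects the trace of a test tensor at no cost against traceless \<open>S\<close>, and it is an
  admissible difference \<open>D - D0\<close> in the example, whose divergence operator is taken to
  be that of \<open>D\<close>. Canonical connections are given by a predicate; naturality under the
  identity contains the independence of the scalar from the choice of \<open>D\<close>.\<close>

lemma Ck_cong:
  assumes "open S" "Ck k S f" "\<And>x. x \<in> S \<Longrightarrow> f x = g x"
  shows "Ck k S g"
  using assms
proof (induction k arbitrary: f g)
  case 0
  then show ?case by (auto cong: continuous_on_cong)
next
  case (Suc k)
  have d: "g differentiable (at x)" if "x \<in> S" for x
  proof -
    have "f differentiable (at x)" using Suc.prems that by simp
    then obtain f' where "(f has_derivative f') (at x)" by (auto simp: differentiable_def)
    then have "(g has_derivative f') (at x)"
      using has_derivative_transform_within_open[OF _ \<open>open S\<close> that] Suc.prems(3) by metis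
    then show ?thesis by (auto simp: differentiable_def)
  qed
  have e: "frechet_derivative f (at x) = frechet_derivative g (at x)" if "x \<in> S" for x
    by (rule frechet_derivative_transform_within_open[OF _ \<open>open S\<close> that])
       (use Suc.prems that in auto)
  have "Ck k S (\<lambda>x. frechet_derivative g (at x) v)" for v
    by (rule Suc.IH[of "\<lambda>x. frechet_derivative f (at x) v"]) (use Suc.prems e in auto)
  with d show ?case by simp
qed

text \<open>Lets induction steps work with an explicit formula \<open>f'\<close> for the derivative
  instead of \<open>frechet_derivative\<close>, which is defined by choice.\<close>

lemma Ck_SucI:
  assumes "open S" "\<And>x. x \<in> S \<Longrightarrow> (f has_derivative f' x) (at x)" "\<And>v. Ck k S (\<lambda>x. f' x v)"
  shows "Ck (Suc k) S f"
proof -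
  have "frechet_derivative f (at x) = f' x" if "x \<in> S" for x
    using frechet_derivative_at[OF assms(2)[OF that]] by simp
  then have "Ck k S (\<lambda>x. frechet_derivative f (at x) v)" for v
    using Ck_cong[OF \<open>open S\<close> assms(3)[of v]] by simp
  then show ?thesis using assms(2) by (auto simp: differentiable_def)
qed

lemma Ck_Suc_has_derivative:
  "Ck (Suc k) S f \<Longrightarrow> x \<in> S \<Longrightarrow> (f has_derivative frechet_derivative f (at x)) (at x)"
  by (simp add: frechet_derivative_works)

lemma Ck_SucD: "Ck (Suc k) S f \<Longrightarrow> Ck k S f"
proof (induction k arbitrary: f)
  case 0
  then show ?case
    by (auto intro!: continuous_at_imp_continuous_on differentiable_imp_continuous_within)
next
  case (Suc k)
  then show ?case by (metis Ck.simps(2))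
qed

lemma Ck_subset: "Ck k S f \<Longrightarrow> T \<subseteq> S \<Longrightarrow> Ck k T f"
  by (induction k arbitrary: f) (auto intro: continuous_on_subset)

lemma Ck_const: "Ck k S (\<lambda>x. c)"
  by (induction k arbitrary: c) auto

lemma Ck_linear:
  assumes "bounded_linear L" "open S"
  shows "Ck k S L"
proof (cases k)
  case 0
  then show ?thesis using assms by (simp add: linear_continuous_on)
next
  case (Suc m)
  then show ?thesis
    using Ck_SucI[OF assms(2), of L "\<lambda>x. L"] Ck_const bounded_linear_imp_has_derivative[OF assms(1)]
    by metis
qed

lemma Ck_add:
  assumes "open S" "Ck k S f" "Ck k S g"
  shows "Ck k S (\<lambda>x. f x + g x)"
  using assms
proof (induction k arbitrary: f g)
  case 0
  then show ?case by (simp add: continuous_on_add)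
next
  case (Suc k)
  show ?case
    by (rule Ck_SucI[OF \<open>open S\<close> has_derivative_add[OF Ck_Suc_has_derivative[OF Suc.prems(2)]
            Ck_Suc_has_derivative[OF Suc.prems(3)]]])
       (use Suc in auto)
qed

lemma (in bounded_bilinear) Ck_prod:
  assumes "open S" "Ck k S f" "Ck k S g"
  shows "Ck k S (\<lambda>x. prod (f x) (g x))"
  using assms
proof (induction k arbitrary: f g)
  case 0
  then show ?case by (simp add: continuous_on)
next
  case (Suc k)
  show ?case
  proof (rule Ck_SucI[OF \<open>open S\<close>])
    show "((\<lambda>x. prod (f x) (g x)) has_derivative
        (\<lambda>v. prod (f x) (frechet_derivative g (at x) v) + prod (frechet_derivative f (at x) v) (g x))) (at x)"
      if "x \<in> S" for x
      by (rule FDERIV[OF Ck_Suc_has_derivative[OF Suc.prems(2) that]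
            Ck_Suc_has_derivative[OF Suc.prems(3) that]])
    show "Ck k S (\<lambda>x. prod (f x) (frechet_derivative g (at x) v) + prod (frechet_derivative f (at x) v) (g x))"
      for v
      using Suc Ck_SucD[OF Suc.prems(2)] Ck_SucD[OF Suc.prems(3)] by (intro Ck_add Suc.IH) auto
  qed
qed

lemma Ck_sum:
  assumes "open S" "\<And>i. i \<in> I \<Longrightarrow> Ck k S (f i)"
  shows "Ck k S (\<lambda>x. \<Sum>i\<in>I. f i x)"
  using assms(2) by (induction I rule: infinite_finite_induct) (auto intro: Ck_const Ck_add[OF assms(1)])

text \<open>Up to sign the derivative of \<open>1/f\<close> is the product of \<open>1/f\<close>,
  \<open>f'\<close> and \<open>1/f\<close>, so the regularity of \<open>1/f\<close> rises by one
  order at each step while \<open>f\<close> stays fixed.\<close>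

lemma Ck_inverse:
  fixes f :: "'a::real_normed_vector \<Rightarrow> real"
  assumes "open S" "Ck k S f" "\<And>x. x \<in> S \<Longrightarrow> f x \<noteq> 0"
  shows "Ck k S (\<lambda>x. inverse (f x))"
  using assms
proof (induction k)
  case 0
  then show ?case by (simp add: continuous_on_inverse)
next
  case (Suc k)
  have i: "Ck k S (\<lambda>x. inverse (f x))" using Suc Ck_SucD by blast
  show ?case
  proof (rule Ck_SucI[OF \<open>open S\<close>])
    show "((\<lambda>x. inverse (f x)) has_derivative
        (\<lambda>v. (-1) * (inverse (f x) * frechet_derivative f (at x) v * inverse (f x)))) (at x)"
      if "x \<in> S" for x
      using Deriv.has_derivative_inverse[OF Suc.prems(3)[OF that] Ck_Suc_has_derivative[OF Suc.prems(2) that]]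
      by simp
    show "Ck k S (\<lambda>x. (-1) * (inverse (f x) * frechet_derivative f (at x) v * inverse (f x)))" for v
      using Suc.prems i \<open>open S\<close> by (intro bounded_bilinear.Ck_prod[OF bounded_bilinear_mult] Ck_const) auto
  qed
qed

text \<open>The chain rule applies \<open>g'(f x)\<close> to a direction that varies with
  \<open>x\<close>, whereas \<open>Ck\<close> differentiates in fixed directions. Expanding the
  direction in \<open>Basis\<close> leaves a finite sum of products; this is why the middle space is
  Euclidean.\<close>

lemma Ck_compose:
  fixes f :: "'a::real_normed_vector \<Rightarrow> 'b::euclidean_space" and g :: "'b \<Rightarrow> 'c::real_normed_vector"
  assumes "open S" "open T" "Ck k S f" "Ck k T g" "\<And>x. x \<in> S \<Longrightarrow> f x \<in> T"
  shows "Ck k S (\<lambda>x. g (f x))"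
  using assms
proof (induction k arbitrary: g)
  case 0
  then show ?case
    by (auto intro: continuous_on_compose2)
next
  case (Suc k)
  let ?df = "\<lambda>x. frechet_derivative f (at x)" and ?dg = "\<lambda>y. frechet_derivative g (at y)"
  have lin: "linear (?dg (f x))" if "x \<in> S" for x
    using Suc.prems that by (auto intro!: linear_frechet_derivative)
  show ?case
  proof (rule Ck_SucI[OF \<open>open S\<close>])
    show "((\<lambda>x. g (f x)) has_derivative (\<lambda>v. \<Sum>b\<in>Basis. (?df x v \<bullet> b) *\<^sub>R ?dg (f x) b)) (at x)"
      if "x \<in> S" for x
    proof -
      have "((g \<circ> f) has_derivative (?dg (f x) \<circ> ?df x)) (at x)"
        by (rule diff_chain_at) (use Suc.prems that Ck_Suc_has_derivative in blast)+
      moreover have "(?dg (f x) \<circ> ?df x) = (\<lambda>v. \<Sum>b\<in>Basis. (?df x v \<bullet> b) *\<^sub>R ?dg (f x) b)"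
        unfolding comp_def
        by (subst euclidean_representation[symmetric, of "?df x _"])
           (simp only: linear_sum[OF lin[OF that]] linear_cmul[OF lin[OF that]])
      ultimately show ?thesis by (simp add: comp_def)
    qed
    show "Ck k S (\<lambda>x. \<Sum>b\<in>Basis. (?df x v \<bullet> b) *\<^sub>R ?dg (f x) b)" for v
    proof (intro Ck_sum bounded_bilinear.Ck_prod[OF bounded_bilinear_scaleR] \<open>open S\<close>)
      fix b :: 'b
      show "Ck k S (\<lambda>x. ?df x v \<bullet> b)"
        using Suc.prems by (intro bounded_bilinear.Ck_prod[OF bounded_bilinear_inner] Ck_const) auto
      show "Ck k S (\<lambda>x. ?dg (f x) b)"
        by (rule Suc.IH) (use Suc.prems Ck_SucD[OF Suc.prems(3)] in auto)
    qed
  qed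
qed

lemma Ck_local:
  assumes "open S" "\<And>x. x \<in> S \<Longrightarrow> \<exists>T. open T \<and> x \<in> T \<and> Ck k (S \<inter> T) f"
  shows "Ck k S f"
  using assms(2)
proof (induction k arbitrary: f)
  case 0
  have "isCont f x" if x: "x \<in> S" for x
  proof -
    obtain T where T: "open T" "x \<in> T" "continuous_on (S \<inter> T) f" using 0[OF x] by auto
    show ?thesis using continuous_on_eq_continuous_at[of "S \<inter> T" f] T \<open>open S\<close> x by blast
  qed
  then show ?case by (simp add: continuous_at_imp_continuous_on)
next
  case (Suc k)
  have "Ck k S (\<lambda>x. frechet_derivative f (at x) v)" for v
  proof (rule Suc.IH)
    fix x assume "x \<in> S"
    from Suc.prems[OF this] obtain T where "open T" "x \<in> T" "Ck (Suc k) (S \<inter> T) f" by blast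
    then show "\<exists>T. open T \<and> x \<in> T \<and> Ck k (S \<inter> T) (\<lambda>x. frechet_derivative f (at x) v)"
      by (intro exI[of _ T]) simp
  qed
  moreover have "f differentiable (at x)" if "x \<in> S" for x
  proof -
    from Suc.prems[OF that] obtain T where "x \<in> T" "Ck (Suc k) (S \<inter> T) f" by blast
    then show ?thesis using that by simp
  qed
  ultimately show ?case by simp
qed

section \<open>Closure properties of smooth maps\<close>

lemma smooth_on_cong: "open S \<Longrightarrow> smooth_on S f \<Longrightarrow> (\<And>x. x \<in> S \<Longrightarrow> f x = g x) \<Longrightarrow> smooth_on S g"
  unfolding smooth_on_def using Ck_cong by blast

lemma smooth_on_subset: "smooth_on S f \<Longrightarrow> T \<subseteq> S \<Longrightarrow> smooth_on T f"
  unfolding smooth_on_def using Ck_subset by blast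

lemma smooth_on_const: "smooth_on S (\<lambda>x. c)"
  unfolding smooth_on_def using Ck_const by blast

lemma smooth_on_linear: "bounded_linear L \<Longrightarrow> open S \<Longrightarrow> smooth_on S L"
  unfolding smooth_on_def using Ck_linear by blast

lemma smooth_on_id: "open S \<Longrightarrow> smooth_on S (\<lambda>x. x)"
  by (rule smooth_on_linear[OF bounded_linear_ident])

lemma smooth_on_add: "open S \<Longrightarrow> smooth_on S f \<Longrightarrow> smooth_on S g \<Longrightarrow> smooth_on S (\<lambda>x. f x + g x)"
  unfolding smooth_on_def using Ck_add by blast

lemma (in bounded_bilinear) smooth_on_prod:
  "open S \<Longrightarrow> smooth_on S f \<Longrightarrow> smooth_on S g \<Longrightarrow> smooth_on S (\<lambda>x. prod (f x) (g x))"
  unfolding smooth_on_def using Ck_prod by blast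

lemmas smooth_on_mult = bounded_bilinear.smooth_on_prod[OF bounded_bilinear_mult]
lemmas smooth_on_scaleR = bounded_bilinear.smooth_on_prod[OF bounded_bilinear_scaleR]

lemma smooth_on_sum: "open S \<Longrightarrow> (\<And>i. i \<in> I \<Longrightarrow> smooth_on S (f i)) \<Longrightarrow> smooth_on S (\<lambda>x. \<Sum>i\<in>I. f i x)"
  unfolding smooth_on_def by (simp add: Ck_sum)

lemma smooth_on_inverse:
  fixes f :: "'a::real_normed_vector \<Rightarrow> real"
  shows "open S \<Longrightarrow> smooth_on S f \<Longrightarrow> (\<And>x. x \<in> S \<Longrightarrow> f x \<noteq> 0) \<Longrightarrow> smooth_on S (\<lambda>x. inverse (f x))"
  unfolding smooth_on_def using Ck_inverse by blast

lemma smooth_on_compose: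
  fixes f :: "'a::real_normed_vector \<Rightarrow> 'b::euclidean_space" and g :: "'b \<Rightarrow> 'c::real_normed_vector"
  shows "open S \<Longrightarrow> open T \<Longrightarrow> smooth_on S f \<Longrightarrow> smooth_on T g \<Longrightarrow> (\<And>x. x \<in> S \<Longrightarrow> f x \<in> T)
    \<Longrightarrow> smooth_on S (\<lambda>x. g (f x))"
  unfolding smooth_on_def using Ck_compose[of S T] by blast

lemma smooth_on_linear_compose:
  fixes f :: "'a::real_normed_vector \<Rightarrow> 'b::euclidean_space"
  shows "linear L \<Longrightarrow> open S \<Longrightarrow> smooth_on S f \<Longrightarrow> smooth_on S (\<lambda>x. L (f x))"
  using smooth_on_compose[of S UNIV f L] smooth_on_linear[of L UNIV] linear_conv_bounded_linear by auto

lemma smooth_on_local: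
  assumes "open S" "\<And>x. x \<in> S \<Longrightarrow> \<exists>T. open T \<and> x \<in> T \<and> smooth_on (S \<inter> T) f"
  shows "smooth_on S f"
  using assms Ck_local[OF assms(1)] unfolding smooth_on_def by metis

lemma smooth_on_has_derivative:
  "smooth_on S f \<Longrightarrow> x \<in> S \<Longrightarrow> (f has_derivative frechet_derivative f (at x)) (at x)"
  unfolding smooth_on_def using Ck_Suc_has_derivative by blast

lemma smooth_on_continuous_on: "smooth_on S f \<Longrightarrow> continuous_on S f"
  unfolding smooth_on_def by (metis Ck.simps(1))

lemma smooth_on_frechet_derivative:
  "smooth_on S f \<Longrightarrow> smooth_on S (\<lambda>x. frechet_derivative f (at x) v)"
  unfolding smooth_on_def by (metis Ck.simps(2))

lemma smooth_on_vec:
  fixes f :: "'a::real_normed_vector \<Rightarrow> real^'k"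
  assumes "open S" "\<And>i. smooth_on S (\<lambda>x. f x $ i)"
  shows "smooth_on S f"
proof -
  have "smooth_on S (\<lambda>x. \<Sum>i\<in>UNIV. f x $ i *\<^sub>R axis i (1::real))"
    using assms by (intro smooth_on_sum smooth_on_scaleR smooth_on_const)
  then show ?thesis
    by (rule smooth_on_cong[OF assms(1)]) (simp add: vec_eq_iff axis_def if_distrib cong: if_cong)
qed

lemma smooth_on_vec_nth:
  fixes f :: "'a::real_normed_vector \<Rightarrow> real^'k"
  shows "open S \<Longrightarrow> smooth_on S f \<Longrightarrow> smooth_on S (\<lambda>x. f x $ i)"
  by (rule smooth_on_linear_compose[of "\<lambda>v. v $ i"]) (auto simp: linear_iff)

subsection \<open>Symmetry of second derivatives\<close>

lemma has_derivative_along_line: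
  fixes f :: "'a::real_normed_vector \<Rightarrow> real"
  assumes "(f has_derivative L) (at (c + s *\<^sub>R v))"
  shows "((\<lambda>s. f (c + s *\<^sub>R v)) has_real_derivative L v) (at s)"
proof -
  have "((\<lambda>s. c + s *\<^sub>R v) has_derivative (\<lambda>h. h *\<^sub>R v)) (at s)"
    by (auto intro!: derivative_eq_intros)
  from has_derivative_compose[OF this, of f L] assms
  have "((\<lambda>s. f (c + s *\<^sub>R v)) has_derivative (\<lambda>h. L (h *\<^sub>R v))) (at s)" by simp
  moreover have "L (h *\<^sub>R v) = L v * h" for h
    using linear_cmul[OF has_derivative_linear[OF assms]] by simp
  ultimately show ?thesis by (simp add: has_field_derivative_def)
qed

text \<open>The mean value theorem is used twice: along \<open>v\<close> for the difference of
  \<open>f\<close> between two parallel sides of the parallelogram, and then along \<open>w\<close>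
  for the derivative in direction \<open>v\<close>. The second difference itself is symmetric in
  \<open>v\<close> and \<open>w\<close>.\<close>

lemma second_difference_mean_value:
  fixes f :: "'a::real_normed_vector \<Rightarrow> real"
  assumes f: "smooth_on S f" and h: "h > 0"
    and S: "\<And>s t. 0 \<le> s \<Longrightarrow> s \<le> h \<Longrightarrow> 0 \<le> t \<Longrightarrow> t \<le> h \<Longrightarrow> x + s *\<^sub>R v + t *\<^sub>R w \<in> S"
  shows "\<exists>s t. 0 < s \<and> s < h \<and> 0 < t \<and> t < h \<and>
    f (x + h *\<^sub>R v + h *\<^sub>R w) - f (x + h *\<^sub>R v) - f (x + h *\<^sub>R w) + f x =
      h * h * frechet_derivative (\<lambda>y. frechet_derivative f (at y) v) (at (x + s *\<^sub>R v + t *\<^sub>R w)) w"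
proof -
  define F where "F y = frechet_derivative f (at y) v" for y
  have F: "smooth_on S F" unfolding F_def by (rule smooth_on_frechet_derivative[OF f])
  have d: "((\<lambda>s. f (x + s *\<^sub>R v + t *\<^sub>R w)) has_real_derivative F (x + s *\<^sub>R v + t *\<^sub>R w)) (at s)"
    if "0 \<le> s" "s \<le> h" "0 \<le> t" "t \<le> h" for s t
    using has_derivative_along_line[of f _ "x + t *\<^sub>R w" s v] smooth_on_has_derivative[OF f S[OF that]]
    by (simp add: F_def add_ac)
  have "\<exists>s. 0 < s \<and> s < h \<and>
      (f (x + h *\<^sub>R v + h *\<^sub>R w) - f (x + h *\<^sub>R v + 0 *\<^sub>R w)) -
      (f (x + 0 *\<^sub>R v + h *\<^sub>R w) - f (x + 0 *\<^sub>R v + 0 *\<^sub>R w)) =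
      (h - 0) * (F (x + s *\<^sub>R v + h *\<^sub>R w) - F (x + s *\<^sub>R v + 0 *\<^sub>R w))"
    by (rule MVT2[OF h, of "\<lambda>s. f (x + s *\<^sub>R v + h *\<^sub>R w) - f (x + s *\<^sub>R v + 0 *\<^sub>R w)"
        "\<lambda>s. F (x + s *\<^sub>R v + h *\<^sub>R w) - F (x + s *\<^sub>R v + 0 *\<^sub>R w)", THEN ex_forward])
      (use h in \<open>auto intro!: DERIV_diff d simp del: scaleR_zero_left\<close>)
  then obtain s where s: "0 < s" "s < h"
    "f (x + h *\<^sub>R v + h *\<^sub>R w) - f (x + h *\<^sub>R v) - f (x + h *\<^sub>R w) + f x =
      h * (F (x + s *\<^sub>R v + h *\<^sub>R w) - F (x + s *\<^sub>R v + 0 *\<^sub>R w))"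
    by auto
  have "((\<lambda>t. F (x + s *\<^sub>R v + t *\<^sub>R w)) has_real_derivative
      frechet_derivative F (at (x + s *\<^sub>R v + t *\<^sub>R w)) w) (at t)" if "0 \<le> t" "t \<le> h" for t
    by (rule has_derivative_along_line, rule smooth_on_has_derivative[OF F S[OF _ _ that]]) (use s in auto)
  from MVT2[OF h this] obtain t where "0 < t" "t < h"
    "F (x + s *\<^sub>R v + h *\<^sub>R w) - F (x + s *\<^sub>R v + 0 *\<^sub>R w) =
      (h - 0) * frechet_derivative F (at (x + s *\<^sub>R v + t *\<^sub>R w)) w" by blast
  with s show ?thesis
    by (intro exI[of _ s] exI[of _ t]) (simp add: F_def[abs_def])
qed

text \<open>Both orders of differentiation compute the same second difference divided by
  \<open>h * h\<close>, at two intermediate points close to \<open>x\<close>; continuity of the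
  second derivatives then excludes a gap at \<open>x\<close>.\<close>

lemma second_derivative_symmetric_real:
  fixes f :: "'a::real_normed_vector \<Rightarrow> real"
  assumes "open S" "smooth_on S f" "x \<in> S"
  shows "frechet_derivative (\<lambda>y. frechet_derivative f (at y) v) (at x) w =
    frechet_derivative (\<lambda>y. frechet_derivative f (at y) w) (at x) v"
proof (rule ccontr)
  define A where "A y = frechet_derivative (\<lambda>y. frechet_derivative f (at y) v) (at y) w" for y
  define B where "B y = frechet_derivative (\<lambda>y. frechet_derivative f (at y) w) (at y) v" for y
  have cont: "isCont A x" "isCont B x"
    unfolding A_def B_def using assms
    by (metis continuous_on_eq_continuous_at smooth_on_continuous_on smooth_on_frechet_derivative)+
  assume "frechet_derivative (\<lambda>y. frechet_derivative f (at y) v) (at x) w \<noteq>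
    frechet_derivative (\<lambda>y. frechet_derivative f (at y) w) (at x) v"
  then have e: "\<bar>A x - B x\<bar> / 2 > 0" by (simp add: A_def B_def)
  obtain d1 where d1: "d1 > 0" "\<And>y. dist y x < d1 \<Longrightarrow> \<bar>A y - A x\<bar> < \<bar>A x - B x\<bar> / 2"
    using cont(1) e unfolding continuous_at_eps_delta dist_real_def by blast
  obtain d2 where d2: "d2 > 0" "\<And>y. dist y x < d2 \<Longrightarrow> \<bar>B y - B x\<bar> < \<bar>A x - B x\<bar> / 2"
    using cont(2) e unfolding continuous_at_eps_delta dist_real_def by blast
  obtain d3 where d3: "d3 > 0" "ball x d3 \<subseteq> S" using assms openE by blast
  define d where "d = min d1 (min d2 d3)"
  have d: "d > 0" using d1 d2 d3 by (simp add: d_def)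
  \<comment> \<open>Keeps the whole parallelogram within distance \<open>d / 2\<close> of
    \<open>x\<close>; the summand \<open>1\<close> avoids division by zero when \<open>v\<close> and
    \<open>w\<close> both vanish.\<close>
  define h where "h = d / (2 * (norm v + norm w + 1))"
  have np: "norm v + norm w + 1 > 0" by (smt (verit) norm_ge_zero)
  have h: "h > 0" unfolding h_def using d np by (intro divide_pos_pos) auto
  have near: "dist (x + s *\<^sub>R v + t *\<^sub>R w) x < d" if "0 \<le> s" "s \<le> h" "0 \<le> t" "t \<le> h" for s t
  proof -
    have "norm (s *\<^sub>R v + t *\<^sub>R w) \<le> s * norm v + t * norm w"
      using norm_triangle_ineq[of "s *\<^sub>R v" "t *\<^sub>R w"] that by simp
    also have "\<dots> \<le> h * norm v + h * norm w"
      using that by (intro add_mono mult_right_mono) auto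
    also have "\<dots> \<le> h * (norm v + norm w + 1)" using h by (simp add: algebra_simps)
    also have "\<dots> = d / 2" using np unfolding h_def by (simp add: divide_simps)
    also have "\<dots> < d" using d by simp
    finally show ?thesis by (simp add: dist_norm add.assoc)
  qed
  have S: "x + s *\<^sub>R v + t *\<^sub>R w \<in> S" if "0 \<le> s" "s \<le> h" "0 \<le> t" "t \<le> h" for s t
    using near[OF that] d3 by (auto simp: d_def dist_commute subset_iff)
  obtain s t where st: "0 < s" "s < h" "0 < t" "t < h" 
    "f (x + h *\<^sub>R v + h *\<^sub>R w) - f (x + h *\<^sub>R v) - f (x + h *\<^sub>R w) + f x = h * h * A (x + s *\<^sub>R v + t *\<^sub>R w)"
    using second_difference_mean_value[OF assms(2) h S] unfolding A_def by blast
  have S': "x + s *\<^sub>R w + t *\<^sub>R v \<in> S" if "0 \<le> s" "s \<le> h" "0 \<le> t" "t \<le> h" for s t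
    using S[of t s] that by (simp add: add_ac)
  obtain s' t' where st': "0 < s'" "s' < h" "0 < t'" "t' < h" 
    "f (x + h *\<^sub>R w + h *\<^sub>R v) - f (x + h *\<^sub>R w) - f (x + h *\<^sub>R v) + f x = h * h * B (x + s' *\<^sub>R w + t' *\<^sub>R v)"
    using second_difference_mean_value[OF assms(2) h S'] unfolding B_def by blast
  have "h * h * A (x + s *\<^sub>R v + t *\<^sub>R w) = h * h * B (x + t' *\<^sub>R v + s' *\<^sub>R w)"
  proof -
    have e: "x + h *\<^sub>R w + h *\<^sub>R v = x + h *\<^sub>R v + h *\<^sub>R w"
      "x + s' *\<^sub>R w + t' *\<^sub>R v = x + t' *\<^sub>R v + s' *\<^sub>R w" by (simp_all add: add_ac)
    show ?thesis using st(5) st'(5)[unfolded e] by linarith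
  qed
  then have "A (x + s *\<^sub>R v + t *\<^sub>R w) = B (x + t' *\<^sub>R v + s' *\<^sub>R w)" using h by simp
  moreover have "\<bar>A (x + s *\<^sub>R v + t *\<^sub>R w) - A x\<bar> < \<bar>A x - B x\<bar> / 2"
    using near[of s t] st by (intro d1) (simp add: d_def)
  moreover have "\<bar>B (x + t' *\<^sub>R v + s' *\<^sub>R w) - B x\<bar> < \<bar>A x - B x\<bar> / 2"
    using near[of t' s'] st' by (intro d2) (simp add: d_def)
  ultimately show False by (smt (verit) field_sum_of_halves)
qed

lemma frechet_derivative_vec_nth:
  fixes f :: "'a::real_normed_vector \<Rightarrow> real^'k"
  assumes "f differentiable (at x)"
  shows "frechet_derivative f (at x) v $ i = frechet_derivative (\<lambda>y. f y $ i) (at x) v"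
proof -
  have "((\<lambda>y. f y $ i) has_derivative (\<lambda>v. frechet_derivative f (at x) v $ i)) (at x)"
    using assms by (intro bounded_linear.has_derivative[OF bounded_linear_vec_nth])
      (simp add: frechet_derivative_works)
  from frechet_derivative_at[OF this] show ?thesis by metis
qed

lemma smooth_on_differentiable: "smooth_on S f \<Longrightarrow> x \<in> S \<Longrightarrow> f differentiable (at x)"
  using smooth_on_has_derivative by (auto simp: differentiable_def)

text \<open>Reduced to components, because the mean value theorem behind the real case fails for
  vector-valued functions.\<close>

lemma second_derivative_symmetric:
  fixes f :: "'a::real_normed_vector \<Rightarrow> real^'k"
  assumes "open S" "smooth_on S f" "x \<in> S"
  shows "frechet_derivative (\<lambda>y. frechet_derivative f (at y) v) (at x) w =
    frechet_derivative (\<lambda>y. frechet_derivative f (at y) w) (at x) v"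
proof -
  have "frechet_derivative (\<lambda>y. frechet_derivative f (at y) v) (at x) w $ i =
    frechet_derivative (\<lambda>y. frechet_derivative (\<lambda>z. f z $ i) (at y) v) (at x) w" for i v w
  proof -
    have "frechet_derivative (\<lambda>y. frechet_derivative f (at y) v) (at x) w $ i =
        frechet_derivative (\<lambda>y. frechet_derivative f (at y) v $ i) (at x) w"
      using assms by (intro frechet_derivative_vec_nth smooth_on_differentiable[of S] smooth_on_frechet_derivative)
    also have "frechet_derivative (\<lambda>y. frechet_derivative f (at y) v $ i) (at x) =
        frechet_derivative (\<lambda>y. frechet_derivative (\<lambda>z. f z $ i) (at y) v) (at x)"
    proof (rule frechet_derivative_transform_within_open[OF _ \<open>open S\<close> \<open>x \<in> S\<close>])
      show "(\<lambda>y. frechet_derivative f (at y) v $ i) differentiable at x"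
        using assms smooth_on_vec_nth smooth_on_frechet_derivative smooth_on_differentiable by blast
    qed (use assms in \<open>auto intro!: frechet_derivative_vec_nth smooth_on_differentiable[of S]\<close>)
    finally show ?thesis .
  qed
  moreover have "frechet_derivative (\<lambda>y. frechet_derivative (\<lambda>z. f z $ i) (at y) v) (at x) w =
    frechet_derivative (\<lambda>y. frechet_derivative (\<lambda>z. f z $ i) (at y) w) (at x) v" for i
    using assms by (intro second_derivative_symmetric_real[of S] smooth_on_vec_nth)
  ultimately show ?thesis by (simp add: vec_eq_iff)
qed

subsection \<open>Bump functions\<close>

text \<open>The class of these functions is closed under differentiation.\<close>

definition flat_exp :: "real poly \<Rightarrow> real \<Rightarrow> real" where
  "flat_exp P t = (if t \<le> 0 then 0 else poly P (inverse t) * exp (- inverse t))"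

lemma poly_times_exp_tendsto_0: "((\<lambda>x::real. poly P x * exp (- x)) \<longlongrightarrow> 0) at_top"
proof -
  have "((\<lambda>x::real. \<Sum>i\<le>degree P. coeff P i * (x ^ i / exp x)) \<longlongrightarrow> (\<Sum>i\<le>degree P. coeff P i * 0)) at_top"
    by (intro tendsto_sum tendsto_mult tendsto_const tendsto_power_div_exp_0)
  then show ?thesis
    by (simp add: poly_altdef sum_distrib_right exp_minus divide_inverse mult.assoc)
qed

text \<open>With \<open>x = 1/t\<close> one has \<open>d/dt = - x^2 d/dx\<close>, which sends
  \<open>P(x) exp(-x)\<close> to \<open>x^2 (P - P')(x) exp(-x)\<close>; the factor
  \<open>[:0, 0, 1:]\<close> is \<open>x^2\<close>. At \<open>0\<close> the right difference
  quotient is the same kind of function with \<open>x P\<close> in place of \<open>P\<close>, so it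
  tends to \<open>0\<close>.\<close>

lemma flat_exp_has_derivative:
  "(flat_exp P has_real_derivative flat_exp ([:0, 0, 1:] * (P - pderiv P)) t) (at t)"
proof -
  consider "t < 0" | "t = 0" | "t > 0" by linarith
  then show ?thesis
  proof cases
    case 1
    have "((\<lambda>t. 0) has_real_derivative 0) (at t)" by simp
    then have "(flat_exp P has_real_derivative 0) (at t)"
      by (rule has_field_derivative_transform_within_open[where S = "{..<0}"])
         (use 1 in \<open>auto simp: flat_exp_def\<close>)
    then show ?thesis using 1 by (simp add: flat_exp_def)
  next
    case 3
    have "((\<lambda>t. poly P (inverse t) * exp (- inverse t)) has_real_derivative
        flat_exp ([:0, 0, 1:] * (P - pderiv P)) t) (at t)"
      using 3 by (auto intro!: derivative_eq_intros DERIV_chain'[where g = "poly P"] poly_DERIV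
          simp: flat_exp_def algebra_simps power2_eq_square)
    then show ?thesis
      by (rule has_field_derivative_transform_within_open[where S = "{0<..}"])
         (use 3 in \<open>auto simp: flat_exp_def\<close>)
  next
    case 2
    have "((\<lambda>h. flat_exp P h / h) \<longlongrightarrow> 0) (at_left 0)"
      by (rule tendsto_eventually) (auto simp: flat_exp_def eventually_at_filter)
    moreover have "((\<lambda>h. flat_exp P h / h) \<longlongrightarrow> 0) (at_right 0)"
    proof (rule Lim_transform_eventually)
      show "((\<lambda>h. poly (pCons 0 P) (inverse h) * exp (- inverse h)) \<longlongrightarrow> 0) (at_right 0)"
        by (rule filterlim_compose[OF poly_times_exp_tendsto_0 filterlim_inverse_at_top_right])
      show "\<forall>\<^sub>F h in at_right 0. poly (pCons 0 P) (inverse h) * exp (- inverse h) = flat_exp P h / h"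
        by (auto simp: flat_exp_def eventually_at_filter divide_inverse)
    qed
    ultimately have "((\<lambda>h. flat_exp P h / h) \<longlongrightarrow> 0) (at 0)"
      by (rule filterlim_split_at)
    then show ?thesis using 2 by (simp add: has_field_derivative_iff flat_exp_def[of _ 0])
  qed
qed

lemma smooth_on_flat_exp: "smooth_on UNIV (flat_exp P)"
proof -
  have "Ck k UNIV (flat_exp P)" for k
  proof (induction k arbitrary: P)
    case 0
    show ?case
      using DERIV_isCont[OF flat_exp_has_derivative] by (auto intro!: continuous_at_imp_continuous_on)
  next
    case (Suc k)
    show ?case
    proof (rule Ck_SucI)
      show "(flat_exp P has_derivative (\<lambda>v. flat_exp ([:0, 0, 1:] * (P - pderiv P)) t * v)) (at t)" for t
        using flat_exp_has_derivative by (simp only: has_field_derivative_def)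
      show "Ck k UNIV (\<lambda>t. flat_exp ([:0, 0, 1:] * (P - pderiv P)) t * v)" for v
        by (intro bounded_bilinear.Ck_prod[OF bounded_bilinear_mult] Suc.IH Ck_const) auto
    qed auto
  qed
  then show ?thesis by (simp add: smooth_on_def)
qed

lemma bump_on_ball:
  fixes p :: "'a::euclidean_space"
  assumes "r > 0"
  shows "\<exists>\<rho>::'a \<Rightarrow> real. smooth_on UNIV \<rho> \<and> \<rho> p = 1 \<and> (\<forall>x. x \<notin> ball p r \<longrightarrow> \<rho> x = 0)"
proof (intro exI conjI allI impI)
  \<comment> \<open>The squared norm is smooth also at the centre. Since
    \<open>flat_exp 1 (r^2)\<close> is \<open>exp (- 1/r^2)\<close>, the prefactor makes the value
    at \<open>p\<close> equal to \<open>1\<close>.\<close>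
  let ?\<rho> = "\<lambda>x::'a. exp (inverse (r\<^sup>2)) * flat_exp 1 (r\<^sup>2 + (-1) * ((x + (-p)) \<bullet> (x + (-p))))"
  show "smooth_on UNIV ?\<rho>"
    by (intro smooth_on_mult smooth_on_const smooth_on_compose[OF _ _ _ smooth_on_flat_exp] smooth_on_add
        bounded_bilinear.smooth_on_prod[OF bounded_bilinear_inner] smooth_on_id) auto
  show "?\<rho> p = 1" using assms by (simp add: flat_exp_def flip: exp_add)
  show "?\<rho> x = 0" if "x \<notin> ball p r" for x
  proof -
    have "r\<^sup>2 \<le> (norm (x - p))\<^sup>2"
      using that assms by (intro power_mono) (auto simp: dist_norm norm_minus_commute)
    then show ?thesis by (simp add: flat_exp_def power2_norm_eq_inner)
  qed
qed

subsection \<open>Nondegenerate symmetric bilinear forms\<close>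

text \<open>No sign condition is imposed: the locale has to cover the pairing, which has split
  signature, and generalised metrics of any signature.\<close>

locale nondegenerate_form =
  fixes h :: "real^'k \<Rightarrow> real^'k \<Rightarrow> real"
  assumes bil: "bilinear h" and sym: "h u v = h v u"
    and nondeg: "(\<And>v. h u v = 0) \<Longrightarrow> u = 0"
begin

lemmas form_simps =
  bilinear_ladd[OF bil] bilinear_radd[OF bil] bilinear_lmul[OF bil] bilinear_rmul[OF bil]
  bilinear_lneg[OF bil] bilinear_rneg[OF bil] bilinear_lsub[OF bil] bilinear_rsub[OF bil]
  bilinear_lzero[OF bil] bilinear_rzero[OF bil]

lemma linear_left: "linear (\<lambda>x. h x y)" and linear_right: "linear (h x)"
  using bil by (simp_all add: bilinear_def)

lemmas sum_left = linear_sum[OF linear_left] and sum_right = linear_sum[OF linear_right]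

lemma eqI: "(\<And>w. h u w = h v w) \<Longrightarrow> u = v"
  using nondeg[of "u - v"] by (simp add: form_simps)

end

lemma basis_span:
  fixes e :: "'k::finite \<Rightarrow> real^'k"
  assumes "inj e" "independent (range e)"
  shows "span (range e) = UNIV"
  using card_ge_dim_independent[of "range e" UNIV] assms by (auto simp: card_image)

lemma basis_expansion:
  fixes e :: "'k::finite \<Rightarrow> real^'k"
  assumes "inj e" "independent (range e)"
  obtains c where "x = (\<Sum>i\<in>UNIV. c i *\<^sub>R e i)"
proof -
  have "x \<in> span (range e)" using basis_span[OF assms] by simp
  then obtain u where "x = (\<Sum>v\<in>range e. u v *\<^sub>R v)"
    using span_finite[of "range e"] by auto
  then have "x = (\<Sum>i\<in>UNIV. u (e i) *\<^sub>R e i)" using assms(1) by (simp add: sum.reindex)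
  then show ?thesis by (rule that)
qed

lemma basis_coeff_zero:
  fixes e :: "'k::finite \<Rightarrow> real^'k"
  assumes "inj e" "independent (range e)" "(\<Sum>i\<in>UNIV. c i *\<^sub>R e i) = 0"
  shows "c i = 0"
proof -
  have "(\<Sum>v\<in>range e. c (inv e v) *\<^sub>R v) = 0" using assms(1,3) by (simp add: sum.reindex)
  then have "\<forall>v\<in>range e. c (inv e v) = 0"
    using conjunct2[OF iffD1[OF independent_explicit assms(2)], rule_format, of "\<lambda>v. c (inv e v)"] by blast
  then show ?thesis using assms(1) by simp
qed

lemma std_basis_basis: "inj (std_basis :: 'k::finite \<Rightarrow> real^'k)"
  "independent (range (std_basis :: 'k::finite \<Rightarrow> real^'k))"
proof -
  show "inj (std_basis :: 'k \<Rightarrow> real^'k)" by (auto simp: inj_def std_basis_def axis_eq_axis)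
  have "range (std_basis :: 'k \<Rightarrow> real^'k) = Basis" by (auto simp: std_basis_def Basis_vec_def)
  then show "independent (range (std_basis :: 'k \<Rightarrow> real^'k))" by (simp add: independent_Basis)
qed

lemma std_basis_expansion: "(\<Sum>i\<in>UNIV. x $ i *\<^sub>R std_basis i) = x"
  by (simp add: vec_eq_iff std_basis_def axis_def if_distrib cong: if_cong)

text \<open>A kernel vector of the Gram matrix lists the coefficients of a vector orthogonal to the
  basis, hence to everything.\<close>

lemma (in nondegenerate_form) gram_invertible:
  assumes "inj e" "independent (range e)"
  shows "invertible ((\<chi> i j. h (e i) (e j)) :: real^'k^'k)"
proof -
  let ?A = "(\<chi> i j. h (e i) (e j)) :: real^'k^'k"
  have "c = 0" if "?A *v c = 0" for c
  proof -
    let ?x = "\<Sum>j\<in>UNIV. c $ j *\<^sub>R e j"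
    have "h ?x (e i) = 0" for i
    proof -
      have "(?A *v c) $ i = 0" using that by simp
      then show ?thesis
        by (simp add: matrix_vector_mult_def sum_left form_simps sym[of "e i"] mult.commute)
    qed
    then have "h ?x y = 0" for y
      by (rule_tac basis_expansion[OF assms, of y]) (simp add: sum_right form_simps)
    then have "?x = 0" by (rule nondeg)
    then show ?thesis using basis_coeff_zero[OF assms] by (simp add: vec_eq_iff)
  qed
  then have "\<exists>B. B ** ?A = mat 1" using matrix_left_invertible_ker[of ?A] by auto
  then show ?thesis using invertible_left_inverse by blast
qed

lemma matrix_inv_invertible:
  assumes "invertible A"
  shows "A ** matrix_inv A = mat 1" "matrix_inv A ** A = mat 1"
  using someI_ex[OF assms[unfolded invertible_def]] by (simp_all add: matrix_inv_def)

section \<open>Dual bases and contractions with the inverse of a form\<close>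

context nondegenerate_form
begin

context
  fixes e :: "'k \<Rightarrow> real^'k"
  assumes e: "inj e" "independent (range e)"
begin

lemma gram_inv_left: "(\<Sum>j\<in>UNIV. gram_inv h e $ i $ j * h (e j) (e l)) = (if i = l then 1 else 0)"
  using matrix_inv_invertible(2)[OF gram_invertible[OF e]]
  by (auto simp: vec_eq_iff matrix_matrix_mult_def mat_def gram_inv_def)

lemma dual_basis_delta: "h (dual_basis h e i) (e l) = (if i = l then 1 else 0)"
  by (simp add: dual_basis_def sum_left form_simps gram_inv_left)

lemma expand_basis: "(\<Sum>i\<in>UNIV. h x (dual_basis h e i) *\<^sub>R e i) = x"
proof -
  obtain c where c: "x = (\<Sum>i\<in>UNIV. c i *\<^sub>R e i)" by (rule basis_expansion[OF e])
  have "h x (dual_basis h e i) = c i" for i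
    unfolding c by (simp add: sum_left form_simps sym[of "e _" "dual_basis h e i"] dual_basis_delta
        if_distrib cong: if_cong)
  then show ?thesis using c by simp
qed

lemma expand_dual_basis: "(\<Sum>i\<in>UNIV. h x (e i) *\<^sub>R dual_basis h e i) = x"
proof (rule eqI)
  fix w
  obtain c where c: "w = (\<Sum>i\<in>UNIV. c i *\<^sub>R e i)" by (rule basis_expansion[OF e])
  show "h (\<Sum>i\<in>UNIV. h x (e i) *\<^sub>R dual_basis h e i) w = h x w"
    unfolding c by (simp add: sum_left sum_right form_simps dual_basis_delta if_distrib cong: if_cong)
qed

end

text \<open>The contraction \<open>h^{ij} \<beta>_{ij}\<close> with the inverse of \<open>h\<close>;
  the standard basis only serves to write it down.\<close>

definition ctr :: "(real^'k \<Rightarrow> real^'k \<Rightarrow> real) \<Rightarrow> real" where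
  "ctr \<beta> = (\<Sum>i\<in>UNIV. \<beta> (std_basis i) (dual_basis h std_basis i))"

text \<open>Expand the standard basis vectors in \<open>e\<close>; moving the coefficients to the
  second slot turns the dual standard basis into the dual of \<open>e\<close>.\<close>

lemma ctr_dual_basis:
  assumes "bilinear \<beta>" "inj e" "independent (range e)"
  shows "ctr \<beta> = (\<Sum>i\<in>UNIV. \<beta> (e i) (dual_basis h e i))"
proof -
  let ?s = "std_basis :: 'k \<Rightarrow> real^'k" and ?d = "dual_basis h std_basis"
  have ll: "linear (\<lambda>x. \<beta> x y)" and lr: "linear (\<beta> x)" for x y
    using assms(1) by (simp_all add: bilinear_def)
  have "ctr \<beta> = (\<Sum>a\<in>UNIV. \<beta> (\<Sum>i\<in>UNIV. h (?s a) (dual_basis h e i) *\<^sub>R e i) (?d a))"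
    unfolding ctr_def by (subst expand_basis[OF assms(2,3)]) simp
  also have "\<dots> = (\<Sum>a\<in>UNIV. \<Sum>i\<in>UNIV. h (dual_basis h e i) (?s a) * \<beta> (e i) (?d a))"
    by (simp add: linear_sum[OF ll] linear_cmul[OF ll] sym)
  also have "\<dots> = (\<Sum>i\<in>UNIV. \<Sum>a\<in>UNIV. h (dual_basis h e i) (?s a) * \<beta> (e i) (?d a))"
    by (rule sum.swap)
  also have "\<dots> = (\<Sum>i\<in>UNIV. \<beta> (e i) (\<Sum>a\<in>UNIV. h (dual_basis h e i) (?s a) *\<^sub>R ?d a))"
    by (simp add: linear_sum[OF lr] linear_cmul[OF lr])
  finally show ?thesis by (simp add: expand_dual_basis[OF std_basis_basis])
qed

lemma ctr_gram_inv:
  assumes "bilinear \<beta>" "inj e" "independent (range e)"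
  shows "ctr \<beta> = (\<Sum>i\<in>UNIV. \<Sum>j\<in>UNIV. gram_inv h e $ i $ j * \<beta> (e i) (e j))"
proof -
  have lr: "linear (\<beta> x)" for x
    using assms(1) by (simp_all add: bilinear_def)
  show ?thesis
    unfolding ctr_dual_basis[OF assms] dual_basis_def by (simp add: linear_sum[OF lr] linear_cmul[OF lr])
qed

lemma gram_inv_sym:
  assumes "inj e" "independent (range e)"
  shows "gram_inv h e $ i $ j = gram_inv h e $ j $ i"
proof -
  have d: "h (dual_basis h e i) (dual_basis h e j) = gram_inv h e $ j $ i" for i j
  proof -
    have "h (dual_basis h e i) (dual_basis h e j) =
        (\<Sum>l\<in>UNIV. gram_inv h e $ j $ l * h (dual_basis h e i) (e l))"
      unfolding dual_basis_def[of h e j] by (simp add: sum_right form_simps)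
    then show ?thesis by (simp add: dual_basis_delta[OF assms] if_distrib cong: if_cong)
  qed
  show ?thesis using d[of i j] d[of j i] sym by metis
qed

lemma ctr_flip:
  assumes "bilinear \<beta>"
  shows "ctr (\<lambda>x y. \<beta> y x) = ctr \<beta>"
proof -
  have b: "bilinear (\<lambda>x y. \<beta> y x)" using assms by (simp add: bilinear_def)
  have "ctr (\<lambda>x y. \<beta> y x) =
      (\<Sum>i\<in>UNIV. \<Sum>j\<in>UNIV. gram_inv h std_basis $ i $ j * \<beta> (std_basis j) (std_basis i))"
    by (rule ctr_gram_inv[OF b std_basis_basis])
  also have "\<dots> = (\<Sum>j\<in>UNIV. \<Sum>i\<in>UNIV. gram_inv h std_basis $ j $ i * \<beta> (std_basis j) (std_basis i))"
    by (subst sum.swap) (simp add: gram_inv_sym[OF std_basis_basis])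
  finally show ?thesis using ctr_gram_inv[OF assms std_basis_basis] by simp
qed

lemma ctr_add: "ctr (\<lambda>x y. \<beta> x y + \<gamma> x y) = ctr \<beta> + ctr \<gamma>"
  and ctr_diff: "ctr (\<lambda>x y. \<beta> x y - \<gamma> x y) = ctr \<beta> - ctr \<gamma>"
  and ctr_cmul: "ctr (\<lambda>x y. c * \<beta> x y) = c * ctr \<beta>"
  by (simp_all add: ctr_def sum.distrib sum_subtractf sum_distrib_left)

lemma ctr_left:
  assumes "linear f"
  shows "ctr (\<lambda>x y. f x * h a y) = f a"
proof -
  have "f a = f (\<Sum>i\<in>UNIV. h a (dual_basis h std_basis i) *\<^sub>R std_basis i)"
    by (simp add: expand_basis[OF std_basis_basis])
  then show ?thesis by (simp add: ctr_def linear_sum[OF assms] linear_cmul[OF assms] mult.commute)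
qed

lemma ctr_right:
  assumes "linear f"
  shows "ctr (\<lambda>x y. h a x * f y) = f a"
proof -
  have "f a = f (\<Sum>i\<in>UNIV. h a (std_basis i) *\<^sub>R dual_basis h std_basis i)"
    by (simp add: expand_dual_basis[OF std_basis_basis])
  then show ?thesis by (simp add: ctr_def linear_sum[OF assms] linear_cmul[OF assms])
qed

text \<open>Expresses the trace through \<open>h\<close>, on which it does not depend, so that
  traces obey the same product and transport rules as all other contractions.\<close>

lemma endo_trace_eq_ctr:
  assumes "linear L"
  shows "endo_trace L = ctr (\<lambda>x y. h (L x) y)"
proof -
  have "h x (dual_basis h std_basis i) = x $ i" for x i
  proof -
    have "h x (dual_basis h std_basis i) = h (\<Sum>j\<in>UNIV. x $ j *\<^sub>R std_basis j) (dual_basis h std_basis i)"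
      by (simp add: std_basis_expansion)
    also have "\<dots> = (\<Sum>j\<in>UNIV. x $ j * h (dual_basis h std_basis i) (std_basis j))"
      by (simp add: sum_left form_simps sym[of "dual_basis h std_basis i"])
    finally show ?thesis
      by (simp add: dual_basis_delta[OF std_basis_basis] if_distrib cong: if_cong)
  qed
  then show ?thesis
    by (simp add: endo_trace_def trace_def matrix_def ctr_def std_basis_def)
qed

lemma bilinear_form_comp: "linear L \<Longrightarrow> bilinear (\<lambda>x y. h (L x) y)"
  "linear L \<Longrightarrow> bilinear (\<lambda>x y. h x (L y))"
  by (auto simp: bilinear_def linear_iff form_simps)

end

text \<open>The images of the standard basis under \<open>F\<close> have the same Gram matrix as the
  standard basis, and a contraction may be computed in any basis. This is how traces pass from one
  algebroid to another.\<close>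

lemma ctr_isometry:
  fixes h h' :: "real^'k \<Rightarrow> real^'k \<Rightarrow> real"
  assumes h: "nondegenerate_form h" "nondegenerate_form h'"
    and F: "linear F" "bij F" "\<And>x y. h' (F x) (F y) = h x y" and \<beta>: "bilinear \<beta>"
  shows "nondegenerate_form.ctr h' \<beta> = nondegenerate_form.ctr h (\<lambda>x y. \<beta> (F x) (F y))"
proof -
  interpret h: nondegenerate_form h by fact
  interpret h': nondegenerate_form h' by fact
  let ?e = "\<lambda>i. F (std_basis i)"
  have "inj F" using F(2) by (simp add: bij_is_inj)
  have e: "inj ?e" using \<open>inj F\<close> std_basis_basis(1) by (auto simp: inj_def)
  have "independent (F ` range std_basis)"
    using inj_on_subset[OF \<open>inj F\<close>]
    by (intro linear_independent_injective_image[OF F(1)] std_basis_basis) auto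
  then have e2: "independent (range ?e)" by (simp add: image_image)
  have b: "bilinear (\<lambda>x y. \<beta> (F x) (F y))"
    using \<beta> F(1) by (auto simp: bilinear_def linear_iff)
  have "gram_inv h' ?e = gram_inv h std_basis" by (simp add: gram_inv_def F(3))
  then show ?thesis
    using h'.ctr_gram_inv[OF \<beta> e e2] h.ctr_gram_inv[OF b std_basis_basis] by simp
qed

text \<open>Expanding \<open>P x\<close> in a basis of the range, each basis vector contributes
  \<open>c b b = 1\<close>. Serves to recognise a one-dimensional eigenspace by its trace.\<close>

lemma trace_projection:
  fixes P :: "real^'k \<Rightarrow> real^'k"
  assumes "linear P" "\<And>x. P (P x) = P x"
  shows "endo_trace P = dim (range P)"
proof -
  obtain B where B: "B \<subseteq> range P" "independent B" "range P \<subseteq> span B" "card B = dim (range P)"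
    using basis_exists by blast
  have "subspace (range P)" using assms(1) by (simp add: linear_subspace_image)
  then have sB: "span B = range P" using B by (simp add: span_minimal subset_antisym)
  have fin: "finite B" using B(2) by (rule independent_imp_finite)
  define c where "c b x = representation B (P x) b" for b x
  have lin: "linear (c b)" for b
    unfolding c_def linear_iff using B(2) sB
    by (auto simp: linear_add[OF assms(1)] linear_cmul[OF assms(1)] representation_add representation_scale)
  have c: "P x = (\<Sum>b\<in>B. c b x *\<^sub>R b)" for x
    unfolding c_def using B(2) sB fin by (subst sum_representation_eq) auto
  have "c b b = 1" if "b \<in> B" for b
  proof -
    have "P b = b" using that B(1) assms(2) by auto
    then show ?thesis using representation_basis[OF B(2) that] by (simp add: c_def)
  qed
  note cb = this
  have "endo_trace P = (\<Sum>i\<in>UNIV. \<Sum>b\<in>B. c b (axis i 1) * b $ i)"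
    by (simp add: endo_trace_def trace_def matrix_def c[of "axis _ 1"])
  also have "\<dots> = (\<Sum>b\<in>B. \<Sum>i\<in>UNIV. c b (axis i 1) * b $ i)" by (rule sum.swap)
  also have "\<dots> = (\<Sum>b\<in>B. c b b)"
  proof (rule sum.cong[OF refl])
    fix b
    have "c b b = c b (\<Sum>i\<in>UNIV. b $ i *\<^sub>R std_basis i)" by (simp only: std_basis_expansion)
    then show "(\<Sum>i\<in>UNIV. c b (axis i 1) * b $ i) = c b b"
      by (simp add: linear_sum[OF lin] linear_cmul[OF lin] std_basis_def mult.commute)
  qed
  also have "\<dots> = card B" by (simp add: cb)
  finally show ?thesis using B(4) by simp
qed

subsection \<open>The first prolongation of an orthogonal involution\<close>

lemma (in nondegenerate_form) ctr_elementary: "ctr (\<lambda>x y. h a x * h b y) = h a b"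
  using ctr_right[OF linear_right[of b], of a] by (simp add: sym)

text \<open>The fibrewise data of a generalised metric: \<open>h\<close> is the scalar product and
  \<Theta> the endomorphism belonging to \<open>G\<close>.\<close>

locale orthogonal_involution = nondegenerate_form h for h :: "real^'k \<Rightarrow> real^'k \<Rightarrow> real" +
  fixes \<Theta> :: "real^'k \<Rightarrow> real^'k"
  assumes lin: "linear \<Theta>" and invol: "\<Theta> (\<Theta> u) = u" and adj: "h (\<Theta> u) v = h u (\<Theta> v)"
begin

definition eig :: "real \<Rightarrow> (real^'k) set" where "eig \<epsilon> = {u. \<Theta> u = \<epsilon> *\<^sub>R u}"

definition eproj :: "real \<Rightarrow> real^'k \<Rightarrow> real^'k" where "eproj \<epsilon> u = (1/2) *\<^sub>R (u + \<epsilon> *\<^sub>R \<Theta> u)"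

lemma linear_eproj: "linear (eproj \<epsilon>)"
  by (auto simp: linear_iff eproj_def linear_add[OF lin] linear_cmul[OF lin] algebra_simps)

lemma eproj_in_eig: "\<epsilon> \<in> {1, -1} \<Longrightarrow> eproj \<epsilon> u \<in> eig \<epsilon>"
  by (auto simp: eig_def eproj_def linear_add[OF lin] linear_cmul[OF lin] linear_neg[OF lin]
      linear_diff[OF lin] invol algebra_simps)

lemma eproj_id: "\<epsilon> \<in> {1, -1} \<Longrightarrow> u \<in> eig \<epsilon> \<Longrightarrow> eproj \<epsilon> u = u"
  by (auto simp: eig_def eproj_def vec_eq_iff)

lemma eproj_sum: "\<epsilon> \<in> {1, -1} \<Longrightarrow> eproj \<epsilon> u + eproj (-\<epsilon>) u = u"
  by (auto simp: eproj_def vec_eq_iff field_simps)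

lemma eproj_adjoint: "h (eproj \<epsilon> u) v = h u (eproj \<epsilon> v)"
  by (simp add: eproj_def form_simps adj)

lemma range_eproj:
  assumes "\<epsilon> \<in> {1, -1}"
  shows "range (eproj \<epsilon>) = eig \<epsilon>"
proof
  show "range (eproj \<epsilon>) \<subseteq> eig \<epsilon>" using eproj_in_eig[OF assms] by blast
  show "eig \<epsilon> \<subseteq> range (eproj \<epsilon>)"
  proof
    fix u assume "u \<in> eig \<epsilon>"
    then show "u \<in> range (eproj \<epsilon>)" using eproj_id[OF assms] by (intro range_eqI[of _ _ u]) simp
  qed
qed

lemma eig_orthogonal:
  assumes "\<epsilon> \<in> {1, -1}" "u \<in> eig \<epsilon>" "v \<in> eig (-\<epsilon>)"
  shows "h u v = 0"
proof -
  have "\<epsilon> * h u v = - \<epsilon> * h u v"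
    using adj[of u v] assms by (simp add: eig_def form_simps)
  then show ?thesis using assms(1) by auto
qed

lemma eig_combine:
  "u \<in> eig \<epsilon> \<Longrightarrow> v \<in> eig \<epsilon> \<Longrightarrow> u + v \<in> eig \<epsilon>"
  "u \<in> eig \<epsilon> \<Longrightarrow> v \<in> eig \<epsilon> \<Longrightarrow> u - v \<in> eig \<epsilon>"
  "u \<in> eig \<epsilon> \<Longrightarrow> c *\<^sub>R u \<in> eig \<epsilon>"
  "0 \<in> eig \<epsilon>"
  by (simp_all add: eig_def linear_add[OF lin] linear_diff[OF lin] linear_cmul[OF lin] linear_0[OF lin] algebra_simps)

section \<open>The first prolongation and its test tensors\<close>

definition prolongation :: "(real^'k \<Rightarrow> real^'k \<Rightarrow> real^'k) \<Rightarrow> bool" where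
  "prolongation S \<longleftrightarrow> bilinear S \<and> (\<forall>u v w. h (S u v) w = - h v (S u w)) \<and>
     (\<forall>\<epsilon>\<in>{1, -1}. \<forall>u. \<forall>v\<in>eig \<epsilon>. S u v \<in> eig \<epsilon>) \<and>
     (\<forall>u v w. h (S u v) w + h (S v w) u + h (S w u) v = 0)"

text \<open>Test tensors: \<open>hook\<close> is \<open>x \<otimes> (y \<and> z)\<close> minus its totally skew part, which makes it cyclic;
  \<open>pure_trace\<close> serves to remove the trace of \<open>hook\<close>.\<close>

definition hook :: "real^'k \<Rightarrow> real^'k \<Rightarrow> real^'k \<Rightarrow> real^'k \<Rightarrow> real^'k \<Rightarrow> real^'k" where
  "hook x y z u v = h x u *\<^sub>R (h y v *\<^sub>R z - h z v *\<^sub>R y)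
     - (1/3) *\<^sub>R (h x u *\<^sub>R (h y v *\<^sub>R z - h z v *\<^sub>R y) + h x v *\<^sub>R (h z u *\<^sub>R y - h y u *\<^sub>R z)
                 + (h y u * h z v - h z u * h y v) *\<^sub>R x)"

definition pure_trace :: "real \<Rightarrow> real^'k \<Rightarrow> real^'k \<Rightarrow> real^'k \<Rightarrow> real^'k" where
  "pure_trace \<epsilon> \<tau> u v = h (eproj \<epsilon> u) v *\<^sub>R \<tau> - h \<tau> v *\<^sub>R eproj \<epsilon> u"

lemma prolongation_comb:
  assumes "prolongation S" "prolongation T"
  shows "prolongation (\<lambda>u v. c *\<^sub>R S u v + T u v)"
proof -
  have "bilinear (\<lambda>u v. c *\<^sub>R S u v + T u v)"
    using assms by (auto simp: prolongation_def bilinear_def linear_iff algebra_simps)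
  moreover have "h (c *\<^sub>R S u v + T u v) w + h (c *\<^sub>R S v w + T v w) u + h (c *\<^sub>R S w u + T w u) v = 0" for u v w
  proof -
    have "h (c *\<^sub>R S u v + T u v) w + h (c *\<^sub>R S v w + T v w) u + h (c *\<^sub>R S w u + T w u) v =
      c * (h (S u v) w + h (S v w) u + h (S w u) v) + (h (T u v) w + h (T v w) u + h (T w u) v)"
      by (simp add: form_simps algebra_simps)
    moreover have "h (S u v) w + h (S v w) u + h (S w u) v = 0" "h (T u v) w + h (T v w) u + h (T w u) v = 0"
      using assms unfolding prolongation_def by blast+
    ultimately show ?thesis by simp
  qed
  moreover have "h (S u v) w = - h v (S u w)" "h (T u v) w = - h v (T u w)" for u v w
    using assms unfolding prolongation_def by blast+
  ultimately show ?thesis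
    using assms unfolding prolongation_def by (auto simp: form_simps eig_combine)
qed

lemma prolongation_hook:
  assumes "\<epsilon> \<in> {1, -1}" "x \<in> eig \<epsilon>" "y \<in> eig \<epsilon>" "z \<in> eig \<epsilon>"
  shows "prolongation (hook x y z)"
  unfolding prolongation_def
proof (intro conjI allI ballI)
  show "bilinear (hook x y z)"
    by (simp add: bilinear_def linear_iff hook_def form_simps) (simp add: vec_eq_iff algebra_simps)
  \<comment> \<open>This is \<open>x \<otimes> (y \<and> z)\<close> with all arguments lowered. It
    is skew in the last two, so its cyclic sum is totally skew; subtracting a third of that sum
    preserves the skewness and makes the cyclic sum vanish.\<close>
  define t where "t u v w = h x u * (h y v * h z w - h z v * h y w)" for u v w
  have e: "h (hook x y z u v) w = t u v w - (t u v w + t v w u + t w u v) / 3" for u v w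
    by (simp add: hook_def form_simps t_def)
  have t: "t u w v = - t u v w" for u v w by (simp add: t_def algebra_simps)
  show "h (hook x y z u v) w = - h v (hook x y z u w)" for u v w
    using t[of u v w] t[of v w u] t[of w u v] unfolding sym[of v] e by (simp add: field_simps)
  show "h (hook x y z u v) w + h (hook x y z v w) u + h (hook x y z w u) v = 0" for u v w
    unfolding e by (simp add: field_simps)
  show "hook x y z u v \<in> eig \<delta>" if "\<delta> \<in> {1, -1}" "v \<in> eig \<delta>" for \<delta> u v
  proof (cases "\<delta> = \<epsilon>")
    case True
    then show ?thesis using assms unfolding hook_def by (intro eig_combine) auto
  next
    case False
    then have "v \<in> eig (- \<epsilon>)" using that assms(1) by auto
    then have "h x v = 0" "h y v = 0" "h z v = 0" using assms eig_orthogonal by blast+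
    then show ?thesis by (simp add: hook_def eig_combine)
  qed
qed

text \<open>The six terms of the cyclic sum cancel in pairs because the projection is self-adjoint;
  on the opposite eigenspace the tensor vanishes by orthogonality.\<close>

lemma prolongation_pure_trace:
  assumes "\<epsilon> \<in> {1, -1}" "\<tau> \<in> eig \<epsilon>"
  shows "prolongation (pure_trace \<epsilon> \<tau>)"
  unfolding prolongation_def
proof (intro conjI allI ballI)
  show "bilinear (pure_trace \<epsilon> \<tau>)"
    by (simp add: bilinear_def linear_iff pure_trace_def form_simps linear_add[OF linear_eproj]
        linear_cmul[OF linear_eproj]) (simp add: vec_eq_iff algebra_simps)
  show "h (pure_trace \<epsilon> \<tau> u v) w = - h v (pure_trace \<epsilon> \<tau> u w)" for u v w
    by (simp add: pure_trace_def form_simps sym[of v])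
  show "h (pure_trace \<epsilon> \<tau> u v) w + h (pure_trace \<epsilon> \<tau> v w) u + h (pure_trace \<epsilon> \<tau> w u) v = 0" for u v w
    using eproj_adjoint[of \<epsilon> u v] eproj_adjoint[of \<epsilon> v w] eproj_adjoint[of \<epsilon> w u]
    by (simp add: pure_trace_def form_simps sym[of u] sym[of v] sym[of w] mult.commute)
  show "pure_trace \<epsilon> \<tau> u v \<in> eig \<delta>" if "\<delta> \<in> {1, -1}" "v \<in> eig \<delta>" for \<delta> u v
  proof (cases "\<delta> = \<epsilon>")
    case True
    then show ?thesis using assms eproj_in_eig unfolding pure_trace_def by (intro eig_combine) auto
  next
    case False
    then have "v \<in> eig (- \<epsilon>)" using that assms(1) by auto
    then have "h (eproj \<epsilon> u) v = 0" "h \<tau> v = 0" using assms eig_orthogonal eproj_in_eig by blast+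
    then show ?thesis by (simp add: pure_trace_def eig_combine)
  qed
qed

text \<open>A totally skew tensor has no trace, so only the part
  \<open>x \<otimes> (y \<and> z)\<close> contributes.\<close>

lemma trace_hook: "endo_trace (\<lambda>u. hook x y z u v) = h (h x z *\<^sub>R y - h x y *\<^sub>R z) v"
proof -
  have l: "linear (\<lambda>u. hook x y z u v)"
    by (simp add: linear_iff hook_def form_simps) (simp add: vec_eq_iff algebra_simps)
  have e: "(\<lambda>u. h (hook x y z u v)) = (\<lambda>u w. (2/3 * h y v) * (h x u * h z w) - (2/3 * h z v) * (h x u * h y w)
     - (1/3 * h x v) * (h z u * h y w) + (1/3 * h x v) * (h y u * h z w)
     - (1/3 * h z v) * (h y u * h x w) + (1/3 * h y v) * (h z u * h x w))"
    by (intro ext) (simp add: hook_def form_simps, simp add: field_simps)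
  show ?thesis
    unfolding endo_trace_eq_ctr[OF l] e ctr_add ctr_diff ctr_cmul ctr_elementary
    by (simp add: form_simps sym[of z x] sym[of y x] sym[of z y])
qed

text \<open>The first term of the wedge contracts to \<open>h \<tau> v\<close>, the second to
  \<open>h \<tau> v\<close> times the trace of the projection, which is the dimension of the
  eigenspace.\<close>

lemma trace_pure_trace:
  assumes "\<epsilon> \<in> {1, -1}" "\<tau> \<in> eig \<epsilon>"
  shows "endo_trace (\<lambda>u. pure_trace \<epsilon> \<tau> u v) = (1 - endo_trace (eproj \<epsilon>)) * h \<tau> v"
proof -
  have l: "linear (\<lambda>u. pure_trace \<epsilon> \<tau> u v)"
    using prolongation_pure_trace[OF assms] by (simp add: prolongation_def bilinear_def)
  have e: "(\<lambda>u. h (pure_trace \<epsilon> \<tau> u v)) = (\<lambda>u w. h (eproj \<epsilon> v) u * h \<tau> w - h \<tau> v * h (eproj \<epsilon> u) w)"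
    by (intro ext) (simp add: pure_trace_def form_simps eproj_adjoint[of \<epsilon> _ v] sym[of _ "eproj \<epsilon> v"])
  have "h (eproj \<epsilon> v) \<tau> = h \<tau> v"
    using eproj_adjoint[of \<epsilon> v \<tau>] eproj_id[OF assms] by (simp add: sym)
  then show ?thesis
    unfolding endo_trace_eq_ctr[OF l] endo_trace_eq_ctr[OF linear_eproj] e ctr_diff ctr_cmul ctr_elementary
    by (simp add: algebra_simps)
qed

context
  fixes S
  assumes S: "prolongation S"
begin

lemma S_lin: "linear (\<lambda>u. h (S u b) c)" "linear (\<lambda>v. h (S a v) c)"
  using S by (auto simp: prolongation_def bilinear_def linear_iff form_simps)

lemma S_skew: "h (S u v) w = - h v (S u w)" and S_eig: "\<epsilon> \<in> {1, -1} \<Longrightarrow> v \<in> eig \<epsilon> \<Longrightarrow> S u v \<in> eig \<epsilon>"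
  and S_cyc: "h (S u v) w + h (S v w) u + h (S w u) v = 0"
  using S unfolding prolongation_def by blast+

text \<open>A tensor with vanishing cyclic sum is orthogonal to totally skew ones, so the correction
  in \<open>hook\<close> drops out; the two terms of \<open>y \<and> z\<close> give the same value
  because \<open>S\<close> is skew.\<close>

lemma ctr_hook:
  "ctr (\<lambda>a a'. ctr (\<lambda>b b'. h (S a b) (hook x y z a' b'))) = 2 * h (S x y) z"
proof -
  have e: "(\<lambda>b b'. h (S a b) (hook x y z a' b')) =
     (\<lambda>b b'. (2/3 * h x a') * (h (S a b) z * h y b') - (2/3 * h x a') * (h (S a b) y * h z b')
     - (1/3 * h z a') * (h (S a b) y * h x b') + (1/3 * h y a') * (h (S a b) z * h x b')
     - (1/3 * h y a') * (h (S a b) x * h z b') + (1/3 * h z a') * (h (S a b) x * h y b'))" for a a'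
    by (intro ext) (simp add: hook_def form_simps, simp add: field_simps)
  have "ctr (\<lambda>b b'. h (S a b) (hook x y z a' b')) =
     2/3 * (h (S a y) z * h x a') - 2/3 * (h (S a z) y * h x a')
     - 1/3 * (h (S a x) y * h z a') + 1/3 * (h (S a x) z * h y a')
     - 1/3 * (h (S a z) x * h y a') + 1/3 * (h (S a y) x * h z a')" for a a'
    unfolding e ctr_add ctr_diff ctr_cmul ctr_left[OF S_lin(2)] by (simp only: ac_simps)
  then have "ctr (\<lambda>a a'. ctr (\<lambda>b b'. h (S a b) (hook x y z a' b'))) =
     2/3 * h (S x y) z - 2/3 * h (S x z) y - 1/3 * h (S z x) y + 1/3 * h (S y x) z
     - 1/3 * h (S y z) x + 1/3 * h (S z y) x"
    by (simp only: ctr_add ctr_diff ctr_cmul ctr_left[OF S_lin(1)])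
  moreover have "h (S x z) y = - h (S x y) z" "h (S z y) x = - h (S z x) y" "h (S y x) z = - h (S y z) x"
    using S_skew sym by metis+
  ultimately show ?thesis using S_cyc[of x y z] by simp
qed

text \<open>Both terms of the wedge give the trace of \<open>S\<close> at \<tau>: since
  \<open>S\<close> preserves the eigenspace containing \<tau>, the projection can be removed. Hence
  the tensor is orthogonal to every traceless \<open>S\<close>.\<close>

lemma ctr_pure_trace:
  assumes "\<epsilon> \<in> {1, -1}" "\<tau> \<in> eig \<epsilon>"
  shows "ctr (\<lambda>a a'. ctr (\<lambda>b b'. h (S a b) (pure_trace \<epsilon> \<tau> a' b'))) = - 2 * endo_trace (\<lambda>a. S a \<tau>)"
proof -
  have "h (S a b) (pure_trace \<epsilon> \<tau> a' b') = h (S a b) \<tau> * h (eproj \<epsilon> a') b' - h (S a b) (eproj \<epsilon> a') * h \<tau> b'"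
    for a a' b b'
    by (simp add: pure_trace_def form_simps mult.commute)
  then have "ctr (\<lambda>b b'. h (S a b) (pure_trace \<epsilon> \<tau> a' b')) =
      h (S a (eproj \<epsilon> a')) \<tau> - h (S a \<tau>) (eproj \<epsilon> a')" for a a'
    by (simp add: ctr_diff ctr_left[OF S_lin(2)])
  also have "h (S a (eproj \<epsilon> a')) \<tau> - h (S a \<tau>) (eproj \<epsilon> a') = (-2) * h (S a \<tau>) a'" for a a'
  proof -
    have "h (S a (eproj \<epsilon> a')) \<tau> = - h (S a \<tau>) (eproj \<epsilon> a')"
      using S_skew[of a "eproj \<epsilon> a'" \<tau>] sym by metis
    moreover have "h (S a \<tau>) (eproj \<epsilon> a') = h (S a \<tau>) a'"
      using eproj_adjoint[of \<epsilon> "S a \<tau>" a'] eproj_id[OF assms(1) S_eig[OF assms]] by simp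
    ultimately show ?thesis by simp
  qed
  finally have "ctr (\<lambda>a a'. ctr (\<lambda>b b'. h (S a b) (pure_trace \<epsilon> \<tau> a' b'))) = (-2) * ctr (\<lambda>a a'. h (S a \<tau>) a')"
    by (simp only: ctr_cmul)
  moreover have "linear (\<lambda>a. S a \<tau>)" using S by (simp add: prolongation_def bilinear_def)
  ultimately show ?thesis by (simp add: endo_trace_eq_ctr)
qed

text \<open>When the eigenspace is a line the test tensors degenerate (\<open>1 - tr P = 0\<close>), but then \<open>S\<close>
  vanishes on it by skewness.\<close>

lemma prolongation_nondegenerate:
  assumes tr: "\<And>v. endo_trace (\<lambda>u. S u v) = 0"
    and orth: "\<And>K. prolongation K \<Longrightarrow> (\<And>v. endo_trace (\<lambda>u. K u v) = 0) \<Longrightarrow>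
      ctr (\<lambda>a a'. ctr (\<lambda>b b'. h (S a b) (K a' b'))) = 0"
  shows "S u v = 0"
proof -
  have same: "h (S x y) z = 0" if \<epsilon>: "\<epsilon> \<in> {1, -1}" and xyz: "x \<in> eig \<epsilon>" "y \<in> eig \<epsilon>" "z \<in> eig \<epsilon>" for \<epsilon> x y z
  proof (cases "endo_trace (eproj \<epsilon>) = 1")
    case True
    have "endo_trace (eproj \<epsilon>) = dim (range (eproj \<epsilon>))"
      using \<epsilon> by (intro trace_projection linear_eproj eproj_id eproj_in_eig)
    then have "dim (eig \<epsilon>) = 1" using True range_eproj[OF \<epsilon>] by simp
    then obtain B where B: "eig \<epsilon> \<subseteq> span B" "card B = 1" using basis_exists by metis
    then obtain b where "eig \<epsilon> \<subseteq> span {b}" by (metis card_1_singletonE)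
    then have "y \<in> span {b}" "z \<in> span {b}" using xyz by blast+
    then obtain c c' where "y = c *\<^sub>R b" "z = c' *\<^sub>R b" by (auto simp: span_singleton)
    moreover have "h (S x b) b = 0" using S_skew[of x b b] by (simp add: sym)
    ultimately show ?thesis
      using S by (simp add: prolongation_def bilinear_rmul form_simps)
  next
    case False
    let ?d = "endo_trace (eproj \<epsilon>)"
    define \<tau> where "\<tau> = h x z *\<^sub>R y - h x y *\<^sub>R z"
    have \<tau>: "\<tau> \<in> eig \<epsilon>" unfolding \<tau>_def using xyz by (intro eig_combine)
    \<comment> \<open>The weights balance the traces: that of \<open>hook\<close> is
      \<open>h \<tau>\<close> and that of \<open>pure_trace\<close> is
      \<open>(1 - d) h \<tau>\<close>, where \<open>d\<close> is the trace of the
      projection.\<close>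
    let ?K = "\<lambda>u v. (?d - 1) *\<^sub>R hook x y z u v + pure_trace \<epsilon> \<tau> u v"
    note pr = prolongation_hook[OF \<epsilon> xyz] prolongation_pure_trace[OF \<epsilon> \<tau>]
    have "ctr (\<lambda>a a'. ctr (\<lambda>b b'. h (S a b) (?K a' b'))) = 0"
    proof (rule orth[OF prolongation_comb[OF pr]])
      fix v
      have "linear (\<lambda>u. hook x y z u v)" "linear (\<lambda>u. pure_trace \<epsilon> \<tau> u v)" "linear (\<lambda>u. ?K u v)"
        using pr prolongation_comb[OF pr, of "?d - 1"] by (simp_all add: prolongation_def bilinear_def)
      then have "endo_trace (\<lambda>u. ?K u v) =
          (?d - 1) * endo_trace (\<lambda>u. hook x y z u v) + endo_trace (\<lambda>u. pure_trace \<epsilon> \<tau> u v)"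
        by (simp add: endo_trace_eq_ctr form_simps ctr_add ctr_cmul)
      then show "endo_trace (\<lambda>u. ?K u v) = 0"
        by (simp add: trace_hook trace_pure_trace[OF \<epsilon> \<tau>] \<tau>_def[symmetric] algebra_simps)
    qed
    then have "(?d - 1) * (2 * h (S x y) z) = 0"
      by (simp add: form_simps ctr_add ctr_cmul ctr_hook ctr_pure_trace[OF \<epsilon> \<tau>] tr)
    then show ?thesis using False by simp
  qed
  \<comment> \<open>With the first argument in the other eigenspace, the two cyclic permutations
    pair vectors of opposite eigenspaces, because \<open>S\<close> preserves both; cyclicity leaves
    nothing for the third term.\<close>
  have mixed: "h (S x y) z = 0" if \<epsilon>: "\<epsilon> \<in> {1, -1}" and xyz: "x \<in> eig (-\<epsilon>)" "y \<in> eig \<epsilon>" "z \<in> eig \<epsilon>" for \<epsilon> x y z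
  proof -
    have "h (S y z) x = 0" by (rule eig_orthogonal[OF \<epsilon> S_eig[OF \<epsilon> xyz(3)] xyz(1)])
    moreover have "h (S z x) y = 0"
      using eig_orthogonal[OF \<epsilon> xyz(2) S_eig[OF _ xyz(1)]] \<epsilon> by (auto simp: sym)
    ultimately show ?thesis using S_cyc[of x y z] by simp
  qed
  have hom: "h (S u y) w = 0" if \<epsilon>: "\<epsilon> \<in> {1, -1}" and y: "y \<in> eig \<epsilon>" for \<epsilon> u y w
  proof -
    have m: "- \<epsilon> \<in> {1, -1}" using \<epsilon> by auto
    have "h (S u y) (eproj (-\<epsilon>) w) = 0"
      by (rule eig_orthogonal[OF \<epsilon> S_eig[OF \<epsilon> y] eproj_in_eig[OF m]])
    moreover have "h (S u y) (eproj \<epsilon> w) = 0"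
    proof -
      have "h (S u y) (eproj \<epsilon> w) = h (S (eproj \<epsilon> u) y) (eproj \<epsilon> w) + h (S (eproj (-\<epsilon>) u) y) (eproj \<epsilon> w)"
        using linear_add[OF S_lin(1)[of y "eproj \<epsilon> w"], of "eproj \<epsilon> u" "eproj (-\<epsilon>) u"] eproj_sum[OF \<epsilon>] by simp
      then show ?thesis
        using same[OF \<epsilon> eproj_in_eig[OF \<epsilon>] y eproj_in_eig[OF \<epsilon>]]
          mixed[OF \<epsilon> eproj_in_eig[OF m] y eproj_in_eig[OF \<epsilon>]] by simp
    qed
    ultimately show ?thesis
      using bilinear_radd[OF bil, of "S u y" "eproj \<epsilon> w" "eproj (-\<epsilon>) w"] eproj_sum[OF \<epsilon>] by simp
  qed
  show ?thesis
  proof (rule nondeg)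
    fix w
    have "h (S u (eproj 1 v + eproj (-1) v)) w = 0"
      using hom[of 1 "eproj 1 v"] hom[of "-1" "eproj (-1) v"] eproj_in_eig
      by (simp add: linear_add[OF S_lin(2)])
    then show "h (S u v) w = 0" using eproj_sum[of 1 v] by simp
  qed
qed

end

end

subsection \<open>Smooth functions on manifolds\<close>

locale smooth_manifold =
  fixes A :: "('m::{t2_space,second_countable_topology}, 'n::finite) chart set"
  assumes atlas: "smooth_atlas A"
begin

lemma chartD:
  assumes "(U, \<phi>) \<in> A"
  shows "open U" "open (\<phi> ` U)" "homeomorphism U (\<phi> ` U) \<phi> (inv_into U \<phi>)" "inj_on \<phi> U"
    "mfd_smooth_on A U \<phi>"
proof -
  show *: "open U" "open (\<phi> ` U)" "homeomorphism U (\<phi> ` U) \<phi> (inv_into U \<phi>)" "mfd_smooth_on A U \<phi>"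
    using assms atlas unfolding smooth_atlas_def by fast+
  show "inj_on \<phi> U" using homeomorphism_apply1[OF *(3)] by (metis inj_on_inverseI)
qed

lemma chart_at: obtains U \<phi> where "(U, \<phi>) \<in> A" "p \<in> U"
proof -
  have "(\<Union>(U, \<phi>)\<in>A. U) = UNIV" using atlas by (simp add: smooth_atlas_def)
  then have "p \<in> (\<Union>(U, \<phi>)\<in>A. U)" by simp
  then show ?thesis using that by auto
qed

lemma open_chart_image:
  assumes "(U, \<phi>) \<in> A" "open W"
  shows "open (\<phi> ` (U \<inter> W))"
proof -
  have "openin (top_of_set (\<phi> ` U)) (\<phi> ` (U \<inter> W))"
    by (rule homeomorphism_imp_open_map[OF chartD(3)[OF assms(1)]]) (simp add: assms(2) openin_open_Int)
  then show ?thesis using chartD(2)[OF assms(1)] by (simp add: openin_open_eq)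
qed

lemma inv_chart:
  assumes "(U, \<phi>) \<in> A" "y \<in> \<phi> ` (U \<inter> W)"
  shows "inv_into U \<phi> y \<in> U" "inv_into U \<phi> y \<in> W" "\<phi> (inv_into U \<phi> y) = y"
  using assms(2) chartD(4)[OF assms(1)] by auto

lemma mfd_smooth_onD:
  "mfd_smooth_on A W f \<Longrightarrow> (U, \<phi>) \<in> A \<Longrightarrow> smooth_on (\<phi> ` (U \<inter> W)) (\<lambda>y. f (inv_into U \<phi> y))"
  unfolding mfd_smooth_on_def comp_def by fast

lemma mfd_smooth_onI:
  "(\<And>U \<phi>. (U, \<phi>) \<in> A \<Longrightarrow> smooth_on (\<phi> ` (U \<inter> W)) (\<lambda>y. f (inv_into U \<phi> y))) \<Longrightarrow> mfd_smooth_on A W f"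
  unfolding mfd_smooth_on_def comp_def by fast

lemma mfd_const: "mfd_smooth_on A W (\<lambda>p. c)"
  by (rule mfd_smooth_onI) (rule smooth_on_const)

lemma mfd_cong:
  assumes "open W" "mfd_smooth_on A W f" "\<And>p. p \<in> W \<Longrightarrow> f p = g p"
  shows "mfd_smooth_on A W g"
proof (rule mfd_smooth_onI)
  fix U \<phi> assume c: "(U, \<phi>) \<in> A"
  show "smooth_on (\<phi> ` (U \<inter> W)) (\<lambda>y. g (inv_into U \<phi> y))"
    by (rule smooth_on_cong[OF open_chart_image[OF c assms(1)] mfd_smooth_onD[OF assms(2) c]])
       (erule assms(3)[OF inv_chart(2)[OF c]])
qed

lemma mfd_subset: "mfd_smooth_on A W f \<Longrightarrow> T \<subseteq> W \<Longrightarrow> mfd_smooth_on A T f"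
  by (rule mfd_smooth_onI, rule smooth_on_subset, erule (1) mfd_smooth_onD) blast

lemma mfd_add:
  assumes "open W" "mfd_smooth_on A W f" "mfd_smooth_on A W g"
  shows "mfd_smooth_on A W (\<lambda>p. f p + g p)"
proof (rule mfd_smooth_onI)
  fix U \<phi> assume c: "(U, \<phi>) \<in> A"
  show "smooth_on (\<phi> ` (U \<inter> W)) (\<lambda>y. f (inv_into U \<phi> y) + g (inv_into U \<phi> y))"
    by (rule smooth_on_add[OF open_chart_image[OF c assms(1)] mfd_smooth_onD[OF assms(2) c]
          mfd_smooth_onD[OF assms(3) c]])
qed

lemma mfd_bilinear:
  assumes "bounded_bilinear b" "open W" "mfd_smooth_on A W f" "mfd_smooth_on A W g"
  shows "mfd_smooth_on A W (\<lambda>p. b (f p) (g p))"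
proof (rule mfd_smooth_onI)
  fix U \<phi> assume c: "(U, \<phi>) \<in> A"
  show "smooth_on (\<phi> ` (U \<inter> W)) (\<lambda>y. b (f (inv_into U \<phi> y)) (g (inv_into U \<phi> y)))"
    by (rule bounded_bilinear.smooth_on_prod[OF assms(1) open_chart_image[OF c assms(2)]
          mfd_smooth_onD[OF assms(3) c] mfd_smooth_onD[OF assms(4) c]])
qed

lemmas mfd_mult = mfd_bilinear[OF bounded_bilinear_mult]
lemmas mfd_scaleR = mfd_bilinear[OF bounded_bilinear_scaleR]

lemma mfd_uminus: "open W \<Longrightarrow> mfd_smooth_on A W f \<Longrightarrow> mfd_smooth_on A W (\<lambda>p. - f p)"
  using mfd_scaleR[OF _ mfd_const[of W "-1"], of f] by simp

lemma mfd_diff: "open W \<Longrightarrow> mfd_smooth_on A W f \<Longrightarrow> mfd_smooth_on A W g \<Longrightarrow> mfd_smooth_on A W (\<lambda>p. f p - g p)"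
  using mfd_add[OF _ _ mfd_uminus, of W f g] by simp

lemma mfd_sum:
  assumes "open W" "\<And>i. i \<in> I \<Longrightarrow> mfd_smooth_on A W (f i)"
  shows "mfd_smooth_on A W (\<lambda>p. \<Sum>i\<in>I. f i p)"
  using assms(2) by (induction I rule: infinite_finite_induct) (auto intro: mfd_const mfd_add[OF assms(1)])

lemma mfd_prod:
  fixes f :: "'i \<Rightarrow> 'm \<Rightarrow> real"
  assumes "open W" "\<And>i. i \<in> I \<Longrightarrow> mfd_smooth_on A W (f i)"
  shows "mfd_smooth_on A W (\<lambda>p. \<Prod>i\<in>I. f i p)"
  using assms(2) by (induction I rule: infinite_finite_induct) (auto intro: mfd_const mfd_mult[OF assms(1)])

lemma mfd_inverse:
  fixes f :: "'m \<Rightarrow> real"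
  assumes "open W" "mfd_smooth_on A W f" "\<And>p. p \<in> W \<Longrightarrow> f p \<noteq> 0"
  shows "mfd_smooth_on A W (\<lambda>p. inverse (f p))"
proof (rule mfd_smooth_onI)
  fix U \<phi> assume c: "(U, \<phi>) \<in> A"
  show "smooth_on (\<phi> ` (U \<inter> W)) (\<lambda>y. inverse (f (inv_into U \<phi> y)))"
    by (rule smooth_on_inverse[OF open_chart_image[OF c assms(1)] mfd_smooth_onD[OF assms(2) c]])
      (erule assms(3)[OF inv_chart(2)[OF c]])
qed

lemma mfd_vec_nth:
  fixes f :: "'m \<Rightarrow> real^'k"
  assumes "open W" "mfd_smooth_on A W f"
  shows "mfd_smooth_on A W (\<lambda>p. f p $ i)"
proof (rule mfd_smooth_onI)
  fix U \<phi> assume c: "(U, \<phi>) \<in> A"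
  show "smooth_on (\<phi> ` (U \<inter> W)) (\<lambda>y. f (inv_into U \<phi> y) $ i)"
    by (rule smooth_on_vec_nth[OF open_chart_image[OF c assms(1)] mfd_smooth_onD[OF assms(2) c]])
qed

lemma mfd_compose:
  fixes f :: "'m \<Rightarrow> 'b::euclidean_space"
  assumes "open W" "open T" "mfd_smooth_on A W f" "smooth_on T g" "\<And>p. p \<in> W \<Longrightarrow> f p \<in> T"
  shows "mfd_smooth_on A W (\<lambda>p. g (f p))"
proof (rule mfd_smooth_onI)
  fix U \<phi> assume c: "(U, \<phi>) \<in> A"
  show "smooth_on (\<phi> ` (U \<inter> W)) (\<lambda>y. g (f (inv_into U \<phi> y)))"
    by (rule smooth_on_compose[OF open_chart_image[OF c assms(1)] assms(2) mfd_smooth_onD[OF assms(3) c] assms(4)])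
      (rule assms(5)[OF inv_chart(2)[OF c]])
qed

lemma mfd_local:
  assumes "open W" "\<And>p. p \<in> W \<Longrightarrow> \<exists>T. open T \<and> p \<in> T \<and> mfd_smooth_on A (W \<inter> T) f"
  shows "mfd_smooth_on A W f"
proof (rule mfd_smooth_onI)
  fix U \<phi> assume c: "(U, \<phi>) \<in> A"
  show "smooth_on (\<phi> ` (U \<inter> W)) (\<lambda>y. f (inv_into U \<phi> y))"
  proof (rule smooth_on_local[OF open_chart_image[OF c assms(1)]])
    fix y assume y: "y \<in> \<phi> ` (U \<inter> W)"
    obtain T where T: "open T" "inv_into U \<phi> y \<in> T" "mfd_smooth_on A (W \<inter> T) f"
      using assms(2)[OF inv_chart(2)[OF c y]] by blast
    have "y \<in> \<phi> ` (U \<inter> T)"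
      using T(2) inv_chart[OF c y] by (intro image_eqI[of _ _ "inv_into U \<phi> y"]) auto
    moreover have "\<phi> ` (U \<inter> W) \<inter> \<phi> ` (U \<inter> T) = \<phi> ` (U \<inter> (W \<inter> T))"
      using chartD(4)[OF c] by (auto simp: inj_on_def)
    ultimately show "\<exists>T'. open T' \<and> y \<in> T' \<and> smooth_on (\<phi> ` (U \<inter> W) \<inter> T') (\<lambda>y. f (inv_into U \<phi> y))"
      using open_chart_image[OF c T(1)] mfd_smooth_onD[OF T(3) c] by (intro exI[of _ "\<phi> ` (U \<inter> T)"]) simp
  qed
qed

text \<open>\<open>V\<close> and the complement of \<open>K\<close> form an open cover, and on the
  latter the function is constantly zero.\<close>

lemma mfd_extend_zero:
  assumes "open V" "closed K" "K \<subseteq> V" "mfd_smooth_on A V f" "\<And>q. q \<notin> K \<Longrightarrow> f q = 0"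
  shows "mfd_smooth_on A UNIV f"
proof (rule mfd_local)
  fix p
  show "\<exists>T. open T \<and> p \<in> T \<and> mfd_smooth_on A (UNIV \<inter> T) f"
  proof (cases "p \<in> V")
    case True
    then show ?thesis using assms by (intro exI[of _ V]) auto
  next
    case False
    have "mfd_smooth_on A (-K) f"
      by (rule mfd_cong[OF _ mfd_const[of "-K" 0]]) (use assms in \<open>auto simp: open_Compl\<close>)
    then show ?thesis using assms False by (intro exI[of _ "-K"]) (auto simp: open_Compl)
  qed
qed simp

lemma bump_function:
  assumes "open V" "p \<in> V"
  obtains \<rho> K where "smooth_fun A \<rho>" "\<rho> p = 1" "closed K" "K \<subseteq> V" "\<And>q. q \<notin> K \<Longrightarrow> \<rho> q = 0"
proof -
  obtain U \<phi> where c: "(U, \<phi>) \<in> A" "p \<in> U" by (rule chart_at)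
  have "open (\<phi> ` (U \<inter> V))" "\<phi> p \<in> \<phi> ` (U \<inter> V)" using open_chart_image[OF c(1) assms(1)] c assms by auto
  then obtain r where r: "r > 0" "cball (\<phi> p) r \<subseteq> \<phi> ` (U \<inter> V)" using open_contains_cball by blast
  obtain \<rho>0 :: "real^'n \<Rightarrow> real" where \<rho>0: "smooth_on UNIV \<rho>0" "\<rho>0 (\<phi> p) = 1"
    "\<And>x. x \<notin> ball (\<phi> p) r \<Longrightarrow> \<rho>0 x = 0" using bump_on_ball[OF r(1)] by blast
  \<comment> \<open>The compact set \<open>K\<close> is closed in the whole manifold and not merely
    in \<open>U\<close>: here the Hausdorff property enters. As it contains the support of the bump,
    extension by zero is smooth.\<close>
  define K where "K = inv_into U \<phi> ` cball (\<phi> p) r"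
  define \<rho> where "\<rho> q = (if q \<in> U then \<rho>0 (\<phi> q) else 0)" for q
  have "continuous_on (cball (\<phi> p) r) (inv_into U \<phi>)"
    using chartD(3)[OF c(1)] r(2) unfolding homeomorphism_def
    by (elim conjE) (erule continuous_on_subset, blast)
  then have "compact K" unfolding K_def by (intro compact_continuous_image) auto
  then have K: "closed K" by (rule compact_imp_closed)
  have KV: "K \<subseteq> U \<inter> V"
    unfolding K_def using r(2) inv_chart(1,2)[OF c(1), of _ V] by (intro image_subsetI IntI) (blast+)
  have out: "\<rho> q = 0" if "q \<notin> K" for q
  proof (cases "q \<in> U")
    case True
    have "inv_into U \<phi> (\<phi> q) = q" using chartD(4)[OF c(1)] True by simp
    then have "\<phi> q \<notin> ball (\<phi> p) r" using that unfolding K_def by (metis imageI mem_ball_imp_mem_cball)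
    then show ?thesis using \<rho>0(3) by (simp add: \<rho>_def)
  qed (simp add: \<rho>_def)
  have "mfd_smooth_on A U (\<lambda>q. \<rho>0 (\<phi> q))"
    by (rule mfd_compose[OF chartD(1)[OF c(1)] open_UNIV chartD(5)[OF c(1)] \<rho>0(1)]) auto
  then have "mfd_smooth_on A U \<rho>"
    by (rule mfd_cong[OF chartD(1)[OF c(1)]]) (simp add: \<rho>_def)
  then have "smooth_fun A \<rho>"
    using KV out by (intro mfd_extend_zero[OF chartD(1)[OF c(1)] K]) auto
  moreover have "\<rho> p = 1" using c \<rho>0 by (simp add: \<rho>_def)
  ultimately show ?thesis using that[of \<rho> K] K KV out by blast
qed

lemma mfd_continuous:
  assumes "smooth_fun A f"
  shows "continuous_on UNIV f"
proof -
  have "isCont f p" for p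
  proof -
    obtain U \<phi> where c: "(U, \<phi>) \<in> A" "p \<in> U" by (rule chart_at)
    have "continuous_on (\<phi> ` U) (\<lambda>y. f (inv_into U \<phi> y))"
      using smooth_on_continuous_on[OF mfd_smooth_onD[OF assms c(1)]] by simp
    moreover have "continuous_on U \<phi>" using chartD(3)[OF c(1)] by (simp add: homeomorphism_def)
    ultimately have "continuous_on U (\<lambda>q. f (inv_into U \<phi> (\<phi> q)))"
      by (rule continuous_on_compose2) simp
    then have "continuous_on U f"
      by (rule continuous_on_eq) (use chartD(4)[OF c(1)] in simp)
    then show ?thesis using chartD(1)[OF c(1)] c(2) continuous_on_eq_continuous_at by blast
  qed
  then show ?thesis by (simp add: continuous_at_imp_continuous_on)
qed

lemma mfd_det:
  fixes M :: "'m \<Rightarrow> real^'k^'k"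
  assumes "open W" "\<And>i j. mfd_smooth_on A W (\<lambda>p. M p $ i $ j)"
  shows "mfd_smooth_on A W (\<lambda>p. det (M p))"
  unfolding det_def using assms by (intro mfd_sum mfd_mult mfd_const mfd_prod)

text \<open>Cramer's rule: the entry is a quotient of determinants, with column \<open>i\<close> of
  the numerator replaced by the \<open>j\<close>-th unit vector, so only polynomial operations and
  one reciprocal occur.\<close>

lemma mfd_matrix_inv:
  fixes M :: "'m \<Rightarrow> real^'k^'k"
  assumes W: "open W" and M: "\<And>i j. mfd_smooth_on A W (\<lambda>p. M p $ i $ j)"
    and inv: "\<And>p. p \<in> W \<Longrightarrow> invertible (M p)"
  shows "mfd_smooth_on A W (\<lambda>p. matrix_inv (M p) $ i $ j)"
proof -
  have d: "det (M p) \<noteq> 0" if "p \<in> W" for p using inv[OF that] by (simp add: invertible_det_nz)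
  let ?N = "\<lambda>p. \<chi> r c. if c = i then axis j 1 $ r else M p $ r $ c"
  have "mfd_smooth_on A W (\<lambda>p. det (?N p) * inverse (det (M p)))"
  proof (intro mfd_mult mfd_inverse mfd_det W M d)
    show "mfd_smooth_on A W (\<lambda>p. ?N p $ r $ c)" for r c
      using M mfd_const by (cases "c = i") simp_all
  qed
  then show ?thesis
  proof (rule mfd_cong[OF W])
    fix p assume p: "p \<in> W"
    have "M p *v (matrix_inv (M p) *v axis j 1) = axis j 1"
      by (simp add: matrix_vector_mul_assoc matrix_inv_invertible[OF inv[OF p]])
    then have "matrix_inv (M p) *v axis j 1 =
        (\<chi> k. det (\<chi> r c. if c = k then axis j 1 $ r else M p $ r $ c) / det (M p))"
      using cramer[OF d[OF p]] by blast
    moreover have "(matrix_inv (M p) *v axis j 1) $ i = matrix_inv (M p) $ i $ j"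
      by (simp add: matrix_vector_mult_def axis_def if_distrib cong: if_cong)
    ultimately show "det (?N p) * inverse (det (M p)) = matrix_inv (M p) $ i $ j"
      by (simp add: divide_inverse)
  qed
qed

subsection \<open>Tangent vectors\<close>

context
  fixes X p
  assumes X: "X \<in> tangent_space A p"
begin

lemma tangent_vectorE:
  obtains U \<phi> x where "(U, \<phi>) \<in> A" "p \<in> U"
    "\<And>f. smooth_fun A f \<Longrightarrow> X f = frechet_derivative (\<lambda>y. f (inv_into U \<phi> y)) (at (\<phi> p)) x"
    "\<And>f. smooth_fun A f \<Longrightarrow> (\<lambda>y. f (inv_into U \<phi> y)) differentiable (at (\<phi> p))"
    "\<And>f. f (inv_into U \<phi> (\<phi> p)) = f p"
proof -
  obtain U \<phi> x where *: "(U, \<phi>) \<in> A" "p \<in> U"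
    "X = (\<lambda>f. if smooth_fun A f then frechet_derivative (f \<circ> inv_into U \<phi>) (at (\<phi> p)) x else 0)"
    using X unfolding tangent_space_def by blast
  show ?thesis
  proof (rule that[OF *(1,2), of x])
    show "(\<lambda>y. f (inv_into U \<phi> y)) differentiable (at (\<phi> p))" if "smooth_fun A f" for f :: "'m \<Rightarrow> real"
      by (rule smooth_on_differentiable[OF mfd_smooth_onD[OF that *(1)]]) (use *(2) in auto)
    show "f (inv_into U \<phi> (\<phi> p)) = f p" for f using chartD(4)[OF *(1)] *(2) by simp
  qed (simp add: *(3) comp_def)
qed

text \<open>The default value on non-smooth functions spares smoothness hypotheses in later facts
  about the anchor.\<close>

lemma tangent_nonsmooth: "\<not> smooth_fun A f \<Longrightarrow> X f = 0"
  using X unfolding tangent_space_def by auto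

lemma tangent_const: "X (\<lambda>q. c) = 0"
  by (rule tangent_vectorE) (simp add: mfd_const)

lemma tangent_mult:
  assumes "smooth_fun A f" "smooth_fun A g"
  shows "X (\<lambda>q. f q * g q) = X f * g p + f p * X g"
proof (rule tangent_vectorE)
  fix U \<phi> x
  assume D: "\<And>f. smooth_fun A f \<Longrightarrow> X f = frechet_derivative (\<lambda>y. f (inv_into U \<phi> y)) (at (\<phi> p)) x"
    "\<And>f. smooth_fun A f \<Longrightarrow> (\<lambda>y. f (inv_into U \<phi> y)) differentiable (at (\<phi> p))"
    and i: "\<And>f. (f :: 'm \<Rightarrow> real) (inv_into U \<phi> (\<phi> p)) = f p"
  let ?f = "\<lambda>y. f (inv_into U \<phi> y)" and ?g = "\<lambda>y. g (inv_into U \<phi> y)"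
  have "((\<lambda>y. ?f y * ?g y) has_derivative
      (\<lambda>x. ?f (\<phi> p) * frechet_derivative ?g (at (\<phi> p)) x + frechet_derivative ?f (at (\<phi> p)) x * ?g (\<phi> p)))
      (at (\<phi> p))"
    by (intro has_derivative_mult iffD1[OF frechet_derivative_works] D(2) assms)
  from frechet_derivative_at[OF this, symmetric] show ?thesis
    unfolding D(1)[OF mfd_mult[OF open_UNIV assms]] D(1)[OF assms(1)] D(1)[OF assms(2)] by (simp add: i)
qed

end

end

subsection \<open>Sections of a Courant algebroid\<close>

lemma smooth_metricD:
  assumes "smooth_metric C h"
  shows "nondegenerate_form (h p)"
    "u \<in> sections C \<Longrightarrow> v \<in> sections C \<Longrightarrow> smooth_fun (atlas C) (\<lambda>p. h p (u p) (v p))"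
  using assms unfolding smooth_metric_def nondegenerate_form_def by simp_all

locale courant_alg =
  fixes C :: "('m::{t2_space,second_countable_topology}, 'n::finite, 'k::finite) courant"
  assumes courant: "courant_algebroid C"
begin

sublocale smooth_manifold "atlas C"
  using courant by unfold_locales (simp add: courant_algebroid_def)

abbreviation "\<Gamma> \<equiv> sections C"
abbreviation "pr \<equiv> pairing C"
abbreviation "an \<equiv> anchor C"
abbreviation "mfd W \<equiv> mfd_smooth_on (atlas C) W"

sublocale form: nondegenerate_form "pairing C p" for p
  using courant unfolding courant_algebroid_def by (elim conjE) (rule smooth_metricD)

lemma pairing_smooth: "u \<in> \<Gamma> \<Longrightarrow> v \<in> \<Gamma> \<Longrightarrow> mfd UNIV (\<lambda>p. pr p (u p) (v p))"
  using courant unfolding courant_algebroid_def by (elim conjE) (rule smooth_metricD)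

lemma triv_at: obtains W \<tau> where "(W, \<tau>) \<in> trivs C" "p \<in> W"
proof -
  have "(\<Union>(W, \<tau>)\<in>trivs C. W) = UNIV"
    using courant by (simp add: courant_algebroid_def vector_bundle_def)
  then have "p \<in> (\<Union>(W, \<tau>)\<in>trivs C. W)" by simp
  then show ?thesis using that by auto
qed

lemma trivD:
  assumes "(W, \<tau>) \<in> trivs C"
  shows "open W" "p \<in> W \<Longrightarrow> linear (\<tau> p)" "p \<in> W \<Longrightarrow> bij (\<tau> p)"
    "p \<in> W \<Longrightarrow> inv (\<tau> p) (\<tau> p x) = x" "p \<in> W \<Longrightarrow> \<tau> p (inv (\<tau> p) x) = x"
    "p \<in> W \<Longrightarrow> linear (inv (\<tau> p))"
proof -
  have *: "open W \<and> (\<forall>p\<in>W. linear (\<tau> p) \<and> bij (\<tau> p))"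
  proof -
    have "vector_bundle C" using courant unfolding courant_algebroid_def by (elim conjE)
    then have "\<forall>(W, \<tau>)\<in>trivs C. open W \<and> (\<forall>p\<in>W. linear (\<tau> p) \<and> bij (\<tau> p))"
      unfolding vector_bundle_def by (elim conjE)
    from bspec[OF this assms] show ?thesis by simp
  qed
  then show "open W" and l: "p \<in> W \<Longrightarrow> linear (\<tau> p)" and b: "p \<in> W \<Longrightarrow> bij (\<tau> p)" by blast+
  show "p \<in> W \<Longrightarrow> inv (\<tau> p) (\<tau> p x) = x" using b by (simp add: bij_is_inj)
  show "p \<in> W \<Longrightarrow> \<tau> p (inv (\<tau> p) x) = x" using b by (simp add: bij_is_surj surj_f_inv_f)
  show "p \<in> W \<Longrightarrow> linear (inv (\<tau> p))"
    using l b by (intro inj_linear_imp_inv_linear) (auto simp: bij_is_inj)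
qed

lemma transition_smooth:
  assumes "(W, \<tau>) \<in> trivs C" "(W', \<tau>') \<in> trivs C"
  shows "mfd (W \<inter> W') (\<lambda>p. \<tau>' p (inv (\<tau> p) x))"
proof -
  have "vector_bundle C" using courant unfolding courant_algebroid_def by (elim conjE)
  then have "\<forall>(W, \<tau>)\<in>trivs C. \<forall>(W', \<tau>')\<in>trivs C. \<forall>x. mfd (W \<inter> W') (\<lambda>p. \<tau>' p (inv (\<tau> p) x))"
    unfolding vector_bundle_def by (elim conjE)
  from bspec[OF this assms(1), simplified, THEN bspec, OF assms(2)] show ?thesis by simp
qed

lemma section_onD: "section_on C U s \<Longrightarrow> (W, \<tau>) \<in> trivs C \<Longrightarrow> mfd (U \<inter> W) (\<lambda>p. \<tau> p (s p))"
  unfolding section_on_def by fast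

lemma sectionD: "s \<in> \<Gamma> \<Longrightarrow> (W, \<tau>) \<in> trivs C \<Longrightarrow> mfd W (\<lambda>p. \<tau> p (s p))"
  using section_onD[of UNIV s W \<tau>] by (simp add: sections_def)

lemma section_on_subset: "section_on C U s \<Longrightarrow> V \<subseteq> U \<Longrightarrow> section_on C V s"
  unfolding section_on_def by (clarify, rule mfd_subset, drule (1) bspec) auto

lemma section_section_on: "s \<in> \<Gamma> \<Longrightarrow> section_on C U s"
  using section_on_subset[of UNIV s U] by (simp add: sections_def)

text \<open>One trivialisation around each point suffices because transition maps are smooth. Their
  smoothness is given on fixed vectors, hence the expansion of the section in the standard
  basis.\<close>

lemma section_onI_local:
  assumes U: "open U"
    and loc: "\<And>p. p \<in> U \<Longrightarrow> \<exists>W \<tau> T. (W, \<tau>) \<in> trivs C \<and> open T \<and> p \<in> T \<and> T \<subseteq> W \<and> mfd (U \<inter> T) (\<lambda>q. \<tau> q (s q))"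
  shows "section_on C U s"
  unfolding section_on_def
proof clarify
  fix W' \<tau>' assume t': "(W', \<tau>') \<in> trivs C"
  show "mfd (U \<inter> W') (\<lambda>p. \<tau>' p (s p))"
  proof (rule mfd_local)
    show "open (U \<inter> W')" using U trivD(1)[OF t'] by blast
    fix p assume p: "p \<in> U \<inter> W'"
    then have "p \<in> U" by simp
    from loc[OF this] obtain W \<tau> T where t: "(W, \<tau>) \<in> trivs C" and T: "open T" "p \<in> T" "T \<subseteq> W"
      "mfd (U \<inter> T) (\<lambda>q. \<tau> q (s q))" by (elim exE conjE)
    have o: "open (U \<inter> W' \<inter> T)" using U T(1) trivD(1)[OF t'] by blast
    have "mfd (U \<inter> W' \<inter> T) (\<lambda>q. \<Sum>i\<in>UNIV. (\<tau> q (s q) $ i) *\<^sub>R \<tau>' q (inv (\<tau> q) (std_basis i)))"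
    proof (intro mfd_sum[OF o] mfd_scaleR[OF o] mfd_vec_nth[OF o])
      show "mfd (U \<inter> W' \<inter> T) (\<lambda>q. \<tau> q (s q))" by (rule mfd_subset[OF T(4)]) blast
      show "mfd (U \<inter> W' \<inter> T) (\<lambda>q. \<tau>' q (inv (\<tau> q) (std_basis i)))" for i
        by (rule mfd_subset[OF transition_smooth[OF t t']]) (use T(3) in blast)
    qed
    then have "mfd (U \<inter> W' \<inter> T) (\<lambda>p. \<tau>' p (s p))"
    proof (rule mfd_cong[OF o])
      fix q assume q: "q \<in> U \<inter> W' \<inter> T"
      then have W: "q \<in> W" "q \<in> W'" using T(3) by blast+
      have "\<tau>' q (s q) = \<tau>' q (inv (\<tau> q) (\<Sum>i\<in>UNIV. (\<tau> q (s q) $ i) *\<^sub>R std_basis i))"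
        by (simp add: std_basis_expansion trivD(4)[OF t W(1)])
      also have "\<dots> = (\<Sum>i\<in>UNIV. (\<tau> q (s q) $ i) *\<^sub>R \<tau>' q (inv (\<tau> q) (std_basis i)))"
        using trivD(2)[OF t' W(2)] trivD(6)[OF t W(1)] by (simp add: linear_sum linear_cmul)
      finally show "(\<Sum>i\<in>UNIV. (\<tau> q (s q) $ i) *\<^sub>R \<tau>' q (inv (\<tau> q) (std_basis i))) = \<tau>' q (s q)" by simp
    qed
    then show "\<exists>T. open T \<and> p \<in> T \<and> mfd (U \<inter> W' \<inter> T) (\<lambda>p. \<tau>' p (s p))" using T by blast
  qed
qed

lemma section_on_add:
  assumes "open U" "section_on C U s" "section_on C U t"
  shows "section_on C U (\<lambda>p. s p + t p)"
  unfolding section_on_def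
proof clarify
  fix W \<tau> assume t: "(W, \<tau>) \<in> trivs C"
  have o: "open (U \<inter> W)" using assms(1) trivD(1)[OF t] by blast
  show "mfd (U \<inter> W) (\<lambda>p. \<tau> p (s p + t p))"
    by (rule mfd_cong[OF o mfd_add[OF o section_onD[OF assms(2) t] section_onD[OF assms(3) t]]])
      (use trivD(2)[OF t] linear_add in fastforce)
qed

lemma section_on_scaleR:
  assumes "open U" "mfd U h" "section_on C U s"
  shows "section_on C U (\<lambda>p. h p *\<^sub>R s p)"
  unfolding section_on_def
proof clarify
  fix W \<tau> assume t: "(W, \<tau>) \<in> trivs C"
  have o: "open (U \<inter> W)" using assms(1) trivD(1)[OF t] by blast
  show "mfd (U \<inter> W) (\<lambda>p. \<tau> p (h p *\<^sub>R s p))"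
    by (rule mfd_cong[OF o mfd_scaleR[OF o mfd_subset[OF assms(2)] section_onD[OF assms(3) t]]])
      (use trivD(2)[OF t] linear_cmul in fastforce)+
qed

lemma section_add: "s \<in> \<Gamma> \<Longrightarrow> t \<in> \<Gamma> \<Longrightarrow> (\<lambda>p. s p + t p) \<in> \<Gamma>"
  by (simp add: sections_def section_on_add)

lemma section_scaleR: "mfd UNIV h \<Longrightarrow> s \<in> \<Gamma> \<Longrightarrow> (\<lambda>p. h p *\<^sub>R s p) \<in> \<Gamma>"
  by (simp add: sections_def section_on_scaleR)

lemma section_cmul: "s \<in> \<Gamma> \<Longrightarrow> (\<lambda>p. c *\<^sub>R s p) \<in> \<Gamma>"
  by (rule section_scaleR[OF mfd_const])

lemma section_zero: "(\<lambda>p. 0) \<in> \<Gamma>"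
proof -
  have "section_on C UNIV (\<lambda>p. 0)"
    unfolding section_on_def
  proof clarify
    fix W \<tau> assume t: "(W, \<tau>) \<in> trivs C"
    show "mfd (UNIV \<inter> W) (\<lambda>p. \<tau> p 0)"
      by (rule mfd_cong[OF _ mfd_const[of _ 0]]) (use trivD[OF t] in \<open>auto simp: linear_0\<close>)
  qed
  then show ?thesis by (simp add: sections_def)
qed

lemma section_sum: "(\<And>i. i \<in> I \<Longrightarrow> s i \<in> \<Gamma>) \<Longrightarrow> (\<lambda>p. \<Sum>i\<in>I. s i p) \<in> \<Gamma>"
  by (induction I rule: infinite_finite_induct) (auto intro: section_zero section_add)

text \<open>The square of the cut-off appears because both the sections \<open>e i\<close> and the coefficients have to be
  extended by zero.\<close>

lemma frame_at:
  obtains \<rho> :: "'m \<Rightarrow> real" and e :: "'k \<Rightarrow> ('m, 'k) sect"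
    where "mfd UNIV \<rho>" "\<rho> p = 1" "\<And>i. e i \<in> \<Gamma>"
    "\<And>q. \<rho> q \<noteq> 0 \<Longrightarrow> inj (\<lambda>i. e i q) \<and> independent (range (\<lambda>i. e i q))"
    "\<And>s. s \<in> \<Gamma> \<Longrightarrow> \<exists>c. (\<forall>i. mfd UNIV (c i)) \<and> (\<forall>q. (\<rho> q * \<rho> q) *\<^sub>R s q = (\<Sum>i\<in>UNIV. c i q *\<^sub>R e i q)) \<and>
      (s p = 0 \<longrightarrow> (\<forall>i. c i p = 0))"
proof -
  obtain W \<tau> where t: "(W, \<tau>) \<in> trivs C" "p \<in> W" by (rule triv_at)
  note tD = trivD[OF t(1)]
  obtain \<rho> K where \<rho>: "mfd UNIV \<rho>" "\<rho> p = (1::real)" "closed K" "K \<subseteq> W" "\<And>q. q \<notin> K \<Longrightarrow> \<rho> q = 0"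
    by (rule bump_function[OF tD(1) t(2)]) blast
  define e where "e i q = \<rho> q *\<^sub>R inv (\<tau> q) (std_basis i)" for i q
  have \<rho>W: "q \<in> W" if "\<rho> q \<noteq> 0" for q using \<rho>(4,5) that by blast
  have "section_on C UNIV (e i)" for i
  proof (rule section_onI_local)
    fix q
    show "\<exists>W \<tau> T. (W, \<tau>) \<in> trivs C \<and> open T \<and> q \<in> T \<and> T \<subseteq> W \<and> mfd (UNIV \<inter> T) (\<lambda>q. \<tau> q (e i q))"
    proof (cases "q \<in> W")
      case True
      have "mfd W (\<lambda>q. \<rho> q *\<^sub>R (std_basis i :: real^'k))"
        by (rule mfd_scaleR[OF tD(1) mfd_subset[OF \<rho>(1)] mfd_const]) simp
      then have "mfd W (\<lambda>q. \<tau> q (e i q))"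
        by (rule mfd_cong[OF tD(1)]) (use tD in \<open>auto simp: e_def linear_cmul\<close>)
      then show ?thesis using True t(1) tD(1) by (intro exI[of _ W] exI[of _ \<tau>]) auto
    next
      case False
      \<comment> \<open>Near a point outside \<open>W\<close> the section is zero, since the
        complement of \<open>K\<close> is open; any trivialisation there shows smoothness.\<close>
      obtain W' \<tau>' where t': "(W', \<tau>') \<in> trivs C" "q \<in> W'" by (rule triv_at)
      have o: "open (W' - K)" using trivD(1)[OF t'(1)] \<rho>(3) by blast
      have "mfd (W' - K) (\<lambda>q. \<tau>' q (e i q))"
        by (rule mfd_cong[OF o mfd_const[of _ 0]]) (use trivD(2)[OF t'(1)] \<rho>(5) in \<open>auto simp: e_def linear_0\<close>)
      then show ?thesis using False \<rho>(4) t' o by (intro exI[of _ W'] exI[of _ \<tau>'] exI[of _ "W' - K"]) auto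
    qed
  qed simp
  then have e: "e i \<in> \<Gamma>" for i by (simp add: sections_def)
  have basis: "inj (\<lambda>i. e i q) \<and> independent (range (\<lambda>i. e i q))" if "\<rho> q \<noteq> 0" for q
  proof -
    note W = \<rho>W[OF that]
    let ?L = "\<lambda>x. \<rho> q *\<^sub>R inv (\<tau> q) x"
    have lin: "linear ?L" using tD(6)[OF W] by (auto simp: linear_iff algebra_simps)
    have inj: "inj ?L" using that tD(5)[OF W] by (auto simp: inj_def) metis
    have "independent (?L ` range std_basis)"
      by (intro linear_independent_injective_image[OF lin] std_basis_basis inj_on_subset[OF inj]) auto
    moreover have "inj (\<lambda>i. ?L (std_basis i))" using inj std_basis_basis(1) by (auto simp: inj_def)
    ultimately show ?thesis by (simp add: e_def image_image)
  qed
  have "\<exists>c. (\<forall>i. mfd UNIV (c i)) \<and> (\<forall>q. (\<rho> q * \<rho> q) *\<^sub>R s q = (\<Sum>i\<in>UNIV. c i q *\<^sub>R e i q)) \<and>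
      (s p = 0 \<longrightarrow> (\<forall>i. c i p = 0))" if s: "s \<in> \<Gamma>" for s
  proof (intro exI conjI allI impI)
    let ?c = "\<lambda>i q. \<rho> q * \<tau> q (s q) $ i"
    show "mfd UNIV (?c i)" for i
    proof (rule mfd_extend_zero[OF tD(1) \<rho>(3,4)])
      show "mfd W (?c i)"
        by (intro mfd_mult[OF tD(1)] mfd_vec_nth[OF tD(1)] sectionD[OF s t(1)] mfd_subset[OF \<rho>(1)]) simp
    qed (simp add: \<rho>(5))
    show "(\<rho> q * \<rho> q) *\<^sub>R s q = (\<Sum>i\<in>UNIV. ?c i q *\<^sub>R e i q)" for q
    proof (cases "\<rho> q = 0")
      case False
      note W = \<rho>W[OF this]
      have "(\<Sum>i\<in>UNIV. ?c i q *\<^sub>R e i q) =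
          (\<rho> q * \<rho> q) *\<^sub>R (\<Sum>i\<in>UNIV. \<tau> q (s q) $ i *\<^sub>R inv (\<tau> q) (std_basis i))"
        by (simp add: e_def scaleR_sum_right algebra_simps)
      also have "(\<Sum>i\<in>UNIV. \<tau> q (s q) $ i *\<^sub>R inv (\<tau> q) (std_basis i)) =
          inv (\<tau> q) (\<Sum>i\<in>UNIV. \<tau> q (s q) $ i *\<^sub>R std_basis i)"
        by (simp add: linear_sum[OF tD(6)[OF W]] linear_cmul[OF tD(6)[OF W]])
      finally show ?thesis by (simp add: std_basis_expansion tD(4)[OF W])
    qed (simp add: e_def)
    show "?c i p = 0" if "s p = 0" for i
      using that tD(2)[OF t(2)] by (simp add: linear_0)
  qed
  note exp = this
  show ?thesis by (rule that) (fact \<rho> e basis exp)+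
qed

lemma section_through: obtains s where "s \<in> \<Gamma>" "s p = x"
proof -
  obtain \<rho> :: "'m \<Rightarrow> real" and e :: "'k \<Rightarrow> ('m, 'k) sect" where *: "\<rho> p = (1::real)" "\<And>i. e i \<in> \<Gamma>"
    "\<And>q. \<rho> q \<noteq> 0 \<Longrightarrow> inj (\<lambda>i. e i q) \<and> independent (range (\<lambda>i. e i q))"
    by (rule frame_at[of p]) blast
  have "inj (\<lambda>i. e i p)" "independent (range (\<lambda>i. e i p))" using *(1) *(3)[of p] by simp_all
  from basis_expansion[OF this] obtain c where "x = (\<Sum>i\<in>UNIV. c i *\<^sub>R e i p)" .
  moreover have "(\<lambda>q. \<Sum>i\<in>UNIV. c i *\<^sub>R e i q) \<in> \<Gamma>" by (intro section_sum section_cmul *)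
  ultimately show ?thesis using that by metis
qed

text \<open>Consider \<open>s = u - v\<close>. Multiplication by \<open>\<rho> * \<rho>\<close> does
  not change \<open>T s\<close>, since \<rho> is \<open>1\<close> at \<open>p\<close>, and it turns
  \<open>s\<close> into a combination of global sections whose coefficients vanish at
  \<open>p\<close>.\<close>

lemma tensorial:
  fixes T :: "('m, 'k) sect \<Rightarrow> 'b::real_vector"
  assumes add: "\<And>u v. u \<in> \<Gamma> \<Longrightarrow> v \<in> \<Gamma> \<Longrightarrow> T (\<lambda>q. u q + v q) = T u + T v"
    and hom: "\<And>h u. mfd UNIV h \<Longrightarrow> u \<in> \<Gamma> \<Longrightarrow> T (\<lambda>q. h q *\<^sub>R u q) = h p *\<^sub>R T u"
    and uv: "u \<in> \<Gamma>" "v \<in> \<Gamma>" "u p = v p"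
  shows "T u = T v"
proof -
  obtain \<rho> :: "'m \<Rightarrow> real" and e :: "'k \<Rightarrow> ('m, 'k) sect" where \<rho>: "mfd UNIV \<rho>" "\<rho> p = (1::real)" "\<And>i. e i \<in> \<Gamma>" and
    exp: "\<And>s. s \<in> \<Gamma> \<Longrightarrow> \<exists>c. (\<forall>i. mfd UNIV (c i)) \<and> (\<forall>q. (\<rho> q * \<rho> q) *\<^sub>R s q = (\<Sum>i\<in>UNIV. c i q *\<^sub>R e i q)) \<and>
      (s p = 0 \<longrightarrow> (\<forall>i. c i p = 0))"
    by (rule frame_at[of p]) blast
  have T0: "T (\<lambda>q. 0) = 0" using hom[OF mfd_const[of _ 0] section_zero] by simp
  have sum: "T (\<lambda>q. \<Sum>i\<in>I. s i q) = (\<Sum>i\<in>I. T (s i))" if "finite I" "\<And>i. s i \<in> \<Gamma>" for I and s :: "'k \<Rightarrow> ('m, 'k) sect"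
    using that(1) by (induction I) (simp_all add: T0 add section_sum that(2))
  define s where "s q = u q + (-1) *\<^sub>R v q" for q
  have s: "s \<in> \<Gamma>" unfolding s_def using uv by (intro section_add section_cmul)
  then obtain c where c: "\<And>i. mfd UNIV (c i)" "\<And>q. (\<rho> q * \<rho> q) *\<^sub>R s q = (\<Sum>i\<in>UNIV. c i q *\<^sub>R e i q)"
    "\<And>i. c i p = 0" using exp[OF s] uv(3) by (auto simp: s_def)
  have "T s = T (\<lambda>q. (\<rho> q * \<rho> q) *\<^sub>R s q)"
    using hom[OF mfd_mult[OF open_UNIV \<rho>(1) \<rho>(1)] s] \<rho>(2) by simp
  also have "\<dots> = (\<Sum>i\<in>UNIV. T (\<lambda>q. c i q *\<^sub>R e i q))"
    unfolding c(2) using sum[of UNIV "\<lambda>i q. c i q *\<^sub>R e i q"] section_scaleR[OF c(1) \<rho>(3)] by simp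
  also have "\<dots> = 0" using hom[OF c(1) \<rho>(3)] c(3) by simp
  finally have "T s = 0" .
  moreover have "T s = T u + (-1) *\<^sub>R T v"
    unfolding s_def add[OF uv(1) section_cmul[OF uv(2)]] hom[OF mfd_const uv(2)] by simp
  ultimately show ?thesis by simp
qed

section \<open>Smoothness tested through local frames\<close>

lemma gram_inv_smooth:
  assumes "open W" and h: "\<And>p. nondegenerate_form (h p)"
    and sm: "\<And>u v. u \<in> \<Gamma> \<Longrightarrow> v \<in> \<Gamma> \<Longrightarrow> mfd UNIV (\<lambda>p. h p (u p) (v p))"
    and e: "\<And>i. e i \<in> \<Gamma>" "\<And>q. q \<in> W \<Longrightarrow> inj (\<lambda>i. e i q) \<and> independent (range (\<lambda>i. e i q))"
  shows "mfd W (\<lambda>q. gram_inv (h q) (\<lambda>i. e i q) $ i $ j)"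
  unfolding gram_inv_def
proof (rule mfd_matrix_inv[OF assms(1)])
  show "mfd W (\<lambda>p. (\<chi> i j. h p (e i p) (e j p)) $ i $ j)" for i j
    using mfd_subset[OF sm[OF e(1) e(1)], of W i j] by simp
  show "invertible (\<chi> i j. h p (e i p) (e j p))" if "p \<in> W" for p
    using nondegenerate_form.gram_invertible[OF h] e(2)[OF that] by blast
qed

lemma open_support: "mfd UNIV \<rho> \<Longrightarrow> open {q. \<rho> q \<noteq> (0::real)}"
  using open_Collect_neq[OF mfd_continuous continuous_on_const] .

text \<open>Locally \<open>s\<close> is the sum of its pairings with a frame times the dual frame,
  and the dual frame is smooth because the inverse Gram matrix is.\<close>

lemma section_by_pairing:
  assumes "\<And>w. w \<in> \<Gamma> \<Longrightarrow> mfd UNIV (\<lambda>q. pr q (s q) (w q))"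
  shows "s \<in> \<Gamma>"
proof -
  have "section_on C UNIV s"
  proof (rule section_onI_local)
    fix p
    obtain \<rho> :: "'m \<Rightarrow> real" and e :: "'k \<Rightarrow> ('m, 'k) sect" where \<rho>: "mfd UNIV \<rho>" "\<rho> p = (1::real)" and e: "\<And>i. e i \<in> \<Gamma>"
      "\<And>q. \<rho> q \<noteq> 0 \<Longrightarrow> inj (\<lambda>i. e i q) \<and> independent (range (\<lambda>i. e i q))"
      by (rule frame_at[of p]) blast
    obtain W \<tau> where t: "(W, \<tau>) \<in> trivs C" "p \<in> W" by (rule triv_at)
    define T where "T = {q. \<rho> q \<noteq> 0} \<inter> W"
    have o: "open T" unfolding T_def using open_support[OF \<rho>(1)] trivD(1)[OF t(1)] by blast
    have "mfd T (\<lambda>q. \<Sum>i\<in>UNIV. pr q (s q) (e i q) *\<^sub>R (\<Sum>j\<in>UNIV. gram_inv (pr q) (\<lambda>i. e i q) $ i $ j *\<^sub>R \<tau> q (e j q)))"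
      by (intro mfd_sum[OF o] mfd_scaleR[OF o] gram_inv_smooth[OF o] mfd_subset[OF sectionD[OF e(1) t(1)]]
          mfd_subset[OF assms[OF e(1)]] pairing_smooth e)
        (auto simp: T_def form.nondegenerate_form_axioms)
    then have "mfd T (\<lambda>q. \<tau> q (s q))"
    proof (rule mfd_cong[OF o])
      fix q assume "q \<in> T"
      then have q: "inj (\<lambda>i. e i q)" "independent (range (\<lambda>i. e i q))" "q \<in> W" using e(2) by (auto simp: T_def)
      have "\<tau> q (s q) = \<tau> q (\<Sum>i\<in>UNIV. pr q (s q) (e i q) *\<^sub>R dual_basis (pr q) (\<lambda>i. e i q) i)"
        by (simp only: form.expand_dual_basis[OF q(1,2)])
      then show "(\<Sum>i\<in>UNIV. pr q (s q) (e i q) *\<^sub>R (\<Sum>j\<in>UNIV. gram_inv (pr q) (\<lambda>i. e i q) $ i $ j *\<^sub>R \<tau> q (e j q)))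
          = \<tau> q (s q)"
        using trivD(2)[OF t(1) q(3)] by (simp add: dual_basis_def linear_sum linear_cmul)
    qed
    then show "\<exists>W \<tau> T. (W, \<tau>) \<in> trivs C \<and> open T \<and> p \<in> T \<and> T \<subseteq> W \<and> mfd (UNIV \<inter> T) (\<lambda>q. \<tau> q (s q))"
      using o t \<rho>(2) by (intro exI[of _ W] exI[of _ \<tau>] exI[of _ T]) (auto simp: T_def)
  qed simp
  then show ?thesis by (simp add: sections_def)
qed

subsection \<open>Anchor and Dorfman bracket\<close>

lemma anchor_tangent: "an p u \<in> tangent_space (atlas C) p"
  and anchor_linear: "linear (\<lambda>u. an p u f)"
proof -
  have "\<forall>p. \<forall>u. an p u \<in> tangent_space (atlas C) p"
    using courant unfolding courant_algebroid_def by (elim conjE)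
  moreover have "\<forall>p f. linear (\<lambda>u. an p u f)"
    using courant unfolding courant_algebroid_def by (elim conjE)
  ultimately show "an p u \<in> tangent_space (atlas C) p" "linear (\<lambda>u. an p u f)" by blast+
qed

lemmas anchor_simps = linear_add[OF anchor_linear] linear_cmul[OF anchor_linear] linear_0[OF anchor_linear]
  linear_diff[OF anchor_linear] linear_neg[OF anchor_linear]

lemmas anchor_mult = tangent_mult[OF anchor_tangent]


lemma anchor_smooth:
  assumes "u \<in> \<Gamma>"
  shows "mfd UNIV (\<lambda>p. an p (u p) f)"
proof (cases "mfd UNIV f")
  case True
  have "anchor_sec C u \<in> vector_fields (atlas C)" using courant assms by (simp add: courant_algebroid_def)
  with True show ?thesis by (simp add: vector_fields_def anchor_sec_def)
next
  case False
  then show ?thesis using tangent_nonsmooth[OF anchor_tangent] mfd_const by simp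
qed

lemma dorfman_closed: "u \<in> \<Gamma> \<Longrightarrow> v \<in> \<Gamma> \<Longrightarrow> dorfman C u v \<in> \<Gamma>"
  using courant unfolding courant_algebroid_def by (elim conjE) simp

lemma dorfman_combination:
  assumes "u \<in> \<Gamma>" "v \<in> \<Gamma>" "w \<in> \<Gamma>"
  shows "dorfman C (\<lambda>p. a *\<^sub>R u p + b *\<^sub>R v p) w = (\<lambda>p. a *\<^sub>R dorfman C u w p + b *\<^sub>R dorfman C v w p)"
    "dorfman C w (\<lambda>p. a *\<^sub>R u p + b *\<^sub>R v p) = (\<lambda>p. a *\<^sub>R dorfman C w u p + b *\<^sub>R dorfman C w v p)"
proof -
  have "\<forall>u\<in>\<Gamma>. \<forall>v\<in>\<Gamma>. \<forall>w\<in>\<Gamma>. \<forall>a b.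
      dorfman C (\<lambda>p. a *\<^sub>R u p + b *\<^sub>R v p) w = (\<lambda>p. a *\<^sub>R dorfman C u w p + b *\<^sub>R dorfman C v w p) \<and>
      dorfman C w (\<lambda>p. a *\<^sub>R u p + b *\<^sub>R v p) = (\<lambda>p. a *\<^sub>R dorfman C w u p + b *\<^sub>R dorfman C w v p)"
    using courant unfolding courant_algebroid_def by (elim conjE)
  with assms show "dorfman C (\<lambda>p. a *\<^sub>R u p + b *\<^sub>R v p) w = (\<lambda>p. a *\<^sub>R dorfman C u w p + b *\<^sub>R dorfman C v w p)"
    "dorfman C w (\<lambda>p. a *\<^sub>R u p + b *\<^sub>R v p) = (\<lambda>p. a *\<^sub>R dorfman C w u p + b *\<^sub>R dorfman C w v p)"
    by simp_all
qed

lemma dorfman_add: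
  assumes "u \<in> \<Gamma>" "v \<in> \<Gamma>" "w \<in> \<Gamma>"
  shows "dorfman C (\<lambda>p. u p + v p) w = (\<lambda>p. dorfman C u w p + dorfman C v w p)"
    "dorfman C w (\<lambda>p. u p + v p) = (\<lambda>p. dorfman C w u p + dorfman C w v p)"
  using dorfman_combination[OF assms, of 1 1] by simp_all

lemma dorfman_jacobi:
  assumes "u \<in> \<Gamma>" "v \<in> \<Gamma>" "w \<in> \<Gamma>"
  shows "dorfman C u (dorfman C v w) p = dorfman C (dorfman C u v) w p + dorfman C v (dorfman C u w) p"
proof -
  have "\<forall>u\<in>\<Gamma>. \<forall>v\<in>\<Gamma>. \<forall>w\<in>\<Gamma>. dorfman C u (dorfman C v w) =
      (\<lambda>p. dorfman C (dorfman C u v) w p + dorfman C v (dorfman C u w) p)"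
    using courant unfolding courant_algebroid_def by (elim conjE)
  from bspec[OF bspec[OF bspec[OF this assms(1)] assms(2)] assms(3)] show ?thesis by (rule fun_cong)
qed

lemma dorfman_pairing:
  assumes "u \<in> \<Gamma>" "v \<in> \<Gamma>" "w \<in> \<Gamma>"
  shows "an p (u p) (\<lambda>q. pr q (v q) (w q)) = pr p (dorfman C u v p) (w p) + pr p (v p) (dorfman C u w p)"
proof -
  have "\<forall>u\<in>\<Gamma>. \<forall>v\<in>\<Gamma>. \<forall>w\<in>\<Gamma>. \<forall>p. an p (u p) (\<lambda>q. pr q (v q) (w q)) =
      pr p (dorfman C u v p) (w p) + pr p (v p) (dorfman C u w p)"
    using courant unfolding courant_algebroid_def by (elim conjE)
  with assms show ?thesis by simp
qed

text \<open>Pairing with a test section turns the claim into the product rule for the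
  anchor.\<close>

lemma dorfman_leibniz:
  assumes h: "mfd UNIV h" and uv: "u \<in> \<Gamma>" "v \<in> \<Gamma>"
  shows "dorfman C u (\<lambda>p. h p *\<^sub>R v p) = (\<lambda>p. an p (u p) h *\<^sub>R v p + h p *\<^sub>R dorfman C u v p)"
proof (rule ext, rule form.eqI)
  fix p x
  obtain w where w: "w \<in> \<Gamma>" "w p = x" by (rule section_through)
  have "an p (u p) (\<lambda>q. pr q (h q *\<^sub>R v q) (w q)) = an p (u p) (\<lambda>q. h q * pr q (v q) (w q))"
    by (simp add: form.form_simps)
  also have "\<dots> = an p (u p) h * pr p (v p) x + h p * an p (u p) (\<lambda>q. pr q (v q) (w q))"
    by (simp add: anchor_mult[OF h pairing_smooth[OF uv(2) w(1)]] w)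
  finally show "pr p (dorfman C u (\<lambda>p. h p *\<^sub>R v p) p) x =
      pr p (an p (u p) h *\<^sub>R v p + h p *\<^sub>R dorfman C u v p) x"
    using dorfman_pairing[OF uv(1) section_scaleR[OF h uv(2)] w(1), of p] dorfman_pairing[OF uv w(1), of p] w(2)
    by (simp add: form.form_simps algebra_simps)
qed

text \<open>Apply the Jacobi identity to \<open>f w\<close>. The mixed terms, in which
  \<open>f\<close> and \<open>w\<close> are both acted on, are symmetric in \<open>u\<close> and
  \<open>v\<close> and cancel; those with \<open>f\<close> undifferentiated cancel by the Jacobi
  identity for \<open>w\<close>; the coefficient left at \<open>w p\<close> is the claim.\<close>

lemma anchor_dorfman:
  assumes uv: "u \<in> \<Gamma>" "v \<in> \<Gamma>" and f: "mfd UNIV f"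
  shows "an p (dorfman C u v p) f = an p (u p) (\<lambda>q. an q (v q) f) - an p (v p) (\<lambda>q. an q (u q) f)"
proof -
  \<comment> \<open>Any non-zero fibre vector will do; a unit vector exists because index types are
    never empty.\<close>
  obtain w where w: "w \<in> \<Gamma>" "w p = axis undefined 1" by (rule section_through)
  have double: "dorfman C u (dorfman C v (\<lambda>p. f p *\<^sub>R w p)) p =
      an p (u p) (\<lambda>q. an q (v q) f) *\<^sub>R w p + an p (v p) f *\<^sub>R dorfman C u w p
      + an p (u p) f *\<^sub>R dorfman C v w p + f p *\<^sub>R dorfman C u (dorfman C v w) p"
    if "u \<in> \<Gamma>" "v \<in> \<Gamma>" for u v
    using that w f
    by (simp add: dorfman_leibniz dorfman_add section_scaleR anchor_smooth dorfman_closed)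
  have "dorfman C u (dorfman C v (\<lambda>p. f p *\<^sub>R w p)) p =
      dorfman C (dorfman C u v) (\<lambda>p. f p *\<^sub>R w p) p + dorfman C v (dorfman C u (\<lambda>p. f p *\<^sub>R w p)) p"
    by (intro dorfman_jacobi uv section_scaleR f w)
  then have "(an p (dorfman C u v p) f - (an p (u p) (\<lambda>q. an q (v q) f) - an p (v p) (\<lambda>q. an q (u q) f))) *\<^sub>R w p = 0"
    using dorfman_jacobi[OF uv w(1), of p]
    unfolding double[OF uv] double[OF uv(2,1)] dorfman_leibniz[OF f dorfman_closed[OF uv] w(1)]
    by (simp add: algebra_simps)
  moreover have "w p \<noteq> 0" unfolding w(2) by (simp add: axis_eq_0_iff)
  ultimately show ?thesis by simp
qed

end

subsection \<open>Generalised connections and curvature\<close>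

locale courant_connection = courant_alg C
  for C :: "('m::{t2_space,second_countable_topology}, 'n::finite, 'k::finite) courant" +
  fixes D :: "('m, 'k) conn"
  assumes conn: "generalised_connection C D"
begin

lemma conn_closed: "u \<in> \<Gamma> \<Longrightarrow> v \<in> \<Gamma> \<Longrightarrow> D u v \<in> \<Gamma>"
  using conn unfolding generalised_connection_def by (elim conjE) blast

lemma conn_combination:
  assumes "u \<in> \<Gamma>" "v \<in> \<Gamma>" "w \<in> \<Gamma>"
  shows "D (\<lambda>p. a *\<^sub>R u p + b *\<^sub>R v p) w = (\<lambda>p. a *\<^sub>R D u w p + b *\<^sub>R D v w p)"
    "D w (\<lambda>p. a *\<^sub>R u p + b *\<^sub>R v p) = (\<lambda>p. a *\<^sub>R D w u p + b *\<^sub>R D w v p)"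
proof -
  have "\<forall>u\<in>\<Gamma>. \<forall>v\<in>\<Gamma>. \<forall>w\<in>\<Gamma>. \<forall>a b.
      D (\<lambda>p. a *\<^sub>R u p + b *\<^sub>R v p) w = (\<lambda>p. a *\<^sub>R D u w p + b *\<^sub>R D v w p) \<and>
      D w (\<lambda>p. a *\<^sub>R u p + b *\<^sub>R v p) = (\<lambda>p. a *\<^sub>R D w u p + b *\<^sub>R D w v p)"
    using conn unfolding generalised_connection_def by (elim conjE)
  with assms show "D (\<lambda>p. a *\<^sub>R u p + b *\<^sub>R v p) w = (\<lambda>p. a *\<^sub>R D u w p + b *\<^sub>R D v w p)"
    "D w (\<lambda>p. a *\<^sub>R u p + b *\<^sub>R v p) = (\<lambda>p. a *\<^sub>R D w u p + b *\<^sub>R D w v p)"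
    by simp_all
qed

lemma conn_add:
  assumes "u \<in> \<Gamma>" "v \<in> \<Gamma>" "w \<in> \<Gamma>"
  shows "D (\<lambda>p. u p + v p) w = (\<lambda>p. D u w p + D v w p)"
    "D w (\<lambda>p. u p + v p) = (\<lambda>p. D w u p + D w v p)"
  using conn_combination[OF assms, of 1 1] by simp_all

lemma conn_scale:
  assumes "mfd UNIV h" "u \<in> \<Gamma>" "v \<in> \<Gamma>"
  shows "D (\<lambda>p. h p *\<^sub>R u p) v = (\<lambda>p. h p *\<^sub>R D u v p)"
    "D u (\<lambda>p. h p *\<^sub>R v p) = (\<lambda>p. an p (u p) h *\<^sub>R v p + h p *\<^sub>R D u v p)"
proof -
  have "\<forall>h u v. mfd UNIV h \<and> u \<in> \<Gamma> \<and> v \<in> \<Gamma> \<longrightarrow>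
        D (\<lambda>p. h p *\<^sub>R u p) v = (\<lambda>p. h p *\<^sub>R D u v p) \<and>
        D u (\<lambda>p. h p *\<^sub>R v p) = (\<lambda>p. an p (u p) h *\<^sub>R v p + h p *\<^sub>R D u v p)"
    using conn unfolding generalised_connection_def by (elim conjE)
  with assms show "D (\<lambda>p. h p *\<^sub>R u p) v = (\<lambda>p. h p *\<^sub>R D u v p)"
    "D u (\<lambda>p. h p *\<^sub>R v p) = (\<lambda>p. an p (u p) h *\<^sub>R v p + h p *\<^sub>R D u v p)" by blast+
qed

lemma conn_pairing:
  assumes "u \<in> \<Gamma>" "v \<in> \<Gamma>" "w \<in> \<Gamma>"
  shows "an p (u p) (\<lambda>q. pr q (v q) (w q)) = pr p (D u v p) (w p) + pr p (v p) (D u w p)"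
proof -
  have "\<forall>u\<in>\<Gamma>. \<forall>v\<in>\<Gamma>. \<forall>w\<in>\<Gamma>. \<forall>p. an p (u p) (\<lambda>q. pr q (v q) (w q)) =
      pr p (D u v p) (w p) + pr p (v p) (D u w p)"
    using conn unfolding generalised_connection_def by (elim conjE)
  with assms show ?thesis by simp
qed

lemma conn_at_eq:
  assumes "u \<in> \<Gamma>" "v \<in> \<Gamma>"
  shows "conn_at C D p (u p) v = D u v p"
  unfolding conn_at_def
proof (rule the_equality)
  show "\<exists>u'\<in>\<Gamma>. u' p = u p \<and> D u v p = D u' v p" using assms by blast
  fix y assume "\<exists>u'\<in>\<Gamma>. u' p = u p \<and> y = D u' v p"
  then obtain u' where u': "u' \<in> \<Gamma>" "u' p = u p" "y = D u' v p" by blast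
  have "D u' v p = D u v p"
    by (rule tensorial[where T = "\<lambda>u. D u v p" and p = p])
       (use assms u' in \<open>simp_all add: conn_add conn_scale\<close>)
  then show "y = D u v p" using u' by simp
qed

lemma conn_at_linear:
  assumes v: "v \<in> \<Gamma>"
  shows "linear (\<lambda>x. conn_at C D p x v)"
proof (rule linearI)
  fix x y c
  obtain u where u: "u \<in> \<Gamma>" "u p = x" by (rule section_through)
  obtain w where w: "w \<in> \<Gamma>" "w p = y" by (rule section_through)
  show "conn_at C D p (x + y) v = conn_at C D p x v + conn_at C D p y v"
    using conn_at_eq[OF section_add[OF u(1) w(1)] v, of p] conn_at_eq[OF u(1) v, of p]
      conn_at_eq[OF w(1) v, of p] u w v by (simp add: conn_add)
  show "conn_at C D p (c *\<^sub>R x) v = c *\<^sub>R conn_at C D p x v"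
    using conn_at_eq[OF section_cmul[OF u(1), where c = c] v, of p] conn_at_eq[OF u(1) v, of p]
      u v by (simp add: conn_scale(1)[OF mfd_const])
qed

lemma conn_at_add: "v \<in> \<Gamma> \<Longrightarrow> w \<in> \<Gamma> \<Longrightarrow>
    conn_at C D p x (\<lambda>p. v p + w p) = conn_at C D p x v + conn_at C D p x w"
  by (rule section_through[of p x]) (auto simp: conn_add conn_at_eq section_add)

lemma conn_at_scale: "mfd UNIV h \<Longrightarrow> v \<in> \<Gamma> \<Longrightarrow>
    conn_at C D p x (\<lambda>p. h p *\<^sub>R v p) = an p x h *\<^sub>R v p + h p *\<^sub>R conn_at C D p x v"
  by (rule section_through[of p x]) (auto simp: conn_scale conn_at_eq section_scaleR)

abbreviation "sd \<equiv> second_deriv D"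

lemma second_deriv_closed: "u \<in> \<Gamma> \<Longrightarrow> v \<in> \<Gamma> \<Longrightarrow> w \<in> \<Gamma> \<Longrightarrow> sd u v w \<in> \<Gamma>"
  unfolding second_deriv_def
  using section_add[OF _ section_cmul[of _ "-1"], of "D u (D v w)" "D (D u v) w"] by (simp add: conn_closed)

lemma second_deriv_add:
  assumes "u \<in> \<Gamma>" "u' \<in> \<Gamma>" "v \<in> \<Gamma>" "w \<in> \<Gamma>"
  shows "sd (\<lambda>p. u p + u' p) v w p = sd u v w p + sd u' v w p"
    "sd v (\<lambda>p. u p + u' p) w p = sd v u w p + sd v u' w p"
    "sd v w (\<lambda>p. u p + u' p) p = sd v w u p + sd v w u' p"
  using assms by (simp_all add: second_deriv_def conn_add conn_closed)

text \<open>In the last slot the terms with one derivative of \<open>u\<close> are symmetric in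
  \<open>v\<close> and \<open>w\<close>, so they cancel after antisymmetrisation; the defect that
  remains differentiates \<open>h\<close> alone.\<close>

lemma second_deriv_scale:
  assumes h: "mfd UNIV h" and "u \<in> \<Gamma>" "v \<in> \<Gamma>" "w \<in> \<Gamma>"
  shows "sd (\<lambda>p. h p *\<^sub>R u p) v w p = h p *\<^sub>R sd u v w p"
    "sd v (\<lambda>p. h p *\<^sub>R u p) w p = h p *\<^sub>R sd v u w p"
    "sd v w (\<lambda>p. h p *\<^sub>R u p) p = (an p (v p) (\<lambda>q. an q (w q) h) - an p (D v w p) h) *\<^sub>R u p
      + an p (w p) h *\<^sub>R D v u p + an p (v p) h *\<^sub>R D w u p + h p *\<^sub>R sd v w u p"
  using assms
  by (simp_all add: second_deriv_def conn_add conn_scale conn_closed section_scaleR anchor_smooth algebra_simps)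

lemma riemann_eq_ctr:
  "riemann C D a b v w p = 1/2 * (pr p (sd v w b p - sd w v b p) (a p) + pr p (sd b a v p - sd a b v p) (w p)
     - form.ctr p (\<lambda>x y. pr p (conn_at C D p x v) (w p) * pr p (conn_at C D p y b) (a p)))"
  by (simp add: riemann_def form.ctr_def)

lemma bilinear_conn_at_product:
  assumes "v \<in> \<Gamma>" "b \<in> \<Gamma>"
  shows "bilinear (\<lambda>x y. pr p (conn_at C D p x v) z * pr p (conn_at C D p y b) t)"
  using conn_at_linear[OF assms(1), of p] conn_at_linear[OF assms(2), of p]
  by (auto simp: bilinear_def linear_iff form.form_simps algebra_simps)

text \<open>The two antisymmetrised second derivatives trade places, and the trace term is symmetric
  because the inverse of the pairing is. It reduces tensoriality in \<open>a\<close> and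
  \<open>b\<close> to that in \<open>v\<close> and \<open>w\<close>.\<close>

lemma riemann_flip:
  assumes "a \<in> \<Gamma>" "b \<in> \<Gamma>" "v \<in> \<Gamma>" "w \<in> \<Gamma>"
  shows "riemann C D w v b a p = riemann C D a b v w p"
proof -
  have "form.ctr p (\<lambda>x y. pr p (conn_at C D p x b) (a p) * pr p (conn_at C D p y v) (w p)) =
      form.ctr p (\<lambda>x y. pr p (conn_at C D p x v) (w p) * pr p (conn_at C D p y b) (a p))"
    using form.ctr_flip[OF bilinear_conn_at_product[of b v], of p p "a p" "w p"] assms
    by (simp add: mult.commute)
  then show ?thesis by (simp add: riemann_eq_ctr)
qed

lemma riemann_w_add:
  assumes "a \<in> \<Gamma>" "b \<in> \<Gamma>" "v \<in> \<Gamma>" "w \<in> \<Gamma>" "w' \<in> \<Gamma>"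
  shows "riemann C D a b v (\<lambda>p. w p + w' p) p = riemann C D a b v w p + riemann C D a b v w' p"
  using assms
  by (simp add: riemann_eq_ctr second_deriv_add form.form_simps ring_distribs form.ctr_add)

lemma riemann_w_scale:
  assumes "mfd UNIV h" "a \<in> \<Gamma>" "b \<in> \<Gamma>" "v \<in> \<Gamma>" "w \<in> \<Gamma>"
  shows "riemann C D a b v (\<lambda>p. h p *\<^sub>R w p) p = h p *\<^sub>R riemann C D a b v w p"
  using assms
  by (simp add: riemann_eq_ctr second_deriv_scale form.form_simps form.ctr_cmul mult.assoc)
    (simp add: algebra_simps)

lemma riemann_v_add:
  assumes "a \<in> \<Gamma>" "b \<in> \<Gamma>" "v \<in> \<Gamma>" "v' \<in> \<Gamma>" "w \<in> \<Gamma>"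
  shows "riemann C D a b (\<lambda>p. v p + v' p) w p = riemann C D a b v w p + riemann C D a b v' w p"
  using assms
  by (simp add: riemann_eq_ctr second_deriv_add conn_at_add form.form_simps ring_distribs form.ctr_add)

end

locale torsion_free_connection = courant_connection +
  assumes torsion_free: "u \<in> \<Gamma> \<Longrightarrow> v \<in> \<Gamma> \<Longrightarrow> w \<in> \<Gamma> \<Longrightarrow> torsion C D u v w p = 0"
begin

text \<open>Let \<open>g\<close> be the gradient of \<open>h\<close>, i.e. \<open>\<langle>g, x\<rangle> = \<pi>(x)h\<close>. By torsion-freeness the commutator terms by which the
  two second derivatives fail to be tensorial in \<open>v\<close> add up to \<open>\<langle>D\<^sub>g b, a\<rangle>\<close>, which is what the trace term
  of the Riemann tensor subtracts.\<close>

lemma anchor_torsion: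
  assumes h: "mfd UNIV h" and ab: "a \<in> \<Gamma>" "b \<in> \<Gamma>"
  shows "an p (b p) (\<lambda>q. an q (a q) h) - an p (a p) (\<lambda>q. an q (b q) h)
      - an p (D b a p) h + an p (D a b p) h =
    form.ctr p (\<lambda>x y. an p x h * pr p (conn_at C D p y b) (a p))"
proof -
  define g where "g = (\<Sum>i\<in>UNIV. (an p (std_basis i) h) *\<^sub>R dual_basis (pr p) std_basis i)"
  have g: "pr p x g = an p x h" for x
  proof -
    have "pr p x g = (\<Sum>i\<in>UNIV. pr p x (dual_basis (pr p) std_basis i) * an p (std_basis i) h)"
      by (simp add: g_def form.sum_right form.form_simps mult.commute)
    also have "\<dots> = an p (\<Sum>i\<in>UNIV. pr p x (dual_basis (pr p) std_basis i) *\<^sub>R std_basis i) h"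
      by (simp add: linear_sum[OF anchor_linear] anchor_simps)
    finally show ?thesis by (simp add: form.expand_basis[OF std_basis_basis])
  qed
  obtain w where w: "w \<in> \<Gamma>" "w p = g" by (rule section_through)
  have "pr p (D b a p - D a b p - dorfman C b a p) g + pr p (D w b p) (a p) = 0"
    using torsion_free[OF ab(2,1) w(1), of p] w(2) by (simp add: torsion_def)
  then have "an p (D b a p) h - an p (D a b p) h - an p (dorfman C b a p) h + pr p (conn_at C D p g b) (a p) = 0"
    using conn_at_eq[OF w(1) ab(2), of p] w(2) by (simp add: g anchor_simps)
  moreover have "form.ctr p (\<lambda>x y. an p x h * pr p (conn_at C D p y b) (a p)) = pr p (conn_at C D p g b) (a p)"
  proof -
    have "linear (\<lambda>y. pr p (conn_at C D p y b) (a p))"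
      using conn_at_linear[OF ab(2), of p] by (auto simp: linear_iff form.form_simps)
    from form.ctr_right[OF this, of p g] show ?thesis by (simp add: g form.sym[of p g])
  qed
  ultimately show ?thesis by (simp add: anchor_dorfman[OF ab(2,1) h])
qed

lemma riemann_v_scale:
  assumes h: "mfd UNIV h" and ab: "a \<in> \<Gamma>" "b \<in> \<Gamma>" and vw: "v \<in> \<Gamma>" "w \<in> \<Gamma>"
  shows "riemann C D a b (\<lambda>p. h p *\<^sub>R v p) w p = h p *\<^sub>R riemann C D a b v w p"
proof -
  have "form.ctr p (\<lambda>x y. pr p (conn_at C D p x (\<lambda>p. h p *\<^sub>R v p)) (w p) * pr p (conn_at C D p y b) (a p)) =
      form.ctr p (\<lambda>x y. pr p (v p) (w p) * (an p x h * pr p (conn_at C D p y b) (a p))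
        + h p * (pr p (conn_at C D p x v) (w p) * pr p (conn_at C D p y b) (a p)))"
    by (simp add: conn_at_scale[OF h vw(1)] form.form_simps algebra_simps)
  also have "\<dots> = pr p (v p) (w p) * (an p (b p) (\<lambda>q. an q (a q) h) - an p (a p) (\<lambda>q. an q (b q) h)
      - an p (D b a p) h + an p (D a b p) h)
      + h p * form.ctr p (\<lambda>x y. pr p (conn_at C D p x v) (w p) * pr p (conn_at C D p y b) (a p))"
    by (simp only: form.ctr_add form.ctr_cmul anchor_torsion[OF h ab])
  finally show ?thesis
    using ab vw h
    by (simp add: riemann_eq_ctr second_deriv_scale form.form_simps) (simp add: algebra_simps)
qed

text \<open>\<open>tensorial\<close> replaces \<open>w\<close> and then \<open>v\<close>; the flip
  symmetry moves \<open>a\<close> and \<open>b\<close> into their places, where the same argument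
  applies again.\<close>

lemma riemann_cong:
  assumes "a \<in> \<Gamma>" "b \<in> \<Gamma>" "v \<in> \<Gamma>" "w \<in> \<Gamma>" "a' \<in> \<Gamma>" "b' \<in> \<Gamma>" "v' \<in> \<Gamma>" "w' \<in> \<Gamma>"
    and "a p = a' p" "b p = b' p" "v p = v' p" "w p = w' p"
  shows "riemann C D a b v w p = riemann C D a' b' v' w' p"
proof -
  have wv: "riemann C D a b v w p = riemann C D a b v' w' p"
    if "a \<in> \<Gamma>" "b \<in> \<Gamma>" "v \<in> \<Gamma>" "w \<in> \<Gamma>" "v' \<in> \<Gamma>" "w' \<in> \<Gamma>" "v p = v' p" "w p = w' p" for a b v w v' w'
  proof -
    have "riemann C D a b v w p = riemann C D a b v w' p"
      by (rule tensorial[where T = "\<lambda>w. riemann C D a b v w p" and p = p])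
         (use that in \<open>simp_all add: riemann_w_add riemann_w_scale\<close>)
    also have "\<dots> = riemann C D a b v' w' p"
      by (rule tensorial[where T = "\<lambda>v. riemann C D a b v w' p" and p = p])
         (use that in \<open>simp_all add: riemann_v_add riemann_v_scale\<close>)
    finally show ?thesis .
  qed
  have "riemann C D a b v w p = riemann C D a b v' w' p" by (rule wv) (use assms in auto)
  also have "\<dots> = riemann C D w' v' b a p" using assms by (simp add: riemann_flip)
  also have "\<dots> = riemann C D w' v' b' a' p" by (rule wv) (use assms in auto)
  also have "\<dots> = riemann C D a' b' v' w' p" using assms by (simp add: riemann_flip)
  finally show ?thesis .
qed

abbreviation "Rm \<equiv> riemann_at C D"

lemma riemann_at_eq:
  assumes "a \<in> \<Gamma>" "b \<in> \<Gamma>" "v \<in> \<Gamma>" "w \<in> \<Gamma>"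
  shows "Rm p (a p) (b p) (v p) (w p) = riemann C D a b v w p"
  unfolding riemann_at_def
proof (rule the_equality)
  show "\<exists>a'\<in>\<Gamma>. \<exists>b'\<in>\<Gamma>. \<exists>v'\<in>\<Gamma>. \<exists>w'\<in>\<Gamma>. a' p = a p \<and> b' p = b p \<and> v' p = v p \<and> w' p = w p \<and>
      riemann C D a b v w p = riemann C D a' b' v' w' p"
    using assms by (intro bexI[of _ a] bexI[of _ b] bexI[of _ v] bexI[of _ w]) simp_all
  fix r assume "\<exists>a'\<in>\<Gamma>. \<exists>b'\<in>\<Gamma>. \<exists>v'\<in>\<Gamma>. \<exists>w'\<in>\<Gamma>. a' p = a p \<and> b' p = b p \<and> v' p = v p \<and> w' p = w p \<and>
      r = riemann C D a' b' v' w' p"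
  then obtain a' b' v' w' where "a' \<in> \<Gamma>" "b' \<in> \<Gamma>" "v' \<in> \<Gamma>" "w' \<in> \<Gamma>"
    "a' p = a p" "b' p = b p" "v' p = v p" "w' p = w p" "r = riemann C D a' b' v' w' p"
    by (elim bexE conjE)
  then show "r = riemann C D a b v w p" using riemann_cong[of a' b' v' w' a b v w p] assms by simp
qed

lemma riemann_at_linear:
  "linear (\<lambda>t. Rm p x y z t)" "linear (\<lambda>z. Rm p x y z t)" "linear (\<lambda>y. Rm p x y z t)" "linear (\<lambda>x. Rm p x y z t)"
proof -
  have flip: "Rm p x y z t = Rm p t z y x" for x y z t
  proof -
    obtain a where a: "a \<in> \<Gamma>" "a p = x" by (rule section_through)
    obtain b where b: "b \<in> \<Gamma>" "b p = y" by (rule section_through)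
    obtain v where v: "v \<in> \<Gamma>" "v p = z" by (rule section_through)
    obtain w where w: "w \<in> \<Gamma>" "w p = t" by (rule section_through)
    show ?thesis
      using riemann_at_eq[OF a(1) b(1) v(1) w(1), of p] riemann_at_eq[OF w(1) v(1) b(1) a(1), of p]
        riemann_flip[OF a(1) b(1) v(1) w(1), of p] a b v w by simp
  qed
  have 1: "linear (\<lambda>t. Rm p x y z t)" for x y z
  proof (rule linearI)
    fix t t' c
    obtain a where a: "a \<in> \<Gamma>" "a p = x" by (rule section_through)
    obtain b where b: "b \<in> \<Gamma>" "b p = y" by (rule section_through)
    obtain v where v: "v \<in> \<Gamma>" "v p = z" by (rule section_through)
    obtain w where w: "w \<in> \<Gamma>" "w p = t" by (rule section_through)
    obtain w' where w': "w' \<in> \<Gamma>" "w' p = t'" by (rule section_through)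
    note eq = riemann_at_eq[OF a(1) b(1) v(1), of _ p, unfolded a(2) b(2) v(2)]
    show "Rm p x y z (t + t') = Rm p x y z t + Rm p x y z t'"
      using eq[OF section_add[OF w(1) w'(1)]] eq[OF w(1)] eq[OF w'(1)]
        riemann_w_add[OF a(1) b(1) v(1) w(1) w'(1), of p] w w' by simp
    show "Rm p x y z (c *\<^sub>R t) = c *\<^sub>R Rm p x y z t"
      using eq[OF section_cmul[OF w(1)], of c] eq[OF w(1)]
        riemann_w_scale[OF mfd_const a(1) b(1) v(1) w(1), of c p] w by simp
  qed
  have 2: "linear (\<lambda>z. Rm p x y z t)" for x y t
  proof (rule linearI)
    fix z z' c
    obtain a where a: "a \<in> \<Gamma>" "a p = x" by (rule section_through)
    obtain b where b: "b \<in> \<Gamma>" "b p = y" by (rule section_through)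
    obtain v where v: "v \<in> \<Gamma>" "v p = z" by (rule section_through)
    obtain v' where v': "v' \<in> \<Gamma>" "v' p = z'" by (rule section_through)
    obtain w where w: "w \<in> \<Gamma>" "w p = t" by (rule section_through)
    note eq = riemann_at_eq[OF a(1) b(1) _ w(1), of _ p, unfolded a(2) b(2) w(2)]
    show "Rm p x y (z + z') t = Rm p x y z t + Rm p x y z' t"
      using eq[OF section_add[OF v(1) v'(1)]] eq[OF v(1)] eq[OF v'(1)]
        riemann_v_add[OF a(1) b(1) v(1) v'(1) w(1), of p] v v' by simp
    show "Rm p x y (c *\<^sub>R z) t = c *\<^sub>R Rm p x y z t"
      using eq[OF section_cmul[OF v(1)], of c] eq[OF v(1)]
        riemann_v_scale[OF mfd_const a(1) b(1) v(1) w(1), of c p] v by simp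
  qed
  show "linear (\<lambda>t. Rm p x y z t)" "linear (\<lambda>z. Rm p x y z t)" by (rule 1, rule 2)
  show "linear (\<lambda>y. Rm p x y z t)" "linear (\<lambda>x. Rm p x y z t)"
    unfolding flip[of x] flip[of _ y] by (rule 2, rule 1)
qed

text \<open>The trace in the definition runs over standard bases of the fibres, which need not
  depend smoothly on the point. In a smooth local frame it has the same value and visibly smooth
  terms.\<close>

lemma riemann_smooth:
  assumes "a \<in> \<Gamma>" "b \<in> \<Gamma>" "v \<in> \<Gamma>" "w \<in> \<Gamma>"
  shows "mfd UNIV (riemann C D a b v w)"
proof (rule mfd_local)
  fix p
  obtain \<rho> :: "'a \<Rightarrow> real" and e :: "'c \<Rightarrow> ('a, 'c) sect" where \<rho>: "mfd UNIV \<rho>" "\<rho> p = (1::real)"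
    and e: "\<And>i. e i \<in> \<Gamma>" "\<And>q. \<rho> q \<noteq> 0 \<Longrightarrow> inj (\<lambda>i. e i q) \<and> independent (range (\<lambda>i. e i q))"
    by (rule frame_at[of p]) blast
  define T where "T = {q. \<rho> q \<noteq> 0}"
  have o: "open T" unfolding T_def by (rule open_support[OF \<rho>(1)])
  have s: "mfd T (\<lambda>q. pr q (s q) (t q))" if "s \<in> \<Gamma>" "t \<in> \<Gamma>" for s t
    by (rule mfd_subset[OF pairing_smooth[OF that]]) simp
  have "mfd T (\<lambda>p. 1/2 * (pr p (sd v w b p) (a p) - pr p (sd w v b p) (a p)
      + (pr p (sd b a v p) (w p) - pr p (sd a b v p) (w p))
      - (\<Sum>i\<in>UNIV. \<Sum>j\<in>UNIV. gram_inv (pr p) (\<lambda>i. e i p) $ i $ j *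
          (pr p (D (e i) v p) (w p) * pr p (D (e j) b p) (a p)))))"
    by (intro mfd_mult[OF o] mfd_add[OF o] mfd_diff[OF o] mfd_sum[OF o] mfd_const s conn_closed
        second_deriv_closed gram_inv_smooth[OF o] form.nondegenerate_form_axioms pairing_smooth assms e)
      (simp_all add: T_def)
  then have "mfd T (riemann C D a b v w)"
  proof (rule mfd_cong[OF o])
    fix q assume "q \<in> T"
    then have q: "inj (\<lambda>i. e i q)" "independent (range (\<lambda>i. e i q))" using e(2) by (auto simp: T_def)
    show "1/2 * (pr q (sd v w b q) (a q) - pr q (sd w v b q) (a q)
      + (pr q (sd b a v q) (w q) - pr q (sd a b v q) (w q))
      - (\<Sum>i\<in>UNIV. \<Sum>j\<in>UNIV. gram_inv (pr q) (\<lambda>i. e i q) $ i $ j *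
          (pr q (D (e i) v q) (w q) * pr q (D (e j) b q) (a q)))) = riemann C D a b v w q"
      unfolding riemann_eq_ctr form.ctr_gram_inv[OF bilinear_conn_at_product[OF assms(3,2)] q]
      by (simp add: form.form_simps conn_at_eq[OF e(1) assms(3)] conn_at_eq[OF e(1) assms(2)])
  qed
  then show "\<exists>T. open T \<and> p \<in> T \<and> mfd (UNIV \<inter> T) (riemann C D a b v w)"
    using o \<rho>(2) by (intro exI[of _ T]) (simp add: T_def)
qed simp

end

subsection \<open>The generalised Kretschmann scalar\<close>

text \<open>Placing each index next to its partner turns the eightfold sum into four nested
  contractions.\<close>

lemma sum_pairs_reorder:
  fixes g :: "'k::finite \<Rightarrow> 'k \<Rightarrow> real" and f :: "'k \<Rightarrow> 'k \<Rightarrow> 'k \<Rightarrow> 'k \<Rightarrow> real"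
  shows "(\<Sum>I\<in>UNIV. \<Sum>J\<in>UNIV. \<Sum>K\<in>UNIV. \<Sum>L\<in>UNIV. \<Sum>I'\<in>UNIV. \<Sum>J'\<in>UNIV. \<Sum>K'\<in>UNIV. \<Sum>L'\<in>UNIV.
      g I I' * g J J' * g K K' * g L L' * f I J K L * f I' J' K' L') =
    (\<Sum>I\<in>UNIV. \<Sum>I'\<in>UNIV. g I I' * (\<Sum>J\<in>UNIV. \<Sum>J'\<in>UNIV. g J J' * (\<Sum>K\<in>UNIV. \<Sum>K'\<in>UNIV. g K K' *
      (\<Sum>L\<in>UNIV. \<Sum>L'\<in>UNIV. g L L' * (f I J K L * f I' J' K' L')))))"
proof -
  let ?F = "\<lambda>I J K L I' J' K' L'. g I I' * g J J' * g K K' * g L L' * f I J K L * f I' J' K' L'"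
  have "(\<Sum>I\<in>UNIV. \<Sum>J\<in>UNIV. \<Sum>K\<in>UNIV. \<Sum>L\<in>UNIV. \<Sum>I'\<in>UNIV. \<Sum>J'\<in>UNIV. \<Sum>K'\<in>UNIV. \<Sum>L'\<in>UNIV. ?F I J K L I' J' K' L') =
      (\<Sum>I\<in>UNIV. \<Sum>J\<in>UNIV. \<Sum>K\<in>UNIV. \<Sum>I'\<in>UNIV. \<Sum>L\<in>UNIV. \<Sum>J'\<in>UNIV. \<Sum>K'\<in>UNIV. \<Sum>L'\<in>UNIV. ?F I J K L I' J' K' L')"
    by (intro sum.cong refl sum.swap)
  also have "\<dots> = (\<Sum>I\<in>UNIV. \<Sum>J\<in>UNIV. \<Sum>I'\<in>UNIV. \<Sum>K\<in>UNIV. \<Sum>L\<in>UNIV. \<Sum>J'\<in>UNIV. \<Sum>K'\<in>UNIV. \<Sum>L'\<in>UNIV. ?F I J K L I' J' K' L')"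
    by (intro sum.cong refl sum.swap)
  also have "\<dots> = (\<Sum>I\<in>UNIV. \<Sum>I'\<in>UNIV. \<Sum>J\<in>UNIV. \<Sum>K\<in>UNIV. \<Sum>L\<in>UNIV. \<Sum>J'\<in>UNIV. \<Sum>K'\<in>UNIV. \<Sum>L'\<in>UNIV. ?F I J K L I' J' K' L')"
    by (intro sum.cong refl sum.swap)
  also have "\<dots> = (\<Sum>I\<in>UNIV. \<Sum>I'\<in>UNIV. \<Sum>J\<in>UNIV. \<Sum>K\<in>UNIV. \<Sum>J'\<in>UNIV. \<Sum>L\<in>UNIV. \<Sum>K'\<in>UNIV. \<Sum>L'\<in>UNIV. ?F I J K L I' J' K' L')"
    by (intro sum.cong refl sum.swap)
  also have "\<dots> = (\<Sum>I\<in>UNIV. \<Sum>I'\<in>UNIV. \<Sum>J\<in>UNIV. \<Sum>J'\<in>UNIV. \<Sum>K\<in>UNIV. \<Sum>L\<in>UNIV. \<Sum>K'\<in>UNIV. \<Sum>L'\<in>UNIV. ?F I J K L I' J' K' L')"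
    by (intro sum.cong refl sum.swap)
  also have "\<dots> = (\<Sum>I\<in>UNIV. \<Sum>I'\<in>UNIV. \<Sum>J\<in>UNIV. \<Sum>J'\<in>UNIV. \<Sum>K\<in>UNIV. \<Sum>K'\<in>UNIV. \<Sum>L\<in>UNIV. \<Sum>L'\<in>UNIV. ?F I J K L I' J' K' L')"
    by (intro sum.cong refl sum.swap)
  finally show ?thesis by (simp add: sum_distrib_left mult.assoc)
qed

text \<open>The frame-free square of a 4-tensor with respect to \<open>h\<close>; the expression in
  any local frame reduces to it.\<close>

definition (in nondegenerate_form) square4 :: "(real^'k \<Rightarrow> real^'k \<Rightarrow> real^'k \<Rightarrow> real^'k \<Rightarrow> real) \<Rightarrow> real" where
  "square4 R = ctr (\<lambda>x x'. ctr (\<lambda>y y'. ctr (\<lambda>z z'. ctr (\<lambda>t t'. R x y z t * R x' y' z' t'))))"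

lemma (in nondegenerate_form) square4_gram_inv:
  assumes R: "\<And>x y z. linear (\<lambda>t. R x y z t)" "\<And>x y t. linear (\<lambda>z. R x y z t)"
      "\<And>x z t. linear (\<lambda>y. R x y z t)" "\<And>y z t. linear (\<lambda>x. R x y z t)"
    and e: "inj e" "independent (range e)"
  shows "square4 R = (\<Sum>I\<in>UNIV. \<Sum>J\<in>UNIV. \<Sum>K\<in>UNIV. \<Sum>L\<in>UNIV. \<Sum>I'\<in>UNIV. \<Sum>J'\<in>UNIV. \<Sum>K'\<in>UNIV. \<Sum>L'\<in>UNIV.
      gram_inv h e $ I $ I' * gram_inv h e $ J $ J' * gram_inv h e $ K $ K' * gram_inv h e $ L $ L' *
      R (e I) (e J) (e K) (e L) * R (e I') (e J') (e K') (e L'))"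
proof -
  note lin = linear_add[OF R(1)] linear_add[OF R(2)] linear_add[OF R(3)] linear_add[OF R(4)]
    linear_cmul[OF R(1)] linear_cmul[OF R(2)] linear_cmul[OF R(3)] linear_cmul[OF R(4)]
  have b4: "bilinear (\<lambda>t t'. R x y z t * R x' y' z' t')" for x y z x' y' z'
    by (simp add: bilinear_def linear_iff lin algebra_simps)
  have b3: "bilinear (\<lambda>z z'. ctr (\<lambda>t t'. R x y z t * R x' y' z' t'))" for x y x' y'
    by (simp add: bilinear_def linear_iff lin ring_distribs ctr_add ctr_cmul mult.assoc mult.left_commute[of "R _ _ _ _"])
  have b2: "bilinear (\<lambda>y y'. ctr (\<lambda>z z'. ctr (\<lambda>t t'. R x y z t * R x' y' z' t')))" for x x'
    by (simp add: bilinear_def linear_iff lin ring_distribs ctr_add ctr_cmul mult.assoc mult.left_commute[of "R _ _ _ _"])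
  have b1: "bilinear (\<lambda>x x'. ctr (\<lambda>y y'. ctr (\<lambda>z z'. ctr (\<lambda>t t'. R x y z t * R x' y' z' t'))))"
    by (simp add: bilinear_def linear_iff lin ring_distribs ctr_add ctr_cmul mult.assoc mult.left_commute[of "R _ _ _ _"])
  show ?thesis
    unfolding square4_def sum_pairs_reorder
    unfolding ctr_gram_inv[OF b1 e] unfolding ctr_gram_inv[OF b2 e]
    unfolding ctr_gram_inv[OF b3 e] unfolding ctr_gram_inv[OF b4 e] ..
qed

context torsion_free_connection
begin

lemma kretschmann_in_frame_eq:
  assumes "nondegenerate_form (G p)" "inj (\<lambda>i. e i p)" "independent (range (\<lambda>i. e i p))"
  shows "kretschmann_in_frame C G D e p = nondegenerate_form.square4 (G p) (Rm p)"
  using nondegenerate_form.square4_gram_inv[OF assms(1) riemann_at_linear assms(2,3)]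
  unfolding kretschmann_in_frame_def Let_def by simp

text \<open>Justifies the definite description: every frame gives \<open>square4\<close>, and a
  frame exists around each point, namely where the cut-off does not vanish.\<close>

lemma kretschmann_eq:
  assumes "nondegenerate_form (G p)"
  shows "kretschmann C G D p = nondegenerate_form.square4 (G p) (Rm p)"
  unfolding kretschmann_def
proof (rule the_equality)
  obtain \<rho> :: "'a \<Rightarrow> real" and e :: "'c \<Rightarrow> ('a, 'c) sect" where \<rho>: "mfd UNIV \<rho>" "\<rho> p = (1::real)"
    and e: "\<And>i. e i \<in> \<Gamma>" "\<And>q. \<rho> q \<noteq> 0 \<Longrightarrow> inj (\<lambda>i. e i q) \<and> independent (range (\<lambda>i. e i q))"
    by (rule frame_at[of p]) blast
  have "local_frame C {q. \<rho> q \<noteq> 0} e"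
    unfolding local_frame_def using open_support[OF \<rho>(1)] section_section_on[OF e(1)] e(2) by simp
  moreover have "nondegenerate_form.square4 (G p) (Rm p) = kretschmann_in_frame C G D e p"
    using kretschmann_in_frame_eq[of G p e, OF assms] e(2)[of p] \<rho>(2) by simp
  ultimately show "\<exists>U e. local_frame C U e \<and> p \<in> U \<and>
      nondegenerate_form.square4 (G p) (Rm p) = kretschmann_in_frame C G D e p"
    using \<rho>(2) by (intro exI[of _ "{q. \<rho> q \<noteq> 0}"] exI[of _ e]) simp
  fix r assume "\<exists>U e. local_frame C U e \<and> p \<in> U \<and> r = kretschmann_in_frame C G D e p"
  then obtain U e where "local_frame C U e" "p \<in> U" "r = kretschmann_in_frame C G D e p" by blast
  then show "r = nondegenerate_form.square4 (G p) (Rm p)"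
    using kretschmann_in_frame_eq[of G p e, OF assms] by (simp add: local_frame_def)
qed

lemma kretschmann_smooth:
  assumes G: "smooth_metric C G"
  shows "smooth_fun (atlas C) (kretschmann C G D)"
proof (rule mfd_local)
  fix p
  obtain \<rho> :: "'a \<Rightarrow> real" and e :: "'c \<Rightarrow> ('a, 'c) sect" where \<rho>: "mfd UNIV \<rho>" "\<rho> p = (1::real)"
    and e: "\<And>i. e i \<in> \<Gamma>" "\<And>q. \<rho> q \<noteq> 0 \<Longrightarrow> inj (\<lambda>i. e i q) \<and> independent (range (\<lambda>i. e i q))"
    by (rule frame_at[of p]) blast
  define T where "T = {q. \<rho> q \<noteq> 0}"
  have o: "open T" unfolding T_def by (rule open_support[OF \<rho>(1)])
  have g: "mfd T (\<lambda>q. gram_inv (G q) (\<lambda>i. e i q) $ i $ j)" for i j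
    by (rule gram_inv_smooth[OF o smooth_metricD[OF G] e(1)]) (simp_all add: T_def e(2))
  have R: "mfd T (\<lambda>q. riemann C D (e I) (e J) (e K) (e L) q)" for I J K L
    by (rule mfd_subset[OF riemann_smooth[OF e(1) e(1) e(1) e(1)]]) simp
  have "mfd T (kretschmann_in_frame C G D e)"
    unfolding kretschmann_in_frame_def[abs_def] Let_def riemann_at_eq[OF e(1) e(1) e(1) e(1)]
    by (intro mfd_sum[OF o] mfd_mult[OF o] g R)
  then have "mfd T (kretschmann C G D)"
    by (rule mfd_cong[OF o])
      (use e(2) smooth_metricD(1)[OF G] in \<open>simp add: kretschmann_in_frame_eq kretschmann_eq T_def\<close>)
  then show "\<exists>T. open T \<and> p \<in> T \<and> mfd (UNIV \<inter> T) (kretschmann C G D)"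
    using o \<rho>(2) by (intro exI[of _ T]) (simp add: T_def)
qed simp

end

subsection \<open>Generalised metrics on exact Courant algebroids\<close>

lemma (in nondegenerate_form) representing_vector:
  assumes "linear f"
  shows "\<exists>!w. \<forall>v. h w v = f v"
proof (rule ex1I)
  let ?w = "\<Sum>i\<in>UNIV. f (std_basis i) *\<^sub>R dual_basis h std_basis i"
  show "\<forall>v. h ?w v = f v"
  proof
    fix v
    have "h ?w v = f (\<Sum>i\<in>UNIV. h v (dual_basis h std_basis i) *\<^sub>R std_basis i)"
      by (simp add: sum_left form_simps linear_sum[OF assms] linear_cmul[OF assms] sym[of "dual_basis _ _ _"]
          mult.commute)
    then show "h ?w v = f v" by (simp add: expand_basis[OF std_basis_basis])
  qed
  then show "w = ?w" if "\<forall>v. h w v = f v" for w using that by (intro eqI) simp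
qed

locale generalised_metric_alg = courant_alg C
  for C :: "('m::{t2_space,second_countable_topology}, 'n::finite, 'k::finite) courant" +
  fixes G :: "('m, 'k) form"
  assumes exact: "exact_courant_algebroid C" and metric: "generalised_metric C G"
begin

abbreviation "\<Theta> \<equiv> metric_endo C G"

lemma smooth_metric: "smooth_metric C G"
  using metric by (simp add: generalised_metric_def)

sublocale gform: nondegenerate_form "G p" for p
  by (rule smooth_metricD[OF smooth_metric])

lemma endo_pairing: "pr p (\<Theta> p u) v = G p u v"
  unfolding metric_endo_def using theI'[OF form.representing_vector[OF gform.linear_right, of p p u]] by simp

lemma endo_involution: "\<Theta> p (\<Theta> p u) = u"
  using metric by (simp add: generalised_metric_def)

lemma endo_orthogonal_involution: "orthogonal_involution (pr p) (\<Theta> p)"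
  unfolding orthogonal_involution_def orthogonal_involution_axioms_def
proof (intro conjI allI)
  show "nondegenerate_form (pr p)" by (rule form.nondegenerate_form_axioms)
  show "linear (\<Theta> p)"
    by (rule linearI) (rule form.eqI[of p], simp add: form.form_simps endo_pairing gform.form_simps)+
  show "\<Theta> p (\<Theta> p u) = u" for u by (rule endo_involution)
  show "pr p (\<Theta> p u) v = pr p u (\<Theta> p v)" for u v
    by (simp add: endo_pairing form.sym[of p u] gform.sym[of p u])
qed

sublocale invol: orthogonal_involution "pr p" "\<Theta> p" for p
  by (rule endo_orthogonal_involution)

lemma eigenspace_eq: "eigenspace C G \<epsilon> p = invol.eig p \<epsilon>"
  by (simp add: eigenspace_def invol.eig_def)

lemma proj_eq: "proj C G \<epsilon> p u = invol.eproj p \<epsilon> u"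
  by (simp add: proj_def invol.eproj_def)

lemma metric_on_eig: "u \<in> invol.eig p \<epsilon> \<Longrightarrow> G p u v = \<epsilon> * pr p u v"
  using endo_pairing[of p u v] by (simp add: invol.eig_def form.form_simps)

text \<open>The endomorphism is defined fibre by fibre; its smoothness is read off from its pairings
  with sections, which are values of \<open>G\<close>.\<close>

lemma endo_section: "u \<in> \<Gamma> \<Longrightarrow> (\<lambda>p. \<Theta> p (u p)) \<in> \<Gamma>"
  by (rule section_by_pairing) (simp add: endo_pairing smooth_metricD(2)[OF smooth_metric])

lemma proj_sec_section: "u \<in> \<Gamma> \<Longrightarrow> proj_sec C G \<epsilon> u \<in> \<Gamma>"
  unfolding proj_sec_def proj_def using section_cmul section_add endo_section by simp

lemma proj_sec_eq: "proj_sec C G \<epsilon> u p = invol.eproj p \<epsilon> (u p)"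
  by (simp add: proj_sec_def proj_eq)

text \<open>The copy of the cotangent space in the fibre, which exactness identifies with the kernel
  of the anchor.\<close>

definition cot :: "'m \<Rightarrow> (real^'k) set" where "cot p = {u. an p u = (\<lambda>f. 0)}"

lemma tangent_range: "tangent_space (atlas C) p = range (an p)"
  and cot_exact: "cot p = {u. \<exists>\<xi>\<in>cotangent_space (atlas C) p. \<forall>v. pr p u v = \<xi> (an p v) / 2}"
proof -
  have *: "range (an p) = tangent_space (atlas C) p \<and> {u. an p u = (\<lambda>f. 0)} =
      {u. \<exists>\<xi>\<in>cotangent_space (atlas C) p. \<forall>v. pr p u v = \<xi> (an p v) / 2}" for p
    using exact unfolding exact_courant_algebroid_def by blast
  show "tangent_space (atlas C) p = range (an p)" using * by simp
  show "cot p = {u. \<exists>\<xi>\<in>cotangent_space (atlas C) p. \<forall>v. pr p u v = \<xi> (an p v) / 2}"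
    unfolding cot_def using * by blast
qed

lemma anchor_comb: "an p (a *\<^sub>R u + b *\<^sub>R v) = (\<lambda>f. a * an p u f + b * an p v f)"
  by (simp add: fun_eq_iff anchor_simps)

lemma cot_comb: "u \<in> cot p \<Longrightarrow> v \<in> cot p \<Longrightarrow> u + v \<in> cot p" "u \<in> cot p \<Longrightarrow> c *\<^sub>R u \<in> cot p" "0 \<in> cot p"
  by (auto simp: cot_def fun_eq_iff anchor_simps)

lemma cot_isotropic:
  assumes "u \<in> cot p" "v \<in> cot p"
  shows "pr p u v = 0"
proof -
  obtain \<xi> where \<xi>: "\<xi> \<in> cotangent_space (atlas C) p" "\<And>v. pr p u v = \<xi> (an p v) / 2"
    using assms(1) unfolding cot_exact by blast
  \<comment> \<open>A covector is only known to respect combinations of tangent vectors, so its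
    value \<open>0\<close> at the zero vector is extracted from a trivial combination.\<close>
  have "\<xi> (\<lambda>f. 0 * an p u f + 0 * an p u f) = 0 * \<xi> (an p u) + 0 * \<xi> (an p u)"
    using \<xi>(1) anchor_tangent unfolding cotangent_space_def by blast
  then show ?thesis using \<xi>(2)[of v] assms(2) by (simp add: cot_def)
qed

text \<open>As \<open>u\<close> is orthogonal to the kernel of the anchor, the functional
  \<open>2 * pr p u\<close> factors through the anchor and is a covector; the \<open>2\<close>
  undoes the normalisation.\<close>

lemma cot_coisotropic:
  assumes u: "\<And>v. v \<in> cot p \<Longrightarrow> pr p u v = 0"
  shows "u \<in> cot p"
proof -
  define \<xi> where "\<xi> X = 2 * pr p u (SOME v. an p v = X)" for X
  have \<xi>: "\<xi> (an p v) = 2 * pr p u v" for v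
  proof -
    have "an p (SOME v'. an p v' = an p v) = an p v" by (rule someI) (rule refl)
    then have "(SOME v'. an p v' = an p v) - v \<in> cot p" by (simp add: cot_def fun_eq_iff anchor_simps)
    from u[OF this] show ?thesis by (simp add: \<xi>_def form.form_simps)
  qed
  have "\<xi> \<in> cotangent_space (atlas C) p"
    unfolding cotangent_space_def tangent_range
  proof (clarify)
    fix x y a b
    show "\<xi> (\<lambda>f. a * an p x f + b * an p y f) = a * \<xi> (an p x) + b * \<xi> (an p y)"
      unfolding anchor_comb[symmetric] \<xi> by (simp add: form.form_simps)
  qed
  then show ?thesis unfolding cot_exact mem_Collect_eq by (rule bexI[rotated]) (simp add: \<xi>)
qed

text \<open>The difference lies in an eigenspace and in the cotangent copy. There \<open>G\<close>
  agrees up to sign with the pairing, which vanishes on the cotangent copy, whereas \<open>G\<close>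
  is nondegenerate on it.\<close>

lemma eig_anchor_inj:
  assumes \<epsilon>: "\<epsilon> \<in> {1, -1}" and "u \<in> invol.eig p \<epsilon>" "v \<in> invol.eig p \<epsilon>" "an p u = an p v"
  shows "u = v"
proof -
  have uv: "u - v \<in> cot p" using assms by (simp add: cot_def fun_eq_iff anchor_simps)
  have "u - v \<in> invol.eig p \<epsilon>" using assms by (simp add: invol.eig_combine)
  then have "G p (u - v) w = 0" if "w \<in> cot p" for w
    using cot_isotropic[OF uv that] by (simp add: metric_on_eig)
  then have "u - v = 0" using metric uv unfolding generalised_metric_def cot_def by blast
  then show ?thesis by simp
qed

text \<open>The cotangent copy and its image under \<Theta> span the fibre. Writing
  \<open>x = a + \<Theta> b\<close> accordingly, only \<open>\<Theta> b\<close> contributes to the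
  anchor, and adding \<open>\<epsilon> b\<close> moves it into the eigenspace.\<close>

lemma eig_anchor_surj:
  assumes \<epsilon>: "\<epsilon> \<in> {1, -1}"
  obtains u where "u \<in> invol.eig p \<epsilon>" "an p u = an p x"
proof -
  define W where "W = {a + \<Theta> p b | a b. a \<in> cot p \<and> b \<in> cot p}"
  have "subspace W"
    unfolding subspace_def
  proof (intro conjI ballI allI)
    show "0 \<in> W" unfolding W_def using cot_comb(3) linear_0[OF invol.lin] by force
    fix x y assume "x \<in> W" "y \<in> W"
    then obtain a b a' b' where *: "x = a + \<Theta> p b" "y = a' + \<Theta> p b'" "a \<in> cot p" "b \<in> cot p" "a' \<in> cot p" "b' \<in> cot p"
      unfolding W_def by blast
    have "x + y = (a + a') + \<Theta> p (b + b')" using * by (simp add: linear_add[OF invol.lin])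
    then show "x + y \<in> W" unfolding W_def using * cot_comb(1) by blast
  next
    fix x c assume "x \<in> W"
    then obtain a b where *: "x = a + \<Theta> p b" "a \<in> cot p" "b \<in> cot p" unfolding W_def by blast
    have "c *\<^sub>R x = c *\<^sub>R a + \<Theta> p (c *\<^sub>R b)" using * by (simp add: linear_cmul[OF invol.lin] algebra_simps)
    then show "c *\<^sub>R x \<in> W" unfolding W_def using * cot_comb(2) by blast
  qed
  \<comment> \<open>Otherwise some non-zero \<open>y\<close> is orthogonal to \<open>W\<close> for
    the pairing. Then \<open>y\<close> and its image under \<Theta> both lie in the cotangent copy,
    so \<open>G p y\<close> vanishes on that copy, against nondegeneracy.\<close>
  have "W = UNIV"
  proof (rule ccontr)
    assume "W \<noteq> UNIV"
    then have "dim W < DIM(real^'k)"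
      using dim_eq_full[of W] dim_subset_UNIV[of W] iffD2[OF span_eq_iff \<open>subspace W\<close>] by fastforce
    then obtain z where z: "z \<noteq> 0" "\<And>w. w \<in> span W \<Longrightarrow> orthogonal z w"
      using orthogonal_to_subspace_exists by blast
    have "linear (\<lambda>v. z \<bullet> v)" by (simp add: linear_iff inner_add_right)
    then obtain y where y: "\<And>v. pr p y v = z \<bullet> v" using form.representing_vector by blast
    have zero: "pr p y (a + \<Theta> p b) = 0" if "a \<in> cot p" "b \<in> cot p" for a b
      using z(2)[OF span_base, of "a + \<Theta> p b"] that unfolding W_def y orthogonal_def by blast
    have "y \<in> cot p"
      using zero[OF _ cot_comb(3)] linear_0[OF invol.lin] by (intro cot_coisotropic) simp
    moreover have "\<Theta> p y \<in> cot p"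
      using zero[OF cot_comb(3)] by (intro cot_coisotropic) (simp add: invol.adj)
    then have "G p y v = 0" if "v \<in> cot p" for v
      using cot_isotropic that endo_pairing[of p y v] by simp
    ultimately have "y = 0" using metric unfolding generalised_metric_def cot_def by blast
    then have "z \<bullet> z = 0" using y[of z] by (simp add: form.form_simps)
    then show False using z(1) by simp
  qed
  then have "x \<in> W" by simp
  then obtain a b where ab: "x = a + \<Theta> p b" "a \<in> cot p" "b \<in> cot p" unfolding W_def by blast
  show ?thesis
  proof (rule that)
    have "\<epsilon> * \<epsilon> = 1" using \<epsilon> by auto
    then show "\<epsilon> *\<^sub>R b + \<Theta> p b \<in> invol.eig p \<epsilon>"
      by (simp add: invol.eig_def linear_add[OF invol.lin] linear_cmul[OF invol.lin] invol.invol algebra_simps)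
    show "an p (\<epsilon> *\<^sub>R b + \<Theta> p b) = an p x"
      using ab by (simp add: fun_eq_iff anchor_simps cot_def)
  qed
qed

lemma lift_eqI:
  assumes "\<epsilon> \<in> {1, -1}" "u \<in> invol.eig p \<epsilon>" "an p u = X"
  shows "lift C G \<epsilon> p X = u"
  unfolding lift_def eigenspace_eq using assms eig_anchor_inj by (intro the_equality) blast+

lemma lift_props:
  assumes "\<epsilon> \<in> {1, -1}" "X \<in> tangent_space (atlas C) p"
  shows "lift C G \<epsilon> p X \<in> invol.eig p \<epsilon>" "an p (lift C G \<epsilon> p X) = X"
proof -
  obtain x where "X = an p x" using assms(2) unfolding tangent_range by blast
  moreover obtain u where "u \<in> invol.eig p \<epsilon>" "an p u = an p x" by (rule eig_anchor_surj[OF assms(1)])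
  ultimately show "lift C G \<epsilon> p X \<in> invol.eig p \<epsilon>" "an p (lift C G \<epsilon> p X) = X"
    using lift_eqI[OF assms(1)] by simp_all
qed

text \<open>For opposite eigenspaces the differences \<open>u - u'\<close> and \<open>v - v'\<close>
  lie in the isotropic cotangent copy and the cross terms vanish, so the two pairings differ by a
  sign, which the signs of \<open>G\<close> on the eigenspaces absorb.\<close>

lemma metric_eig_agree:
  assumes "\<epsilon> \<in> {1, -1}" "u \<in> invol.eig p \<epsilon>" "v \<in> invol.eig p \<epsilon>"
    and "\<delta> \<in> {1, -1}" "u' \<in> invol.eig p \<delta>" "v' \<in> invol.eig p \<delta>" "an p u = an p u'" "an p v = an p v'"
  shows "G p u v = G p u' v'"
proof (cases "\<delta> = \<epsilon>")
  case True
  then show ?thesis using assms eig_anchor_inj by metis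
next
  case False
  then have \<delta>: "\<delta> = - \<epsilon>" using assms by auto
  have "u - u' \<in> cot p" "v - v' \<in> cot p" using assms by (simp_all add: cot_def fun_eq_iff anchor_simps)
  then have "pr p (u - u') (v - v') = 0" by (rule cot_isotropic)
  moreover have "pr p u v' = 0" "pr p u' v = 0"
    using invol.eig_orthogonal[OF assms(1)] assms \<delta> form.sym by metis+
  ultimately have "pr p u v = - pr p u' v'" by (simp add: form.form_simps)
  then show ?thesis using assms \<delta> by (simp add: metric_on_eig)
qed

lemma base_metric_eq:
  assumes "\<epsilon> \<in> {1, -1}" "u \<in> invol.eig p \<epsilon>" "v \<in> invol.eig p \<epsilon>"
  shows "base_metric C G p (an p u) (an p v) = G p u v"
  unfolding base_metric_def eigenspace_eq
proof (rule the_equality)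
  show "\<forall>\<delta>\<in>{1, -1}. \<forall>u'\<in>invol.eig p \<delta>. \<forall>v'\<in>invol.eig p \<delta>.
      an p u' = an p u \<and> an p v' = an p v \<longrightarrow> G p u' v' = G p u v"
    using metric_eig_agree[OF _ _ _ assms] by blast
  fix r assume "\<forall>\<delta>\<in>{1, -1}. \<forall>u'\<in>invol.eig p \<delta>. \<forall>v'\<in>invol.eig p \<delta>.
      an p u' = an p u \<and> an p v' = an p v \<longrightarrow> G p u' v' = r"
  then show "r = G p u v" using assms by blast
qed

lemma base_metric_lift:
  assumes "X \<in> tangent_space (atlas C) p" "Y \<in> tangent_space (atlas C) p"
  shows "base_metric C G p X Y = G p (lift C G 1 p X) (lift C G 1 p Y)"
  using base_metric_eq[of 1 "lift C G 1 p X" p "lift C G 1 p Y"] lift_props[of 1 _ p] assms by simp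

lemma so_prolong_eq: "so_prolong C G p = Collect (invol.prolongation p)"
  unfolding so_prolong_def invol.prolongation_def eigenspace_eq ..

lemma tensor_pairing_eq:
  "tensor_pairing C p S K = form.ctr p (\<lambda>a a'. form.ctr p (\<lambda>b b'. pr p (S a b) (K a' b')))"
  unfolding tensor_pairing_def form.ctr_def ..

lemma anchor_sec_vector_field: "u \<in> \<Gamma> \<Longrightarrow> anchor_sec C u \<in> vector_fields (atlas C)"
  using anchor_tangent anchor_smooth by (simp add: vector_fields_def anchor_sec_def)

text \<open>The difference of two candidates is symmetric in the first two and skew in the last two
  arguments when lowered with the metric, hence zero.\<close>

lemma levi_civita_unique:
  assumes tan: "\<And>X Y p. X \<in> vector_fields (atlas C) \<Longrightarrow> Y \<in> vector_fields (atlas C) \<Longrightarrow>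
      N X Y p \<in> tangent_space (atlas C) p \<and> M X Y p \<in> tangent_space (atlas C) p"
    and met: "\<And>X Y Z p. X \<in> vector_fields (atlas C) \<Longrightarrow> Y \<in> vector_fields (atlas C) \<Longrightarrow> Z \<in> vector_fields (atlas C) \<Longrightarrow>
      base_metric C G p (N X Y p) (Z p) + base_metric C G p (Y p) (N X Z p) =
      base_metric C G p (M X Y p) (Z p) + base_metric C G p (Y p) (M X Z p)"
    and tor: "\<And>X Y p f. X \<in> vector_fields (atlas C) \<Longrightarrow> Y \<in> vector_fields (atlas C) \<Longrightarrow>
      N X Y p f - N Y X p f = M X Y p f - M Y X p f"
    and X: "X \<in> vector_fields (atlas C)" and Y: "Y \<in> vector_fields (atlas C)"
  shows "N X Y p = M X Y p"
proof -
  let ?V = "vector_fields (atlas C)" and ?l = "lift C G 1 p"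
  have vt: "Z p \<in> tangent_space (atlas C) p" if "Z \<in> ?V" for Z using that by (simp add: vector_fields_def)
  define c where "c X Y Z = G p (?l (N X Y p) - ?l (M X Y p)) (?l (Z p))" for X Y Z
  have skew: "c X Y Z = - c X Z Y" if "X \<in> ?V" "Y \<in> ?V" "Z \<in> ?V" for X Y Z
    using met[OF that, of p] tan[OF that(1,2), of p] tan[OF that(1,3), of p] vt[OF that(2)] vt[OF that(3)]
    by (simp add: base_metric_lift c_def gform.form_simps gform.sym[of p "?l (Y p)"])
  have symm: "c X Y Z = c Y X Z" if "X \<in> ?V" "Y \<in> ?V" for X Y Z
  proof -
    note t = tan[OF that, of p] tan[OF that(2,1), of p]
    have l: "?l (N X Y p) \<in> invol.eig p 1" "?l (M X Y p) \<in> invol.eig p 1" "?l (N Y X p) \<in> invol.eig p 1"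
      "?l (M Y X p) \<in> invol.eig p 1" using t by (auto intro: lift_props)
    have a: "an p (?l (N X Y p)) = N X Y p" "an p (?l (M X Y p)) = M X Y p" "an p (?l (N Y X p)) = N Y X p"
      "an p (?l (M Y X p)) = M Y X p" using t by (auto intro: lift_props)
    have "an p (?l (N X Y p) - ?l (M X Y p)) = an p (?l (N Y X p) - ?l (M Y X p))"
    proof
      fix f
      show "an p (?l (N X Y p) - ?l (M X Y p)) f = an p (?l (N Y X p) - ?l (M Y X p)) f"
        using tor[OF that, of p f] by (simp add: anchor_simps a)
    qed
    then have "?l (N X Y p) - ?l (M X Y p) = ?l (N Y X p) - ?l (M Y X p)"
      using l by (intro eig_anchor_inj[of 1 _ p]) (simp_all add: invol.eig_combine)
    then show ?thesis by (simp add: c_def)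
  qed
  have c0: "c X Y Z = 0" if "Z \<in> ?V" for Z
  proof -
    have "c X Y Z = - c Z X Y" using skew[OF X Y that] symm[OF X that] by simp
    also have "\<dots> = c Z Y X" using skew[OF that X Y] by simp
    also have "\<dots> = - c Y X Z" using symm[OF that Y] skew[OF Y that X] by simp
    finally show ?thesis using symm[OF X Y, of Z] by simp
  qed
  have t: "N X Y p \<in> tangent_space (atlas C) p" "M X Y p \<in> tangent_space (atlas C) p" using tan[OF X Y] by blast+
  have d: "?l (N X Y p) - ?l (M X Y p) \<in> invol.eig p 1"
    using t by (simp add: invol.eig_combine lift_props)
  have "?l (N X Y p) - ?l (M X Y p) = 0"
  proof (rule gform.nondeg)
    fix w
    obtain s where s: "s \<in> \<Gamma>" "s p = w" by (rule section_through)
    \<comment> \<open>Fields of this kind have every vector of \<open>E_+\<close> at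
      \<open>p\<close> as a lift, so \<open>c\<close> tests against all of \<open>E_+\<close>; the
      component in \<open>E_-\<close> is orthogonal anyway.\<close>
    let ?Z = "anchor_sec C (proj_sec C G 1 s)"
    have "?l (?Z p) = invol.eproj p 1 w"
      using invol.eproj_in_eig[of 1 p w] s(2) by (intro lift_eqI) (simp_all add: anchor_sec_def proj_sec_eq)
    then have "G p (?l (N X Y p) - ?l (M X Y p)) (invol.eproj p 1 w) = 0"
      using c0[OF anchor_sec_vector_field[OF proj_sec_section[OF s(1), of 1]]] by (simp add: c_def)
    moreover have "G p (?l (N X Y p) - ?l (M X Y p)) (invol.eproj p (-1) w) = 0"
      using invol.eig_orthogonal[of 1 _ p "invol.eproj p (-1) w"] d invol.eproj_in_eig[of "-1" p w]
      by (simp add: metric_on_eig)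
    ultimately show "G p (?l (N X Y p) - ?l (M X Y p)) w = 0"
      using invol.eproj_sum[of 1 p w] bilinear_radd[OF gform.bil] by (metis add_0 insertI1)
  qed
  then show ?thesis using lift_props(2)[of 1 _ p] t by (metis eq_iff_diff_eq_0 insertI1)
qed

end

subsection \<open>Naturality under isomorphisms\<close>

text \<open>Locally \<open>h\<close> after \<open>f\<close> is the coordinate expression of
  \<open>h\<close> composed with that of \<open>f\<close>.\<close>

lemma smooth_map_compose:
  fixes f :: "'m::{t2_space,second_countable_topology} \<Rightarrow> 'm2::{t2_space,second_countable_topology}"
    and A :: "('m, 'n::finite) chart set" and A' :: "('m2, 'n2::finite) chart set"
  assumes "smooth_manifold A" "smooth_manifold A'" and f: "smooth_map A A' f"
    and W: "open W" and h: "mfd_smooth_on A' W h"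
  shows "mfd_smooth_on A (f -` W) (\<lambda>p. h (f p))"
proof -
  interpret A: smooth_manifold A by fact
  interpret A': smooth_manifold A' by fact
  have cont: "continuous_on UNIV f" using f by (simp add: smooth_map_def)
  have op: "open (f -` V)" if "open V" for V
    using open_vimage[OF that cont] .
  show ?thesis
  proof (rule A.mfd_local[OF op[OF W]])
    fix p assume p: "p \<in> f -` W"
    obtain V \<psi> where c: "(V, \<psi>) \<in> A'" "f p \<in> V" by (rule A'.chart_at)
    have V: "open V" by (rule A'.chartD(1)[OF c(1)])
    have \<psi>: "mfd_smooth_on A (f -` V) (\<psi> \<circ> f)" using f c(1) unfolding smooth_map_def by fast
    have o: "open (f -` W \<inter> f -` V)" using op[OF W] op[OF V] by blast
    have "mfd_smooth_on A (f -` W \<inter> f -` V) (\<lambda>q. h (inv_into V \<psi> ((\<psi> \<circ> f) q)))"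
      by (rule A.mfd_compose[OF o A'.open_chart_image[OF c(1) W] A.mfd_subset[OF \<psi>] A'.mfd_smooth_onD[OF h c(1)]])
        auto
    then have "mfd_smooth_on A (f -` W \<inter> f -` V) (\<lambda>q. h (f q))"
      by (rule A.mfd_cong[OF o]) (use A'.chartD(4)[OF c(1)] in simp)
    then show "\<exists>T. open T \<and> p \<in> T \<and> mfd_smooth_on A (f -` W \<inter> T) (\<lambda>p. h (f p))"
      using op[OF V] c(2) by (intro exI[of _ "f -` V"]) simp
  qed
qed

locale courant_iso =
  src: generalised_metric_alg C G + tgt: generalised_metric_alg C' G'
  for C :: "('m::{t2_space,second_countable_topology}, 'n::finite, 'k::finite) courant"
    and G :: "('m, 'k) form"
    and C' :: "('m2::{t2_space,second_countable_topology}, 'n, 'k) courant"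
    and G' :: "('m2, 'k) form" +
  fixes f :: "'m \<Rightarrow> 'm2" and F :: "'m \<Rightarrow> real^'k \<Rightarrow> real^'k"
  assumes iso: "courant_isomorphism C C' f F"
    and isom: "G' (f p) (F p u) (F p v) = G p u v"
begin

lemma diffeo: "bij f" "smooth_map (atlas C) (atlas C') f" "smooth_map (atlas C') (atlas C) (inv f)"
  and F_lin: "linear (F p)" and F_bij: "bij (F p)"
  and F_pr: "pairing C' (f p) (F p u) (F p v) = pairing C p u v"
proof -
  have "diffeomorphism (atlas C) (atlas C') f" using iso unfolding courant_isomorphism_def by (elim conjE)
  then show "bij f" "smooth_map (atlas C) (atlas C') f" "smooth_map (atlas C') (atlas C) (inv f)"
    by (simp_all add: diffeomorphism_def)
  have "\<forall>p. linear (F p) \<and> bij (F p)" using iso unfolding courant_isomorphism_def by (elim conjE)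
  then show "linear (F p)" "bij (F p)" by simp_all
  have "\<forall>p u v. pairing C' (f p) (F p u) (F p v) = pairing C p u v"
    using iso unfolding courant_isomorphism_def by (elim conjE)
  then show "pairing C' (f p) (F p u) (F p v) = pairing C p u v" by simp
qed

lemma finv [simp]: "inv f (f p) = p" "f (inv f q) = q"
  using diffeo(1) by (simp_all add: bij_is_inj bij_is_surj surj_f_inv_f)

lemma Finv [simp]: "inv (F p) (F p x) = x" "F p (inv (F p) x) = x"
  using F_bij[of p] by (simp_all add: bij_is_inj bij_is_surj surj_f_inv_f)

lemma Finv_lin: "linear (inv (F p))"
  using F_lin F_bij by (intro inj_linear_imp_inv_linear) (auto simp: bij_is_inj)

lemmas F_simps = linear_add[OF F_lin] linear_diff[OF F_lin] linear_cmul[OF F_lin] linear_0[OF F_lin] linear_neg[OF F_lin]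
lemmas Finv_simps = linear_add[OF Finv_lin] linear_diff[OF Finv_lin] linear_cmul[OF Finv_lin] linear_0[OF Finv_lin] linear_neg[OF Finv_lin]

lemma F_eq_iff: "F p x = F p y \<longleftrightarrow> x = y"
  using F_bij[of p] by (auto simp: bij_def inj_def)

lemma pull_smooth: "open W \<Longrightarrow> tgt.mfd W h \<Longrightarrow> src.mfd (f -` W) (\<lambda>p. h (f p))"
  by (rule smooth_map_compose[OF src.smooth_manifold_axioms tgt.smooth_manifold_axioms diffeo(2)])

lemma push_smooth: "open W \<Longrightarrow> src.mfd W h \<Longrightarrow> tgt.mfd (inv f -` W) (\<lambda>q. h (inv f q))"
  by (rule smooth_map_compose[OF tgt.smooth_manifold_axioms src.smooth_manifold_axioms diffeo(3)])

lemma smooth_fun_iff: "src.mfd UNIV (\<lambda>p. h (f p)) \<longleftrightarrow> tgt.mfd UNIV h"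
  using pull_smooth[of UNIV h] push_smooth[of UNIV "\<lambda>p. h (f p)"] by auto

definition push_tangent :: "'m tangent \<Rightarrow> 'm2 tangent" where
  "push_tangent X = (\<lambda>h. X (\<lambda>p. h (f p)))"

definition push_field :: "'m vfield \<Rightarrow> 'm2 vfield" where
  "push_field X = (\<lambda>q. push_tangent (X (inv f q)))"

lemma push_field_at [simp]: "push_field X (f p) = push_tangent (X p)"
  by (simp add: push_field_def)

text \<open>An isomorphism respects anchors on smooth functions by definition. For non-smooth
  \<open>h\<close> both sides take the default value \<open>0\<close>, because \<open>h\<close> is
  smooth exactly when its pull-back is.\<close>

lemma anchor_push: "anchor C' (f p) (F p u) = push_tangent (anchor C p u)"
proof
  fix h
  show "anchor C' (f p) (F p u) h = push_tangent (anchor C p u) h"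
  proof (cases "tgt.mfd UNIV h")
    case True
    have "\<forall>p u h. smooth_fun (atlas C') h \<longrightarrow> anchor C' (f p) (F p u) h = anchor C p u (h \<circ> f)"
      using iso unfolding courant_isomorphism_def by (elim conjE)
    with True show ?thesis by (simp add: push_tangent_def comp_def)
  next
    case False
    then have "\<not> src.mfd UNIV (\<lambda>p. h (f p))" by (simp add: smooth_fun_iff)
    with False show ?thesis
      using tgt.tangent_nonsmooth[OF tgt.anchor_tangent] src.tangent_nonsmooth[OF src.anchor_tangent]
      by (simp add: push_tangent_def)
  qed
qed

abbreviation "push \<equiv> push_sec f F"

lemma push_at [simp]: "push s (f p) = F p (s p)"
  by (simp add: push_sec_def)

lemma push_eqI: "(\<And>p. s' (f p) = F p (s p)) \<Longrightarrow> s' = push s"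
proof
  fix q assume "\<And>p. s' (f p) = F p (s p)"
  from this[of "inv f q"] show "s' q = push s q" by (simp add: push_sec_def)
qed

text \<open>As with transition maps, \<open>F\<close> is known to be smooth on fixed vectors of a
  trivialisation, hence the expansion in the standard basis.\<close>

lemma push_section:
  assumes s: "s \<in> src.\<Gamma>"
  shows "push s \<in> tgt.\<Gamma>"
proof -
  have "section_on C' UNIV (push s)"
  proof (rule tgt.section_onI_local)
    fix q
    obtain W \<tau> where t: "(W, \<tau>) \<in> trivs C" "inv f q \<in> W" by (rule src.triv_at)
    obtain W' \<tau>' where t': "(W', \<tau>') \<in> trivs C'" "q \<in> W'" by (rule tgt.triv_at)
    define V where "V = W \<inter> f -` W'"
    have "continuous_on UNIV f" using diffeo(2) by (simp add: smooth_map_def)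
    then have "open (f -` W')"
      by (rule open_vimage[OF tgt.trivD(1)[OF t'(1)]])
    then have V: "open V" unfolding V_def using src.trivD(1)[OF t(1)] by blast
    have "continuous_on UNIV (inv f)" using diffeo(3) by (simp add: smooth_map_def)
    then have oV: "open (inv f -` V)"
      by (rule open_vimage[OF V])
    have "\<forall>(W, \<tau>)\<in>trivs C. \<forall>(W', \<tau>')\<in>trivs C'. \<forall>x.
        mfd_smooth_on (atlas C) (W \<inter> f -` W') (\<lambda>p. \<tau>' (f p) (F p (inv (\<tau> p) x)))"
      using iso unfolding courant_isomorphism_def by (elim conjE)
    from bspec[OF this t(1), simplified, THEN bspec, OF t'(1)]
    have sm: "src.mfd V (\<lambda>p. \<tau>' (f p) (F p (inv (\<tau> p) x)))" for x by (simp add: V_def)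
    have "src.mfd V (\<lambda>p. \<Sum>i\<in>UNIV. (\<tau> p (s p) $ i) *\<^sub>R \<tau>' (f p) (F p (inv (\<tau> p) (std_basis i))))"
      by (intro src.mfd_sum[OF V] src.mfd_scaleR[OF V] src.mfd_vec_nth[OF V] sm
          src.mfd_subset[OF src.sectionD[OF s t(1)]]) (simp add: V_def)
    then have "src.mfd V (\<lambda>p. \<tau>' (f p) (F p (s p)))"
    proof (rule src.mfd_cong[OF V])
      fix p assume "p \<in> V"
      then have p: "p \<in> W" "f p \<in> W'" by (auto simp: V_def)
      have "\<tau>' (f p) (F p (s p)) = \<tau>' (f p) (F p (inv (\<tau> p) (\<Sum>i\<in>UNIV. (\<tau> p (s p) $ i) *\<^sub>R std_basis i)))"
        by (simp add: std_basis_expansion src.trivD(4)[OF t(1) p(1)])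
      also have "\<dots> = (\<Sum>i\<in>UNIV. (\<tau> p (s p) $ i) *\<^sub>R \<tau>' (f p) (F p (inv (\<tau> p) (std_basis i))))"
        using tgt.trivD(2)[OF t'(1) p(2)] src.trivD(6)[OF t(1) p(1)] F_lin[of p] by (simp add: linear_sum linear_cmul)
      finally show "(\<Sum>i\<in>UNIV. (\<tau> p (s p) $ i) *\<^sub>R \<tau>' (f p) (F p (inv (\<tau> p) (std_basis i)))) =
          \<tau>' (f p) (F p (s p))" by simp
    qed
    from push_smooth[OF V this] have "tgt.mfd (inv f -` V) (\<lambda>q. \<tau>' q (push s q))"
      by (simp add: push_sec_def)
    then show "\<exists>W \<tau> T. (W, \<tau>) \<in> trivs C' \<and> open T \<and> q \<in> T \<and> T \<subseteq> W \<and> tgt.mfd (UNIV \<inter> T) (\<lambda>q. \<tau> q (push s q))"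
      using t t' oV by (intro exI[of _ W'] exI[of _ \<tau>'] exI[of _ "inv f -` V"]) (auto simp: V_def)
  qed simp
  then show ?thesis by (simp add: sections_def)
qed

lemma dorfman_push:
  assumes "u \<in> src.\<Gamma>" "v \<in> src.\<Gamma>"
  shows "dorfman C' (push u) (push v) = push (dorfman C u v)"
proof -
  have "\<forall>u\<in>src.\<Gamma>. \<forall>v\<in>src.\<Gamma>. dorfman C' (push u) (push v) = push (dorfman C u v)"
    using iso unfolding courant_isomorphism_def by (elim conjE)
  with assms show ?thesis by simp
qed

lemma endo_push: "metric_endo C' G' (f p) (F p u) = F p (metric_endo C G p u)"
proof (rule tgt.form.eqI[of "f p"])
  fix w
  have "w = F p (inv (F p) w)" by simp
  then show "pairing C' (f p) (metric_endo C' G' (f p) (F p u)) w = pairing C' (f p) (F p (metric_endo C G p u)) w"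
    using tgt.endo_pairing src.endo_pairing isom F_pr by metis
qed

lemma eproj_push: "tgt.invol.eproj (f p) \<epsilon> (F p u) = F p (src.invol.eproj p \<epsilon> u)"
  by (simp add: tgt.invol.eproj_def src.invol.eproj_def endo_push F_simps)

lemma eig_push: "F p u \<in> tgt.invol.eig (f p) \<epsilon> \<longleftrightarrow> u \<in> src.invol.eig p \<epsilon>"
  by (simp add: tgt.invol.eig_def src.invol.eig_def endo_push F_eq_iff flip: F_simps)

lemma proj_sec_push: "proj_sec C' G' \<epsilon> (push u) = push (proj_sec C G \<epsilon> u)"
  by (rule push_eqI) (simp add: tgt.proj_sec_eq src.proj_sec_eq eproj_push)

lemma tangent_push: "X \<in> tangent_space (atlas C) p \<Longrightarrow> push_tangent X \<in> tangent_space (atlas C') (f p)"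
  unfolding src.tangent_range tgt.tangent_range by (auto simp flip: anchor_push)

lemma lift_push:
  assumes "\<epsilon> \<in> {1, -1}" "X \<in> tangent_space (atlas C) p"
  shows "lift C' G' \<epsilon> (f p) (push_tangent X) = F p (lift C G \<epsilon> p X)"
  using src.lift_props[OF assms] by (intro tgt.lift_eqI[OF assms(1)]) (simp_all add: eig_push anchor_push)

lemma base_metric_push:
  assumes "X \<in> tangent_space (atlas C) p" "Y \<in> tangent_space (atlas C) p"
  shows "base_metric C' G' (f p) (push_tangent X) (push_tangent Y) = base_metric C G p X Y"
  by (simp add: tgt.base_metric_lift[OF tangent_push tangent_push] src.base_metric_lift assms lift_push isom)

lemma push_vector_field:
  assumes X: "X \<in> vector_fields (atlas C)"
  shows "push_field X \<in> vector_fields (atlas C')"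
  unfolding vector_fields_def
proof (intro CollectI conjI allI impI)
  show "push_field X q \<in> tangent_space (atlas C') q" for q
    using tangent_push[of "X (inv f q)" "inv f q"] X by (simp add: vector_fields_def push_field_def)
  fix h :: "'m2 \<Rightarrow> real" assume "tgt.mfd UNIV h"
  then have "src.mfd UNIV (\<lambda>p. X p (\<lambda>p. h (f p)))"
    using X by (simp add: vector_fields_def smooth_fun_iff)
  then show "tgt.mfd UNIV (\<lambda>q. push_field X q h)"
    using push_smooth[of UNIV] by (simp add: push_field_def push_tangent_def)
qed

lemma anchor_sec_push: "anchor_sec C' (push u) = push_field (anchor_sec C u)"
proof
  fix q
  show "anchor_sec C' (push u) q = push_field (anchor_sec C u) q"
    using anchor_push[of "inv f q"] by (simp add: anchor_sec_def push_field_def push_sec_def)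
qed

text \<open>The pull-back \<open>M\<close> of \<open>N'\<close> is compared with \<open>N\<close> by
  uniqueness, which asks only for tangency, metric compatibility and the torsion identity.\<close>

lemma levi_civita_push:
  assumes N: "levi_civita (atlas C) (base_metric C G) N" and N': "levi_civita (atlas C') (base_metric C' G') N'"
    and XY: "X \<in> vector_fields (atlas C)" "Y \<in> vector_fields (atlas C)"
  shows "N' (push_field X) (push_field Y) (f p) = push_tangent (N X Y p)"
proof -
  define M where "M X Y p = (\<lambda>h. N' (push_field X) (push_field Y) (f p) (\<lambda>q. h (inv f q)))" for X Y p
  have M: "push_tangent (M X Y p) = N' (push_field X) (push_field Y) (f p)" for X Y p
    by (simp add: push_tangent_def M_def)
  let ?V = "vector_fields (atlas C)"
  have tV: "X p \<in> tangent_space (atlas C) p" if "X \<in> ?V" for X p using that by (simp add: vector_fields_def)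
  have Nt: "N X Y p \<in> tangent_space (atlas C) p" if "X \<in> ?V" "Y \<in> ?V" for X Y p
    using N that unfolding levi_civita_def by (intro tV) blast
  have Mt: "M X Y p \<in> tangent_space (atlas C) p" if "X \<in> ?V" "Y \<in> ?V" for X Y p
  proof -
    have "N' (push_field X) (push_field Y) \<in> vector_fields (atlas C')"
      using N' push_vector_field[OF that(1)] push_vector_field[OF that(2)] unfolding levi_civita_def by (elim conjE) blast
    then have "N' (push_field X) (push_field Y) (f p) \<in> tangent_space (atlas C') (f p)"
      by (simp add: vector_fields_def)
    then obtain y where y: "N' (push_field X) (push_field Y) (f p) = anchor C' (f p) y"
      unfolding tgt.tangent_range by blast
    have "M X Y p = anchor C p (inv (F p) y)"
      using anchor_push[of p "inv (F p) y"] unfolding M_def y by (simp add: push_tangent_def fun_eq_iff)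
    then show ?thesis using src.anchor_tangent by simp
  qed
  have met: "X p (\<lambda>q. base_metric C G q (Y q) (Z q)) =
      base_metric C G p (N X Y p) (Z p) + base_metric C G p (Y p) (N X Z p)"
    if "X \<in> ?V" "Y \<in> ?V" "Z \<in> ?V" for X Y Z p
  proof -
    have "\<forall>X\<in>?V. \<forall>Y\<in>?V. \<forall>Z\<in>?V. \<forall>p. X p (\<lambda>q. base_metric C G q (Y q) (Z q)) =
        base_metric C G p (N X Y p) (Z p) + base_metric C G p (Y p) (N X Z p)"
      using N unfolding levi_civita_def by (elim conjE)
    with that show ?thesis by blast
  qed
  have met': "X p (\<lambda>q. base_metric C G q (Y q) (Z q)) =
      base_metric C G p (M X Y p) (Z p) + base_metric C G p (Y p) (M X Z p)"
    if "X \<in> ?V" "Y \<in> ?V" "Z \<in> ?V" for X Y Z p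
  proof -
    have "\<forall>X\<in>vector_fields (atlas C'). \<forall>Y\<in>vector_fields (atlas C'). \<forall>Z\<in>vector_fields (atlas C'). \<forall>p.
        X p (\<lambda>q. base_metric C' G' q (Y q) (Z q)) =
        base_metric C' G' p (N' X Y p) (Z p) + base_metric C' G' p (Y p) (N' X Z p)"
      using N' unfolding levi_civita_def by (elim conjE)
    then have "push_field X (f p) (\<lambda>q. base_metric C' G' q (push_field Y q) (push_field Z q)) =
        base_metric C' G' (f p) (N' (push_field X) (push_field Y) (f p)) (push_field Z (f p)) +
        base_metric C' G' (f p) (push_field Y (f p)) (N' (push_field X) (push_field Z) (f p))"
      using that[THEN push_vector_field] by blast
    moreover have "push_field X (f p) (\<lambda>q. base_metric C' G' q (push_field Y q) (push_field Z q)) =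
        X p (\<lambda>q. base_metric C G q (Y q) (Z q))"
      by (simp add: push_tangent_def[of "X p"] base_metric_push[OF tV[OF that(2)] tV[OF that(3)]])
    ultimately show ?thesis
      using base_metric_push[OF Mt[OF that(1,2), of p] tV[OF that(3), of p]]
        base_metric_push[OF tV[OF that(2), of p] Mt[OF that(1,3), of p]] by (simp add: M)
  qed
  \<comment> \<open>Uniqueness requires this for all functions; on non-smooth ones every tangent
    vector gives \<open>0\<close>.\<close>
  have tor: "N X Y p h - N Y X p h = M X Y p h - M Y X p h" if "X \<in> ?V" "Y \<in> ?V" for X Y p h
  proof (cases "src.mfd UNIV h")
    case True
    then have h': "tgt.mfd UNIV (\<lambda>q. h (inv f q))" using push_smooth[of UNIV h] by simp
    have "\<forall>X\<in>vector_fields (atlas C'). \<forall>Y\<in>vector_fields (atlas C'). \<forall>p f. smooth_fun (atlas C') f \<longrightarrow>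
        N' X Y p f - N' Y X p f = X p (\<lambda>q. Y q f) - Y p (\<lambda>q. X q f)"
      using N' unfolding levi_civita_def by (elim conjE)
    then have "M X Y p h - M Y X p h = X p (\<lambda>q. Y q h) - Y p (\<lambda>q. X q h)"
      using that[THEN push_vector_field] h' unfolding M_def by (simp add: push_tangent_def)
    moreover have "\<forall>X\<in>?V. \<forall>Y\<in>?V. \<forall>p f. smooth_fun (atlas C) f \<longrightarrow>
        N X Y p f - N Y X p f = X p (\<lambda>q. Y q f) - Y p (\<lambda>q. X q f)"
      using N unfolding levi_civita_def by (elim conjE)
    then have "N X Y p h - N Y X p h = X p (\<lambda>q. Y q h) - Y p (\<lambda>q. X q h)"
      using that True by blast
    ultimately show ?thesis by simp
  next
    case False
    then show ?thesis
      using src.tangent_nonsmooth[OF Nt[OF that]] src.tangent_nonsmooth[OF Nt[OF that(2,1)]]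
        src.tangent_nonsmooth[OF Mt[OF that]] src.tangent_nonsmooth[OF Mt[OF that(2,1)]] by simp
  qed
  have "N X Y p = M X Y p"
    by (rule src.levi_civita_unique[OF _ _ tor XY]) (use Nt Mt met met' in \<open>auto simp flip: met\<close>)
  then show ?thesis using M by simp
qed

context
  fixes N N'
  assumes N: "levi_civita (atlas C) (base_metric C G) N" and N': "levi_civita (atlas C') (base_metric C' G') N'"
begin

lemma pre_connection_push:
  assumes "u \<in> src.\<Gamma>" "v \<in> src.\<Gamma>"
  shows "pre_connection C' G' N' (push u) (push v) = push (pre_connection C G N u v)"
proof (rule push_eqI)
  fix p
  let ?X = "\<lambda>\<epsilon> u. anchor_sec C (proj_sec C G \<epsilon> u)"
  have V: "?X \<epsilon> u \<in> vector_fields (atlas C)" if "u \<in> src.\<Gamma>" for \<epsilon> u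
    by (rule src.anchor_sec_vector_field[OF src.proj_sec_section[OF that]])
  have t: "N (?X \<epsilon> u) (?X \<epsilon> v) p \<in> tangent_space (atlas C) p" for \<epsilon>
  proof -
    have "N (?X \<epsilon> u) (?X \<epsilon> v) \<in> vector_fields (atlas C)"
      using N V[OF assms(1)] V[OF assms(2)] unfolding levi_civita_def by (elim conjE) blast
    then show ?thesis by (simp add: vector_fields_def)
  qed
  have "lift C' G' \<epsilon> (f p) (N' (anchor_sec C' (proj_sec C' G' \<epsilon> (push u))) (anchor_sec C' (proj_sec C' G' \<epsilon> (push v))) (f p)) =
      F p (lift C G \<epsilon> p (N (?X \<epsilon> u) (?X \<epsilon> v) p))" if "\<epsilon> \<in> {1, -1}" for \<epsilon>
    by (simp add: proj_sec_push anchor_sec_push levi_civita_push[OF N N' V[OF assms(1)] V[OF assms(2)]] lift_push[OF that t])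
  moreover have "proj C' G' \<delta> (f p) (dorfman C' (proj_sec C' G' \<epsilon> (push u)) (proj_sec C' G' \<delta> (push v)) (f p)) =
      F p (proj C G \<delta> p (dorfman C (proj_sec C G \<epsilon> u) (proj_sec C G \<delta> v) p))" for \<epsilon> \<delta>
    by (simp add: proj_sec_push dorfman_push src.proj_sec_section assms src.proj_eq tgt.proj_eq eproj_push)
  ultimately show "pre_connection C' G' N' (push u) (push v) (f p) = F p (pre_connection C G N u v p)"
    by (simp add: pre_connection_def F_simps)
qed

lemma torsion_push:
  assumes "u \<in> src.\<Gamma>" "v \<in> src.\<Gamma>" "w \<in> src.\<Gamma>"
  shows "torsion C' (pre_connection C' G' N') (push u) (push v) (push w) (f p) =
    torsion C (pre_connection C G N) u v w p"
  using assms by (simp add: torsion_def pre_connection_push dorfman_push F_pr flip: F_simps)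

end

lemma base_connection_push:
  assumes D0: "base_connection C G D0" and D0': "base_connection C' G' D0'"
    and uv: "u \<in> src.\<Gamma>" "v \<in> src.\<Gamma>"
  shows "D0' (push u) (push v) (f p) = F p (D0 u v p)"
proof -
  obtain N where N: "levi_civita (atlas C) (base_metric C G) N"
    "\<And>w p. w \<in> src.\<Gamma> \<Longrightarrow> pairing C p (D0 u v p) (w p) =
      pairing C p (pre_connection C G N u v p) (w p) - 1/3 * torsion C (pre_connection C G N) u v w p"
    using D0 uv unfolding base_connection_def by blast
  obtain N' where N': "levi_civita (atlas C') (base_metric C' G') N'"
    "\<And>w p. w \<in> tgt.\<Gamma> \<Longrightarrow> pairing C' p (D0' (push u) (push v) p) (w p) =
      pairing C' p (pre_connection C' G' N' (push u) (push v) p) (w p)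
        - 1/3 * torsion C' (pre_connection C' G' N') (push u) (push v) w p"
    using D0' push_section[OF uv(1)] push_section[OF uv(2)] unfolding base_connection_def by blast
  show ?thesis
  proof (rule tgt.form.eqI[of "f p"])
    fix x
    obtain w where w: "w \<in> src.\<Gamma>" "w p = inv (F p) x" by (rule src.section_through)
    have "pairing C' (f p) (D0' (push u) (push v) (f p)) (F p (w p)) = pairing C p (D0 u v p) (w p)"
      using N'(2)[OF push_section[OF w(1)], of "f p"] N(2)[OF w(1), of p]
      by (simp add: pre_connection_push[OF N(1) N'(1) uv] torsion_push[OF N(1) N'(1) uv w(1)] F_pr)
    then show "pairing C' (f p) (D0' (push u) (push v) (f p)) x = pairing C' (f p) (F p (D0 u v p)) x"
      using F_pr[of p "D0 u v p" "w p"] w(2) by simp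
  qed
qed

end

section \<open>Transport of the canonical connection and of its curvature\<close>

locale canonical_pair = courant_iso C G C' G' f F
  for C :: "('m::{t2_space,second_countable_topology}, 'n::finite, 'k::finite) courant"
    and G :: "('m, 'k) form"
    and C' :: "('m2::{t2_space,second_countable_topology}, 'n, 'k) courant"
    and G' :: "('m2, 'k) form" and f F +
  fixes dv D dv' D'
  assumes canon: "canonical_connection C G dv D" and canon': "canonical_connection C' G' dv' D'"
    and div: "s \<in> src.\<Gamma> \<Longrightarrow> dv' (push s) (f p) = dv s p"
begin

lemma torsion_free_connections: "torsion_free_connection C D" "torsion_free_connection C' D'"
proof -
  have *: "generalised_levi_civita C G D" "generalised_levi_civita C' G' D'"
    using canon canon' by (simp_all add: canonical_connection_def)
  show "torsion_free_connection C D"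
    by unfold_locales (use *(1) in \<open>simp_all add: generalised_levi_civita_def\<close>)
  show "torsion_free_connection C' D'"
    by unfold_locales (use *(2) in \<open>simp_all add: generalised_levi_civita_def\<close>)
qed

sublocale D: torsion_free_connection C D by (rule torsion_free_connections)
sublocale D': torsion_free_connection C' D' by (rule torsion_free_connections)

lemma metric_compatible:
  "u \<in> src.\<Gamma> \<Longrightarrow> v \<in> src.\<Gamma> \<Longrightarrow> w \<in> src.\<Gamma> \<Longrightarrow>
    anchor C p (u p) (\<lambda>q. G q (v q) (w q)) = G p (D u v p) (w p) + G p (v p) (D u w p)"
  "u' \<in> tgt.\<Gamma> \<Longrightarrow> v' \<in> tgt.\<Gamma> \<Longrightarrow> w' \<in> tgt.\<Gamma> \<Longrightarrow>
    anchor C' q (u' q) (\<lambda>q. G' q (v' q) (w' q)) = G' q (D' u' v' q) (w' q) + G' q (v' q) (D' u' w' q)"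
  using canon canon'
  by (simp_all add: canonical_connection_def generalised_levi_civita_def metric_connection_def)

lemma divergence_trace:
  "v \<in> src.\<Gamma> \<Longrightarrow> dv v p = endo_trace (\<lambda>x. conn_at C D p x v)"
  "v' \<in> tgt.\<Gamma> \<Longrightarrow> dv' v' q = endo_trace (\<lambda>x. conn_at C' D' q x v')"
  using canon canon' by (simp_all add: canonical_connection_def has_divergence_def)

lemma connection_push:
  assumes uv: "u \<in> src.\<Gamma>" "v \<in> src.\<Gamma>"
  shows "D' (push u) (push v) (f p) = F p (D u v p)"
proof -
  obtain D0 S where S: "base_connection C G D0" "bilinear (S p)"
    "\<And>u v. u \<in> src.\<Gamma> \<Longrightarrow> v \<in> src.\<Gamma> \<Longrightarrow> D u v p - D0 u v p = S p (u p) (v p)"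
    "\<And>K. K \<in> trace_kernel C G p \<Longrightarrow> tensor_pairing C p (S p) K = 0"
    using canon unfolding canonical_connection_def by blast
  obtain D0' S' where S': "base_connection C' G' D0'" "bilinear (S' (f p))"
    "\<And>u v. u \<in> tgt.\<Gamma> \<Longrightarrow> v \<in> tgt.\<Gamma> \<Longrightarrow> D' u v (f p) - D0' u v (f p) = S' (f p) (u (f p)) (v (f p))"
    "\<And>K. K \<in> trace_kernel C' G' (f p) \<Longrightarrow> tensor_pairing C' (f p) (S' (f p)) K = 0"
    using canon' unfolding canonical_connection_def by blast
  \<comment> \<open>The base connections correspond under the isomorphism, so the pull-back of
    \<open>S'\<close> minus \<open>S\<close> is the pointwise difference of the two connections. The
    first description gives the orthogonality, the second the algebraic properties.\<close>
  define \<Delta> where "\<Delta> x y = inv (F p) (S' (f p) (F p x) (F p y)) - S p x y" for x y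
  have \<Delta>: "F p (\<Delta> (u p) (v p)) = D' (push u) (push v) (f p) - F p (D u v p)"
    if "u \<in> src.\<Gamma>" "v \<in> src.\<Gamma>" for u v
    using S(3)[OF that, symmetric] S'(3)[OF push_section[OF that(1)] push_section[OF that(2)], symmetric]
      base_connection_push[OF S(1) S'(1) that, of p]
    by (simp add: \<Delta>_def F_simps)
  have D': "D' (push u) (push v) (f p) = F p (D u v p + \<Delta> (u p) (v p))" if "u \<in> src.\<Gamma>" "v \<in> src.\<Gamma>" for u v
    using \<Delta>[OF that] by (simp add: F_simps)
  have bil: "bilinear \<Delta>"
    using S(2) S'(2) by (simp add: bilinear_def linear_iff \<Delta>_def F_simps Finv_simps algebra_simps)
  have skew: "pairing C p (\<Delta> x y) z = - pairing C p y (\<Delta> x z) \<and> G p (\<Delta> x y) z = - G p y (\<Delta> x z)" for x y z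
  proof -
    obtain u where u: "u \<in> src.\<Gamma>" "u p = x" by (rule src.section_through)
    obtain v where v: "v \<in> src.\<Gamma>" "v p = y" by (rule src.section_through)
    obtain w where w: "w \<in> src.\<Gamma>" "w p = z" by (rule src.section_through)
    note p = push_section[OF u(1)] push_section[OF v(1)] push_section[OF w(1)]
    have "anchor C' (f p) (push u (f p)) (\<lambda>q. pairing C' q (push v q) (push w q)) =
        anchor C p (u p) (\<lambda>q. pairing C q (v q) (w q))"
      by (simp add: anchor_push push_tangent_def F_pr)
    then have 1: "pairing C p (\<Delta> x y) z = - pairing C p y (\<Delta> x z)"
      using D'.conn_pairing[OF p, of "f p"] D.conn_pairing[OF u(1) v(1) w(1), of p] u v w
      by (simp add: D' F_pr src.form.form_simps)
    have "anchor C' (f p) (push u (f p)) (\<lambda>q. G' q (push v q) (push w q)) =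
        anchor C p (u p) (\<lambda>q. G q (v q) (w q))"
      by (simp add: anchor_push push_tangent_def isom)
    then have 2: "G p (\<Delta> x y) z = - G p y (\<Delta> x z)"
      using metric_compatible(2)[OF p, of "f p"] metric_compatible(1)[OF u(1) v(1) w(1), of p] u v w
      by (simp add: D' isom src.gform.form_simps)
    from 1 2 show ?thesis ..
  qed
  \<comment> \<open>Being skew for both the pairing and \<open>G\<close> means commuting with the
    metric endomorphism, hence preserving its eigenspaces.\<close>
  have eig: "\<Delta> x y \<in> src.invol.eig p \<epsilon>" if "y \<in> src.invol.eig p \<epsilon>" for x y \<epsilon>
  proof -
    have "metric_endo C G p (\<Delta> x y) = \<epsilon> *\<^sub>R \<Delta> x y"
    proof (rule src.form.eqI[of p])
      fix z
      have "G p y (\<Delta> x z) = \<epsilon> * pairing C p y (\<Delta> x z)" by (rule src.metric_on_eig[OF that])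
      then show "pairing C p (metric_endo C G p (\<Delta> x y)) z = pairing C p (\<epsilon> *\<^sub>R \<Delta> x y) z"
        using skew[of x y z] by (simp add: src.endo_pairing src.form.form_simps)
    qed
    then show ?thesis by (simp add: src.invol.eig_def)
  qed
  \<comment> \<open>Both torsions vanish, and after one use of skewness their difference is the
    cyclic sum.\<close>
  have cyc: "pairing C p (\<Delta> x y) z + pairing C p (\<Delta> y z) x + pairing C p (\<Delta> z x) y = 0" for x y z
  proof -
    obtain u where u: "u \<in> src.\<Gamma>" "u p = x" by (rule src.section_through)
    obtain v where v: "v \<in> src.\<Gamma>" "v p = y" by (rule src.section_through)
    obtain w where w: "w \<in> src.\<Gamma>" "w p = z" by (rule src.section_through)
    note p = push_section[OF u(1)] push_section[OF v(1)] push_section[OF w(1)]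
    have "torsion C' D' (push u) (push v) (push w) (f p) =
        pairing C' (f p) (F p (D u v p + \<Delta> x y - (D v u p + \<Delta> y x) - dorfman C u v p)) (F p z)
        + pairing C' (f p) (F p (D w u p + \<Delta> z x)) (F p y)"
      by (simp add: torsion_def D' u v w dorfman_push F_simps)
    also have "\<dots> = torsion C D u v w p + pairing C p (\<Delta> x y) z - pairing C p (\<Delta> y x) z + pairing C p (\<Delta> z x) y"
      by (simp add: F_pr torsion_def u v w src.form.form_simps)
    finally show ?thesis
      using D.torsion_free[OF u(1) v(1) w(1)] D'.torsion_free[OF p] skew[of y x z]
      by (simp add: src.form.sym[of p x])
  qed
  have prol: "src.invol.prolongation p \<Delta>"
    unfolding src.invol.prolongation_def using bil skew eig cyc by blast
  have lin1: "linear (\<lambda>x. \<Delta> x y)" for y using bil by (simp add: bilinear_def)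
  have tr: "endo_trace (\<lambda>x. \<Delta> x y) = 0" for y
  proof -
    obtain v where v: "v \<in> src.\<Gamma>" "v p = y" by (rule src.section_through)
    have c: "conn_at C' D' (f p) (F p x) (push v) = F p (conn_at C D p x v + \<Delta> x y)" for x
    proof -
      obtain u where u: "u \<in> src.\<Gamma>" "u p = x" by (rule src.section_through)
      show ?thesis
        using D'.conn_at_eq[OF push_section[OF u(1)] push_section[OF v(1)], of "f p"] D.conn_at_eq[OF u(1) v(1), of p]
        by (simp add: D' u v)
    qed
    \<comment> \<open>Written as contractions, the traces are carried along by \<open>F\<close>; as
      the two divergences agree, \<Delta> has no trace.\<close>
    have "dv' (push v) (f p) = tgt.form.ctr (f p) (\<lambda>x y. pairing C' (f p) (conn_at C' D' (f p) x (push v)) y)"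
      unfolding divergence_trace(2)[OF push_section[OF v(1)]]
      by (rule tgt.form.endo_trace_eq_ctr[OF D'.conn_at_linear[OF push_section[OF v(1)]]])
    also have "\<dots> = src.form.ctr p (\<lambda>x x'. pairing C p (conn_at C D p x v + \<Delta> x y) x')"
      using ctr_isometry[OF src.form.nondegenerate_form_axioms tgt.form.nondegenerate_form_axioms F_lin F_bij F_pr
          tgt.form.bilinear_form_comp(1)[OF D'.conn_at_linear[OF push_section[OF v(1)]]], of p "f p"]
      by (simp add: c F_pr)
    also have "\<dots> = dv v p + endo_trace (\<lambda>x. \<Delta> x y)"
      unfolding divergence_trace(1)[OF v(1)] src.form.endo_trace_eq_ctr[OF D.conn_at_linear[OF v(1), of p], of p]
        src.form.endo_trace_eq_ctr[OF lin1[of y], of p]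
      by (simp add: src.form.form_simps src.form.ctr_add)
    finally show ?thesis using div[OF v(1)] by simp
  qed
  have "\<Delta> x y = 0" for x y
  proof (rule src.invol.prolongation_nondegenerate[OF prol tr])
    fix K assume K: "src.invol.prolongation p K" "\<And>v. endo_trace (\<lambda>u. K u v) = 0"
    \<comment> \<open>The orthogonality of \<open>S'\<close> is stated in the target, so the test
      tensor is transported there and the scalar product is brought back.\<close>
    define K' where "K' x y = F p (K (inv (F p) x) (inv (F p) y))" for x y
    have K'F: "K' (F p x) (F p y) = F p (K x y)" for x y by (simp add: K'_def)
    have ex: "\<exists>x'. x = F p x'" for x by (rule exI[of _ "inv (F p) x"]) simp
    have Kb: "bilinear K" using K(1) by (simp add: src.invol.prolongation_def)
    have K'b: "bilinear K'"
      using Kb by (simp add: bilinear_def linear_iff K'_def F_simps Finv_simps)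
    have "tgt.invol.prolongation (f p) K'"
      unfolding tgt.invol.prolongation_def
    proof (intro conjI allI ballI K'b)
      fix u v w
      obtain u' v' w' where [simp]: "u = F p u'" "v = F p v'" "w = F p w'" using ex by metis
      show "pairing C' (f p) (K' u v) w = - pairing C' (f p) v (K' u w)"
        using K(1) unfolding src.invol.prolongation_def by (simp add: K'F F_pr)
      have "pairing C p (K u' v') w' + pairing C p (K v' w') u' + pairing C p (K w' u') v' = 0"
        using K(1) unfolding src.invol.prolongation_def by blast
      then show "pairing C' (f p) (K' u v) w + pairing C' (f p) (K' v w) u + pairing C' (f p) (K' w u) v = 0"
        by (simp add: K'F F_pr)
    next
      fix \<epsilon> :: real and u v assume *: "\<epsilon> \<in> {1, -1}" "v \<in> tgt.invol.eig (f p) \<epsilon>"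
      obtain u' v' where [simp]: "u = F p u'" "v = F p v'" using ex by metis
      show "K' u v \<in> tgt.invol.eig (f p) \<epsilon>"
        using K(1) * unfolding src.invol.prolongation_def by (auto simp: K'F eig_push)
    qed
    moreover have "endo_trace (\<lambda>u. K' u v) = 0" for v
    proof -
      obtain v' where [simp]: "v = F p v'" using ex by metis
      have l: "linear (\<lambda>u. K' u v)" "linear (\<lambda>u. K u v')" using K'b Kb by (simp_all add: bilinear_def)
      have "endo_trace (\<lambda>u. K' u v) = tgt.form.ctr (f p) (\<lambda>x y. pairing C' (f p) (K' x v) y)"
        by (rule tgt.form.endo_trace_eq_ctr[OF l(1)])
      also have "\<dots> = src.form.ctr p (\<lambda>x y. pairing C p (K x v') y)"
        using ctr_isometry[OF src.form.nondegenerate_form_axioms tgt.form.nondegenerate_form_axioms F_lin F_bij F_pr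
          tgt.form.bilinear_form_comp(1)[OF l(1)], of p "f p"]
        by (simp add: K'F F_pr)
      also have "\<dots> = endo_trace (\<lambda>u. K u v')" by (rule src.form.endo_trace_eq_ctr[OF l(2), symmetric])
      finally show ?thesis by (simp add: K(2))
    qed
    ultimately have "K' \<in> trace_kernel C' G' (f p)"
      by (simp add: trace_kernel_def tgt.so_prolong_eq)
    then have "tensor_pairing C' (f p) (S' (f p)) K' = 0" by (rule S'(4))
    moreover have "tensor_pairing C' (f p) (S' (f p)) K' =
        src.form.ctr p (\<lambda>a a'. src.form.ctr p (\<lambda>b b'. pairing C p (inv (F p) (S' (f p) (F p a) (F p b))) (K a' b')))"
    proof -
      let ?\<beta> = "\<lambda>a a' b b'. pairing C' (f p) (S' (f p) a b) (K' a' b')"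
      have b2: "bilinear (?\<beta> a a')" for a a'
        using S'(2) K'b by (simp add: bilinear_def linear_iff tgt.form.form_simps)
      have b1: "bilinear (\<lambda>a a'. tgt.form.ctr (f p) (?\<beta> a a'))"
        using S'(2) K'b
        by (simp add: bilinear_def linear_iff tgt.form.form_simps tgt.form.ctr_add tgt.form.ctr_cmul)
      note iso = ctr_isometry[OF src.form.nondegenerate_form_axioms tgt.form.nondegenerate_form_axioms F_lin F_bij F_pr]
      have "tensor_pairing C' (f p) (S' (f p)) K' =
          src.form.ctr p (\<lambda>a a'. src.form.ctr p (\<lambda>b b'. ?\<beta> (F p a) (F p a') (F p b) (F p b')))"
        unfolding tgt.tensor_pairing_eq iso[OF b1] unfolding iso[OF b2] ..
      moreover have "?\<beta> (F p a) (F p a') (F p b) (F p b') =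
          pairing C p (inv (F p) (S' (f p) (F p a) (F p b))) (K a' b')" for a a' b b'
        using F_pr[of p "inv (F p) (S' (f p) (F p a) (F p b))" "K a' b'"] by (simp add: K'F)
      ultimately show ?thesis by simp
    qed
    moreover have "K \<in> trace_kernel C G p" using K by (simp add: trace_kernel_def src.so_prolong_eq)
    then have "tensor_pairing C p (S p) K = 0" by (rule S(4))
    ultimately show "src.form.ctr p (\<lambda>a a'. src.form.ctr p (\<lambda>b b'. pairing C p (\<Delta> a b) (K a' b'))) = 0"
      unfolding src.tensor_pairing_eq \<Delta>_def by (simp add: src.form.form_simps src.form.ctr_diff)
  qed
  then show ?thesis using D'[OF uv, of] by simp
qed

lemma conn_at_push:
  assumes "v \<in> src.\<Gamma>"
  shows "conn_at C' D' (f p) (F p x) (push v) = F p (conn_at C D p x v)"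
proof -
  obtain u where u: "u \<in> src.\<Gamma>" "u p = x" by (rule src.section_through)
  show ?thesis
    using D'.conn_at_eq[OF push_section[OF u(1)] push_section[OF assms], of "f p"] D.conn_at_eq[OF u(1) assms, of p]
    by (simp add: connection_push u assms)
qed

lemma connection_push_sec: "u \<in> src.\<Gamma> \<Longrightarrow> v \<in> src.\<Gamma> \<Longrightarrow> D' (push u) (push v) = push (D u v)"
  by (rule push_eqI) (rule connection_push)

lemma riemann_push:
  assumes "a \<in> src.\<Gamma>" "b \<in> src.\<Gamma>" "v \<in> src.\<Gamma>" "w \<in> src.\<Gamma>"
  shows "riemann C' D' (push a) (push b) (push v) (push w) (f p) = riemann C D a b v w p"
proof -
  have sd: "second_deriv D' (push u) (push v) (push w) (f p) = F p (second_deriv D u v w p)"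
    if "u \<in> src.\<Gamma>" "v \<in> src.\<Gamma>" "w \<in> src.\<Gamma>" for u v w
    using that by (simp add: second_deriv_def connection_push_sec D.conn_closed F_simps)
  have "tgt.form.ctr (f p) (\<lambda>x y. pairing C' (f p) (conn_at C' D' (f p) x (push v)) (push w (f p)) *
        pairing C' (f p) (conn_at C' D' (f p) y (push b)) (push a (f p))) =
      src.form.ctr p (\<lambda>x y. pairing C p (conn_at C D p x v) (w p) * pairing C p (conn_at C D p y b) (a p))"
    using ctr_isometry[OF src.form.nondegenerate_form_axioms tgt.form.nondegenerate_form_axioms F_lin F_bij F_pr
        D'.bilinear_conn_at_product[OF push_section[OF assms(3)] push_section[OF assms(2)]], of p "f p"]
    by (simp add: conn_at_push assms F_pr)
  then show ?thesis
    unfolding D'.riemann_eq_ctr D.riemann_eq_ctr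
    by (simp add: sd assms F_pr flip: F_simps)
qed

lemma riemann_at_push: "riemann_at C' D' (f p) (F p x) (F p y) (F p z) (F p t) = riemann_at C D p x y z t"
proof -
  obtain a where a: "a \<in> src.\<Gamma>" "a p = x" by (rule src.section_through)
  obtain b where b: "b \<in> src.\<Gamma>" "b p = y" by (rule src.section_through)
  obtain v where v: "v \<in> src.\<Gamma>" "v p = z" by (rule src.section_through)
  obtain w where w: "w \<in> src.\<Gamma>" "w p = t" by (rule src.section_through)
  show ?thesis
    using D'.riemann_at_eq[OF a(1)[THEN push_section] b(1)[THEN push_section] v(1)[THEN push_section]
        w(1)[THEN push_section], of "f p"] D.riemann_at_eq[OF a(1) b(1) v(1) w(1), of p]
      riemann_push[OF a(1) b(1) v(1) w(1), of p] a b v w by simp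
qed

text \<open>In the target frame \<open>F p (std_basis i)\<close> the inverse Gram matrix and the
  curvature components equal those of the standard frame of the source.\<close>

lemma kretschmann_push: "kretschmann C' G' D' (f p) = kretschmann C G D p"
proof -
  let ?e = "\<lambda>i. F p (std_basis i)"
  have inj: "inj (F p)" using F_bij by (rule bij_is_inj)
  have e1: "inj ?e" using inj std_basis_basis(1) by (auto simp: inj_def)
  have "independent (F p ` range std_basis)"
    by (intro linear_independent_injective_image[OF F_lin] std_basis_basis inj_on_subset[OF inj]) auto
  then have e2: "independent (range ?e)" by (simp add: image_image)
  have g: "gram_inv (G' (f p)) ?e = gram_inv (G p) std_basis" by (simp add: gram_inv_def isom)
  show ?thesis
    unfolding D'.kretschmann_eq[of G', OF tgt.gform.nondegenerate_form_axioms]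
      D.kretschmann_eq[of G, OF src.gform.nondegenerate_form_axioms]
      tgt.gform.square4_gram_inv[OF D'.riemann_at_linear e1 e2]
      src.gform.square4_gram_inv[OF D.riemann_at_linear std_basis_basis]
      g riemann_at_push ..
qed

end

lemma kretschmann_data_smooth:
  assumes "kretschmann_data C G dv D"
  shows "smooth_fun (atlas C) (kretschmann C G D)"
proof -
  have *: "exact_courant_algebroid C" "generalised_metric C G" "generalised_levi_civita C G D"
    using assms by (simp_all add: kretschmann_data_def canonical_connection_def)
  interpret courant_alg C
    using *(1) by unfold_locales (simp add: exact_courant_algebroid_def)
  interpret torsion_free_connection C D
    by unfold_locales (use *(3) in \<open>simp_all add: generalised_levi_civita_def\<close>)
  show ?thesis using *(2) by (intro kretschmann_smooth) (simp add: generalised_metric_def)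
qed

lemma kretschmann_natural:
  assumes data: "kretschmann_data C G dv D" "kretschmann_data C' G' dv' D'"
    and iso: "courant_isomorphism C C' f F" and maps: "maps_metric_div C f F G dv G' dv'"
  shows "kretschmann C' G' D' \<circ> f = kretschmann C G D"
proof -
  interpret src: generalised_metric_alg C G
    using data(1) by unfold_locales (simp_all add: kretschmann_data_def exact_courant_algebroid_def)
  interpret tgt: generalised_metric_alg C' G'
    using data(2) by unfold_locales (simp_all add: kretschmann_data_def exact_courant_algebroid_def)
  interpret canonical_pair C G C' G' f F dv D dv' D'
  proof unfold_locales
    show "dv' (push_sec f F s) (f p) = dv s p" if "s \<in> sections C" for s p
      using maps that unfolding maps_metric_div_def by (metis comp_apply)
  qed (use data iso maps in \<open>simp_all add: kretschmann_data_def maps_metric_div_def\<close>)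
  show ?thesis by (rule ext) (simp add: kretschmann_push)
qed

subsection \<open>Flat space as a manifold\<close>

abbreviation dd :: "(real^'n \<Rightarrow> 'b::real_normed_vector) \<Rightarrow> real^'n \<Rightarrow> real^'n \<Rightarrow> 'b" where
  "dd u p x \<equiv> frechet_derivative u (at p) x"

definition flat_atlas :: "(real^'n::finite, 'n) chart set" where
  "flat_atlas = {(UNIV, \<lambda>x. x)}"

lemma inv_ident: "inv (\<lambda>x. x) = (\<lambda>x. x)"
  using inv_id unfolding id_def .

lemma flat_mfd [simp]: "mfd_smooth_on flat_atlas W f \<longleftrightarrow> smooth_on W f"
  by (simp add: inv_ident mfd_smooth_on_def flat_atlas_def comp_def)

lemma flat_smooth_atlas: "smooth_atlas flat_atlas"
proof -
  have "mfd_smooth_on flat_atlas UNIV (\<lambda>x :: real^'n. x)" by (simp add: smooth_on_id)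
  then show ?thesis
    unfolding smooth_atlas_def by (simp add: flat_atlas_def homeomorphism_def inv_ident)
qed

interpretation flat: smooth_manifold "flat_atlas :: (real^'n::finite, 'n) chart set"
  by unfold_locales (rule flat_smooth_atlas)

context
  fixes u :: "real^'n \<Rightarrow> 'b::real_normed_vector"
  assumes u: "smooth_on UNIV u"
begin

lemma dd_has_derivative: "(u has_derivative dd u p) (at p)"
  by (rule smooth_on_has_derivative[OF u]) simp

lemma dd_linear: "linear (dd u p)"
  by (rule has_derivative_linear[OF dd_has_derivative])

lemma dd_expand: "dd u p x = (\<Sum>i\<in>UNIV. x $ i *\<^sub>R dd u p (axis i 1))"
proof -
  have "dd u p x = dd u p (\<Sum>i\<in>UNIV. x $ i *\<^sub>R std_basis i)" by (simp only: std_basis_expansion)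
  then show ?thesis by (simp add: linear_sum[OF dd_linear] linear_cmul[OF dd_linear] std_basis_def)
qed

end

lemma dd_eq: "(u has_derivative u') (at p) \<Longrightarrow> dd u p x = u' x"
  by (metis frechet_derivative_at)

lemma dd_coordinate: "dd (\<lambda>x. x $ i) p x = x $ i"
  by (rule dd_eq) (rule bounded_linear_imp_has_derivative[OF bounded_linear_vec_nth])

lemma dd_add: "smooth_on UNIV u \<Longrightarrow> smooth_on UNIV v \<Longrightarrow> dd (\<lambda>p. u p + v p) p x = dd u p x + dd v p x"
  by (rule dd_eq) (intro has_derivative_add dd_has_derivative)

lemma dd_bilinear:
  assumes "bounded_bilinear b" "smooth_on UNIV u" "smooth_on UNIV v"
  shows "dd (\<lambda>p. b (u p) (v p)) p x = b (u p) (dd v p x) + b (dd u p x) (v p)"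
  by (rule dd_eq) (intro bounded_bilinear.FDERIV[OF assms(1)] dd_has_derivative assms(2,3))

lemma dd_linear_compose:
  fixes L :: "'b::euclidean_space \<Rightarrow> 'c::real_normed_vector"
  assumes "linear L" "smooth_on UNIV u"
  shows "dd (\<lambda>p. L (u p)) p x = L (dd u p x)"
  by (rule dd_eq) (intro bounded_linear.has_derivative[OF _ dd_has_derivative] assms(2)
      linear_conv_bounded_linear[THEN iffD1, OF assms(1)])

text \<open>The direction varies with the point, so it is resolved into the fixed coordinate
  directions.\<close>

lemma smooth_dd:
  fixes V :: "real^'n \<Rightarrow> real^'n"
  assumes "smooth_on UNIV u" "smooth_on UNIV V"
  shows "smooth_on UNIV (\<lambda>p. dd u p (V p))"
  unfolding dd_expand[OF assms(1), of _ "V _"]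
  by (intro smooth_on_sum smooth_on_scaleR smooth_on_vec_nth smooth_on_frechet_derivative assms) auto

text \<open>A product rule in which the direction varies too: a second derivative with frozen
  directions, to which symmetry applies, plus a first derivative along the derivative of
  \<open>V\<close>.\<close>

lemma dd_dd:
  fixes V :: "real^'n \<Rightarrow> real^'n"
  assumes u: "smooth_on UNIV u" and V: "smooth_on UNIV V"
  shows "dd (\<lambda>q. dd u q (V q)) p x = dd (\<lambda>q. dd u q (V p)) p x + dd u p (dd V p x)"
proof -
  have s: "smooth_on UNIV (\<lambda>q. dd u q y)" for y by (rule smooth_on_frechet_derivative[OF u])
  have "((\<lambda>q. \<Sum>i\<in>UNIV. V q $ i *\<^sub>R dd u q (axis i 1)) has_derivative
      (\<lambda>x. \<Sum>i\<in>UNIV. V p $ i *\<^sub>R dd (\<lambda>q. dd u q (axis i 1)) p x + dd V p x $ i *\<^sub>R dd u p (axis i 1))) (at p)"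
    by (intro has_derivative_sum bounded_bilinear.FDERIV[OF bounded_bilinear_scaleR]
        bounded_linear.has_derivative[OF bounded_linear_vec_nth] dd_has_derivative V s)
  from dd_eq[OF this, of x] have "dd (\<lambda>q. dd u q (V q)) p x =
      (\<Sum>i\<in>UNIV. V p $ i *\<^sub>R dd (\<lambda>q. dd u q (axis i 1)) p x) + (\<Sum>i\<in>UNIV. dd V p x $ i *\<^sub>R dd u p (axis i 1))"
    by (simp add: sum.distrib flip: dd_expand[OF u])
  moreover have "((\<lambda>q. \<Sum>i\<in>UNIV. V p $ i *\<^sub>R dd u q (axis i 1)) has_derivative
      (\<lambda>x. \<Sum>i\<in>UNIV. V p $ i *\<^sub>R dd (\<lambda>q. dd u q (axis i 1)) p x)) (at p)"
    by (intro has_derivative_sum has_derivative_scaleR_right dd_has_derivative s)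
  from dd_eq[OF this, of x]
  have "dd (\<lambda>q. dd u q (V p)) p x = (\<Sum>i\<in>UNIV. V p $ i *\<^sub>R dd (\<lambda>q. dd u q (axis i 1)) p x)"
    by (simp flip: dd_expand[OF u])
  ultimately show ?thesis by (simp flip: dd_expand[OF u])
qed

section \<open>Tangent vectors and the Levi-Civita connection of flat space\<close>

definition tv :: "real^'n::finite \<Rightarrow> real^'n \<Rightarrow> (real^'n) tangent" where
  "tv p x = (\<lambda>f. if smooth_on UNIV f then dd f p x else 0)"

definition co :: "(real^'n::finite) tangent \<Rightarrow> real^'n" where
  "co X = (\<chi> i. X (\<lambda>x. x $ i))"

lemma co_tv [simp]: "co (tv p x) = x"
  by (simp add: co_def tv_def vec_eq_iff dd_coordinate smooth_on_linear bounded_linear_vec_nth)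

lemma tv_smooth: "smooth_on UNIV f \<Longrightarrow> tv p x f = dd f p x"
  by (simp add: tv_def)

lemma tv_comb: "tv p (a *\<^sub>R x + b *\<^sub>R y) = (\<lambda>f. a * tv p x f + b * tv p y f)"
  by (rule ext) (simp add: tv_def linear_add[OF dd_linear] linear_cmul[OF dd_linear])

lemma tv_zero_iff: "tv p x = (\<lambda>f. 0) \<longleftrightarrow> x = 0"
proof
  assume e: "tv p x = (\<lambda>f. 0)"
  have "x = co (tv p x)" by simp
  also have "\<dots> = 0" unfolding e by (simp add: co_def vec_eq_iff)
  finally show "x = 0" .
next
  show "x = 0 \<Longrightarrow> tv p x = (\<lambda>f. 0)" using tv_comb[of p 0 0 0 0] by simp
qed

lemma flat_tangent_space: "tangent_space flat_atlas p = range (tv p)"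
  unfolding tangent_space_def flat_mfd by (auto simp: flat_atlas_def inv_ident tv_def[abs_def] comp_def cong: if_cong)

lemma flat_vector_fields:
  "vector_fields flat_atlas = {X. (\<forall>p. X p = tv p (co (X p))) \<and> smooth_on UNIV (\<lambda>p. co (X p))}"
  (is "?L = ?R")
proof (intro set_eqI iffI)
  fix X assume X: "X \<in> ?L"
  have "X p = tv p (co (X p))" for p
  proof -
    have "X p \<in> range (tv p)" using X unfolding vector_fields_def flat_tangent_space by blast
    then show ?thesis by auto
  qed
  moreover have "smooth_on UNIV (\<lambda>p. co (X p))"
    using X by (intro smooth_on_vec) (simp_all add: vector_fields_def co_def smooth_on_linear bounded_linear_vec_nth)
  ultimately show "X \<in> ?R" by simp
next
  fix X assume X: "X \<in> ?R"
  have "smooth_on UNIV (\<lambda>p. X p f)" if "smooth_on UNIV f" for f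
  proof -
    have "X p f = dd f p (co (X p))" for p using X that tv_smooth by (metis (mono_tags) mem_Collect_eq)
    then show ?thesis using smooth_dd[OF that, of "\<lambda>p. co (X p)"] X by simp
  qed
  then show "X \<in> ?L" using X unfolding vector_fields_def flat_tangent_space by (auto intro: range_eqI)
qed

definition flat_nabla :: "(real^'n::finite) vfield \<Rightarrow> (real^'n) vfield \<Rightarrow> (real^'n) vfield" where
  "flat_nabla X Y = (\<lambda>p. tv p (dd (\<lambda>q. co (Y q)) p (co (X p))))"

lemma flat_levi_civita:
  assumes g: "\<And>p x y. g p (tv p x) (tv p y) = x \<bullet> y"
  shows "levi_civita flat_atlas g flat_nabla"
proof -
  let ?V = "vector_fields flat_atlas"
  have V: "X p = tv p (co (X p))" "smooth_on UNIV (\<lambda>p. co (X p))" if "X \<in> ?V" for X p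
    using that unfolding flat_vector_fields by blast+
  have add: "co (vf_add X Y p) = co (X p) + co (Y p)" for X Y p
    by (simp add: co_def vf_add_def vec_eq_iff)
  have mult: "co (vf_mult h X p) = h p *\<^sub>R co (X p)" for h X p
    by (simp add: co_def vf_mult_def vec_eq_iff)
  have tadd: "tv p (x + y) = (\<lambda>f. tv p x f + tv p y f)" for p x y using tv_comb[of p 1 x 1 y] by simp
  have tmul: "tv p (c *\<^sub>R x) = (\<lambda>f. c * tv p x f)" for p c x using tv_comb[of p c x 0 0] by simp
  \<comment> \<open>The commutator of vector fields in coordinates: the second derivatives of
    \<open>f\<close> cancel by symmetry. This gives the torsion identity for
    \<open>flat_nabla\<close>.\<close>
  have flip: "dd f p (dd W p (U p)) - dd f p (dd U p (W p)) =
      dd (\<lambda>q. dd f q (W q)) p (U p) - dd (\<lambda>q. dd f q (U q)) p (W p)"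
    if "smooth_on UNIV f" "smooth_on UNIV U" "smooth_on UNIV W" for f :: "real^'n \<Rightarrow> real" and U W p
    using second_derivative_symmetric_real[OF open_UNIV that(1) UNIV_I, of "W p" p "U p"]
    by (simp add: dd_dd[OF that(1,2)] dd_dd[OF that(1,3)])
  show ?thesis
    unfolding levi_civita_def
  proof (intro conjI ballI allI impI)
    show "flat_nabla X Y \<in> ?V" if "X \<in> ?V" "Y \<in> ?V" for X Y
      unfolding flat_vector_fields flat_nabla_def using smooth_dd[OF V(2)[OF that(2)] V(2)[OF that(1)]] by simp
    show "flat_nabla (vf_add X X') Y = vf_add (flat_nabla X Y) (flat_nabla X' Y)"
      if "X \<in> ?V" "X' \<in> ?V" "Y \<in> ?V" for X X' Y
      using V(2)[OF that(3)]
      by (simp add: flat_nabla_def fun_eq_iff add linear_add[OF dd_linear] tadd vf_add_def[of "\<lambda>p. tv p (_ p)"])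
    show "flat_nabla Y (vf_add X X') = vf_add (flat_nabla Y X) (flat_nabla Y X')"
      if "X \<in> ?V" "X' \<in> ?V" "Y \<in> ?V" for X X' Y
      using V(2)[OF that(1)] V(2)[OF that(2)]
      by (simp add: flat_nabla_def fun_eq_iff add dd_add tadd vf_add_def[of "\<lambda>p. tv p (_ p)"])
    show "flat_nabla (vf_mult h X) Y = vf_mult h (flat_nabla X Y)"
      if "mfd_smooth_on flat_atlas UNIV h \<and> X \<in> ?V \<and> Y \<in> ?V" for h X Y
      using V(2)[of Y] that
      by (simp add: flat_nabla_def fun_eq_iff mult linear_cmul[OF dd_linear] tmul vf_mult_def[of _ "\<lambda>p. tv p (_ p)"])
    show "flat_nabla X (vf_mult h Y) = vf_add (vf_mult (\<lambda>p. X p h) Y) (vf_mult h (flat_nabla X Y))"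
      if "mfd_smooth_on flat_atlas UNIV h \<and> X \<in> ?V \<and> Y \<in> ?V" for h X Y
    proof (intro ext)
      fix p f
      have h: "smooth_on UNIV h" and X: "X \<in> ?V" and Y: "Y \<in> ?V" using that by simp_all
      have "X p h = dd h p (co (X p))" using V(1)[OF X, of p] tv_smooth[OF h] by metis
      moreover have "Y p f = tv p (co (Y p)) f" using V(1)[OF Y, of p] by simp
      ultimately show "flat_nabla X (vf_mult h Y) p f =
          vf_add (vf_mult (\<lambda>p. X p h) Y) (vf_mult h (flat_nabla X Y)) p f"
        unfolding flat_nabla_def mult dd_bilinear[OF bounded_bilinear_scaleR h V(2)[OF Y]] tadd tmul
        by (simp add: vf_add_def vf_mult_def)
    qed
    show "X p (\<lambda>q. g q (Y q) (Z q)) = g p (flat_nabla X Y p) (Z p) + g p (Y p) (flat_nabla X Z p)"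
      if "X \<in> ?V" "Y \<in> ?V" "Z \<in> ?V" for X Y Z p
    proof -
      have e: "g q (Y q) (Z q) = co (Y q) \<bullet> co (Z q)" for q
        using g V(1)[OF that(2)] V(1)[OF that(3)] by metis
      have s: "smooth_on UNIV (\<lambda>q. co (Y q) \<bullet> co (Z q))"
        by (intro bounded_bilinear.smooth_on_prod[OF bounded_bilinear_inner] V that) simp
      have "X p (\<lambda>q. g q (Y q) (Z q)) = dd (\<lambda>q. co (Y q) \<bullet> co (Z q)) p (co (X p))"
        unfolding e using V(1)[OF that(1), of p] tv_smooth[OF s] by metis
      also have "\<dots> = co (Y p) \<bullet> dd (\<lambda>q. co (Z q)) p (co (X p)) + dd (\<lambda>q. co (Y q)) p (co (X p)) \<bullet> co (Z p)"
        by (rule dd_bilinear[OF bounded_bilinear_inner V(2)[OF that(2)] V(2)[OF that(3)]])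
      also have "\<dots> = g p (flat_nabla X Y p) (tv p (co (Z p))) + g p (tv p (co (Y p))) (flat_nabla X Z p)"
        by (simp add: flat_nabla_def g)
      finally show ?thesis using V(1)[OF that(2), of p] V(1)[OF that(3), of p] by simp
    qed
    show "flat_nabla X Y p f - flat_nabla Y X p f = X p (\<lambda>q. Y q f) - Y p (\<lambda>q. X q f)"
      if "X \<in> ?V" "Y \<in> ?V" "mfd_smooth_on flat_atlas UNIV f" for X Y p f
    proof -
      have f: "smooth_on UNIV f" using that(3) by simp
      have e: "X q h = dd h q (co (X q))" "Y q h = dd h q (co (Y q))" if "smooth_on UNIV h" for q h
        using V(1)[OF \<open>X \<in> ?V\<close>, of q] V(1)[OF \<open>Y \<in> ?V\<close>, of q] tv_smooth[OF that] by metis+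
      have "X p (\<lambda>q. Y q f) = dd (\<lambda>q. dd f q (co (Y q))) p (co (X p))"
        unfolding e(2)[OF f] by (rule e(1)[OF smooth_dd[OF f V(2)[OF that(2)]]])
      moreover have "Y p (\<lambda>q. X q f) = dd (\<lambda>q. dd f q (co (X q))) p (co (Y p))"
        unfolding e(1)[OF f] by (rule e(2)[OF smooth_dd[OF f V(2)[OF that(1)]]])
      ultimately show ?thesis
        using flip[OF f V(2)[OF that(1)] V(2)[OF that(2)], of p] by (simp add: flat_nabla_def tv_smooth[OF f])
    qed
  qed
qed

subsection \<open>The standard Courant algebroid over flat space\<close>

text \<open>The fibre is written as \<open>E\<^sub>+ \<oplus> E\<^sub>-\<close>: the two summands of the index type label orthonormal frames
  \<open>\<partial>\<^sub>i \<plusminus> dx\<^sub>i\<close> of the two eigenbundles.\<close>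

type_synonym 'n flat_fibre = "real^('n + 'n)"

definition \<theta> :: "'n::finite flat_fibre \<Rightarrow> 'n flat_fibre" where
  "\<theta> u = (\<chi> I. case I of Inl i \<Rightarrow> u $ I | Inr i \<Rightarrow> - u $ I)"

definition flat_pair :: "'n::finite flat_fibre \<Rightarrow> 'n flat_fibre \<Rightarrow> real" where
  "flat_pair u v = \<theta> u \<bullet> v"

text \<open>A sum, because \<open>\<partial>\<^sub>i + dx\<^sub>i\<close> and
  \<open>\<partial>\<^sub>i - dx\<^sub>i\<close> both project to
  \<open>\<partial>\<^sub>i\<close>.\<close>

definition flat_anchor :: "'n::finite flat_fibre \<Rightarrow> real^'n" where
  "flat_anchor u = (\<chi> i. u $ Inl i + u $ Inr i)"

text \<open>In the frames of the two eigenbundles \<open>dup a\<close> represents the vector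
  \<open>2 a\<close>, and \<open>cov a\<close>, with the sign changed on \<open>E_-\<close>, the
  covector \<open>2 a\<close>.\<close>

definition dup :: "real^'n::finite \<Rightarrow> 'n flat_fibre" where
  "dup a = (\<chi> I. case I of Inl i \<Rightarrow> a $ i | Inr i \<Rightarrow> a $ i)"

abbreviation cov :: "real^'n::finite \<Rightarrow> 'n flat_fibre" where
  "cov a \<equiv> \<theta> (dup a)"

lemma theta_linear: "linear \<theta>"
  by (simp add: linear_iff \<theta>_def vec_eq_iff split: sum.split)

lemma theta_theta [simp]: "\<theta> (\<theta> u) = u"
  by (simp add: \<theta>_def vec_eq_iff split: sum.split)

lemma theta_inner: "\<theta> u \<bullet> \<theta> v = u \<bullet> v"
  unfolding inner_vec_def by (intro sum.cong) (auto simp: \<theta>_def split: sum.split)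

lemma theta_adjoint: "\<theta> u \<bullet> v = u \<bullet> \<theta> v"
  using theta_inner[of u "\<theta> v"] by simp

lemma flat_anchor_linear: "linear flat_anchor"
  by (simp add: linear_iff flat_anchor_def vec_eq_iff algebra_simps)

lemma dup_linear: "linear dup"
  by (simp add: linear_iff dup_def vec_eq_iff split: sum.split)

lemma flat_anchor_dup [simp]: "flat_anchor (dup a) = 2 *\<^sub>R a" and flat_anchor_cov [simp]: "flat_anchor (cov a) = 0"
  by (simp_all add: flat_anchor_def dup_def \<theta>_def vec_eq_iff)

lemma dup_inner: "dup a \<bullet> v = a \<bullet> flat_anchor v"
proof -
  have "dup a \<bullet> v = (\<Sum>I\<in>UNIV <+> UNIV. dup a $ I * v $ I)" by (simp add: inner_vec_def)
  also have "\<dots> = a \<bullet> flat_anchor v"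
    by (subst sum.Plus) (simp_all add: dup_def flat_anchor_def inner_vec_def comp_def algebra_simps sum.distrib)
  finally show ?thesis .
qed

lemma flat_anchor_eq_0_iff: "flat_anchor u = 0 \<longleftrightarrow> u = cov (\<chi> i. u $ Inl i)"
proof
  assume "flat_anchor u = 0"
  then have "u $ Inl i + u $ Inr i = 0" for i by (simp add: flat_anchor_def vec_eq_iff)
  then have "u $ Inr i = - u $ Inl i" for i by (metis add_eq_0_iff)
  then show "u = cov (\<chi> i. u $ Inl i)" by (simp add: vec_eq_iff \<theta>_def dup_def split: sum.split)
next
  assume "u = cov (\<chi> i. u $ Inl i)"
  then show "flat_anchor u = 0" by (metis flat_anchor_cov)
qed

lemma flat_pair_cov: "flat_pair (cov a) v = a \<bullet> flat_anchor v"
  by (simp add: flat_pair_def dup_inner)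

lemma flat_pair_form: "nondegenerate_form flat_pair"
proof
  show "bilinear flat_pair"
    by (simp add: bilinear_def linear_iff flat_pair_def linear_add[OF theta_linear] linear_cmul[OF theta_linear]
        inner_add_left inner_add_right)
  show "flat_pair u v = flat_pair v u" for u v :: "'a flat_fibre"
    using theta_adjoint[of u v] by (simp add: flat_pair_def inner_commute)
  show "u = 0" if "\<And>v. flat_pair u v = 0" for u :: "'a flat_fibre"
  proof -
    have "u \<bullet> u = 0" using that[of "\<theta> u"] by (simp add: flat_pair_def theta_inner)
    then show ?thesis by simp
  qed
qed

interpretation fp: nondegenerate_form "flat_pair :: 'n::finite flat_fibre \<Rightarrow> _" by (rule flat_pair_form)

lemma flat_pair_bounded: "bounded_bilinear (flat_pair :: 'n::finite flat_fibre \<Rightarrow> _)"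
  using fp.bil bilinear_conv_bounded_bilinear by blast

lemma inner_form: "nondegenerate_form ((\<bullet>) :: real^'k::finite \<Rightarrow> _)"
proof
  show "bilinear ((\<bullet>) :: real^'k \<Rightarrow> _)"
    by (simp add: bilinear_def linear_iff inner_add_left inner_add_right)
  show "u \<bullet> v = v \<bullet> u" for u v :: "real^'k" by (rule inner_commute)
  show "u = 0" if "\<And>v. u \<bullet> v = 0" for u :: "real^'k" using that[of u] by simp
qed

section \<open>Dorfman bracket and exactness of the flat model\<close>

definition flat_adj :: "(real^'n::finite \<Rightarrow> 'n flat_fibre) \<Rightarrow> (real^'n \<Rightarrow> 'n flat_fibre) \<Rightarrow> real^'n \<Rightarrow> 'n flat_fibre" where
  "flat_adj u v p = cov (\<chi> i. flat_pair (dd u p (axis i 1)) (v p))"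

text \<open>The Dorfman bracket with \<open>H = 0\<close> in a frame of constant sections, whose
  mutual brackets vanish; the last term is responsible for the failure of skew symmetry.\<close>

definition flat_dorfman :: "(real^'n::finite \<Rightarrow> 'n flat_fibre) \<Rightarrow> (real^'n \<Rightarrow> 'n flat_fibre) \<Rightarrow> real^'n \<Rightarrow> 'n flat_fibre" where
  "flat_dorfman u v p = dd v p (flat_anchor (u p)) - dd u p (flat_anchor (v p)) + flat_adj u v p"

definition flatC :: "(real^'n::finite, 'n, 'n + 'n) courant" where
  "flatC = \<lparr>atlas = flat_atlas, trivs = {(UNIV, \<lambda>p x. x)}, anchor = (\<lambda>p u. tv p (flat_anchor u)),
     pairing = (\<lambda>p. flat_pair), dorfman = flat_dorfman\<rparr>"

lemma flatC_simps [simp]: "atlas flatC = flat_atlas" "anchor flatC = (\<lambda>p u. tv p (flat_anchor u))"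
  "pairing flatC = (\<lambda>p. flat_pair)" "dorfman flatC = flat_dorfman"
  by (simp_all add: flatC_def)

lemma flat_sections: "sections flatC = {s. smooth_on UNIV s}"
  by (simp add: sections_def section_on_def flatC_def)

lemma flat_anchor_smooth: "smooth_on UNIV u \<Longrightarrow> smooth_on UNIV (\<lambda>p. flat_anchor (u p))"
  by (rule smooth_on_linear_compose[OF flat_anchor_linear open_UNIV])

lemma flat_pair_smooth: "smooth_on UNIV u \<Longrightarrow> smooth_on UNIV v \<Longrightarrow> smooth_on UNIV (\<lambda>p. flat_pair (u p) (v p))"
  by (rule bounded_bilinear.smooth_on_prod[OF flat_pair_bounded open_UNIV])

lemma dd_flat_pair:
  "smooth_on UNIV u \<Longrightarrow> smooth_on UNIV v \<Longrightarrow>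
    dd (\<lambda>p. flat_pair (u p) (v p)) p x = flat_pair (u p) (dd v p x) + flat_pair (dd u p x) (v p)"
  by (rule dd_bilinear[OF flat_pair_bounded])

lemma flat_adj_pairing:
  assumes "smooth_on UNIV u"
  shows "flat_pair (flat_adj u v p) w = flat_pair (dd u p (flat_anchor w)) (v p)"
proof -
  have "flat_pair (flat_adj u v p) w = (\<Sum>i\<in>UNIV. flat_pair (dd u p (axis i 1)) (v p) * flat_anchor w $ i)"
    by (simp add: flat_adj_def flat_pair_cov inner_vec_def)
  also have "\<dots> = flat_pair (dd u p (flat_anchor w)) (v p)"
    unfolding dd_expand[OF assms, of _ "flat_anchor w"] by (simp add: fp.sum_left fp.form_simps mult.commute)
  finally show ?thesis .
qed

lemma flat_adj_smooth:
  assumes "smooth_on UNIV u" "smooth_on UNIV v"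
  shows "smooth_on UNIV (flat_adj u v)"
  unfolding flat_adj_def[abs_def]
proof (rule smooth_on_linear_compose[OF linear_compose[OF dup_linear theta_linear, unfolded comp_def] open_UNIV])
  show "smooth_on UNIV (\<lambda>p. \<chi> i. flat_pair (dd u p (axis i 1)) (v p))"
    by (rule smooth_on_vec[OF open_UNIV]) (simp add: flat_pair_smooth smooth_on_frechet_derivative assms)
qed

lemma smooth_on_diff:
  assumes "open S" "smooth_on S f" "smooth_on S g"
  shows "smooth_on S (\<lambda>x. f x - g x)"
  using smooth_on_add[OF assms(1,2) smooth_on_scaleR[OF assms(1) smooth_on_const[of S "-1"] assms(3)]] by simp

lemma flat_dorfman_smooth: "smooth_on UNIV u \<Longrightarrow> smooth_on UNIV v \<Longrightarrow> smooth_on UNIV (flat_dorfman u v)"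
  unfolding flat_dorfman_def[abs_def] by (intro smooth_on_add smooth_on_diff smooth_dd flat_anchor_smooth flat_adj_smooth) auto

lemma flat_anchor_flat_dorfman: "flat_anchor (flat_dorfman u v p) = flat_anchor (dd v p (flat_anchor (u p))) - flat_anchor (dd u p (flat_anchor (v p)))"
  by (simp add: flat_dorfman_def linear_add[OF flat_anchor_linear] linear_diff[OF flat_anchor_linear] flat_adj_def)

lemma flat_dorfman_pairing:
  assumes "smooth_on UNIV u"
  shows "flat_pair (flat_dorfman u v p) t = flat_pair (dd v p (flat_anchor (u p))) t - flat_pair (dd u p (flat_anchor (v p))) t
    + flat_pair (dd u p (flat_anchor t)) (v p)"
  by (simp add: flat_dorfman_def fp.form_simps flat_adj_pairing[OF assms])

text \<open>Pairing with a constant \<open>t\<close> makes the bracket a real function. Directions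
  are frozen at \<open>p\<close>, so that the second derivatives appear in the form to which
  symmetry applies.\<close>

lemma dd_flat_dorfman_pairing:
  assumes v: "smooth_on UNIV v" and w: "smooth_on UNIV w"
  shows "flat_pair (dd (flat_dorfman v w) p x) t =
    flat_pair (dd (\<lambda>q. dd w q (flat_anchor (v p))) p x) t + flat_pair (dd w p (flat_anchor (dd v p x))) t
    - flat_pair (dd (\<lambda>q. dd v q (flat_anchor (w p))) p x) t - flat_pair (dd v p (flat_anchor (dd w p x))) t
    + flat_pair (dd (\<lambda>q. dd v q (flat_anchor t)) p x) (w p) + flat_pair (dd v p (flat_anchor t)) (dd w p x)"
proof -
  have 1: "dd (\<lambda>q. flat_pair (flat_dorfman v w q) t) p x = flat_pair (dd (flat_dorfman v w) p x) t"
    by (simp add: dd_flat_pair flat_dorfman_smooth v w smooth_on_const fp.form_simps)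
  have s: "smooth_on UNIV (\<lambda>q. dd w q (flat_anchor (v q)))" "smooth_on UNIV (\<lambda>q. dd v q (flat_anchor (w q)))"
    "smooth_on UNIV (\<lambda>q. dd v q (flat_anchor t))"
    by (intro smooth_dd flat_anchor_smooth v w smooth_on_const)+
  note h = dd_has_derivative[OF s(1), of p] dd_has_derivative[OF s(2), of p] dd_has_derivative[OF s(3), of p]
  have "((\<lambda>q. flat_pair (dd w q (flat_anchor (v q))) t - flat_pair (dd v q (flat_anchor (w q))) t + flat_pair (dd v q (flat_anchor t)) (w q))
      has_derivative (\<lambda>x. flat_pair (dd (\<lambda>q. dd w q (flat_anchor (v q))) p x) t - flat_pair (dd (\<lambda>q. dd v q (flat_anchor (w q))) p x) t
        + (flat_pair (dd v p (flat_anchor t)) (dd w p x) + flat_pair (dd (\<lambda>q. dd v q (flat_anchor t)) p x) (w p)))) (at p)"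
    by (intro has_derivative_add has_derivative_diff bounded_bilinear.FDERIV[OF flat_pair_bounded]
        bounded_linear.has_derivative[OF bounded_bilinear.bounded_linear_left[OF flat_pair_bounded]] h dd_has_derivative[OF w])
  from dd_eq[OF this, of x] have "dd (\<lambda>q. flat_pair (flat_dorfman v w q) t) p x =
      flat_pair (dd (\<lambda>q. dd w q (flat_anchor (v q))) p x) t - flat_pair (dd (\<lambda>q. dd v q (flat_anchor (w q))) p x) t
        + (flat_pair (dd v p (flat_anchor t)) (dd w p x) + flat_pair (dd (\<lambda>q. dd v q (flat_anchor t)) p x) (w p))"
    by (simp add: flat_dorfman_pairing[OF v])
  then show ?thesis
    unfolding 1 dd_dd[OF w flat_anchor_smooth[OF v]] dd_dd[OF v flat_anchor_smooth[OF w]]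
      dd_linear_compose[OF flat_anchor_linear v] dd_linear_compose[OF flat_anchor_linear w]
    by (simp add: fp.form_simps)
qed

text \<open>Against a constant \<open>t\<close> everything expands into products of first
  derivatives, which cancel algebraically, and second derivatives, which match by the six instances
  of symmetry in \<open>sym\<close>.\<close>

lemma flat_dorfman_jacobi:
  assumes u: "smooth_on UNIV u" and v: "smooth_on UNIV v" and w: "smooth_on UNIV w"
  shows "flat_dorfman u (flat_dorfman v w) p = flat_dorfman (flat_dorfman u v) w p + flat_dorfman v (flat_dorfman u w) p"
proof (rule fp.eqI)
  fix t
  note lin = linear_add[OF dd_linear[OF u]] linear_add[OF dd_linear[OF v]] linear_add[OF dd_linear[OF w]]
    linear_diff[OF dd_linear[OF u]] linear_diff[OF dd_linear[OF v]] linear_diff[OF dd_linear[OF w]]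
  have J: "flat_pair x (flat_dorfman u v p) = flat_pair (dd v p (flat_anchor (u p))) x - flat_pair (dd u p (flat_anchor (v p))) x
    + flat_pair (dd u p (flat_anchor x)) (v p)" if "smooth_on UNIV u" for x u v
    using flat_dorfman_pairing[OF that, of v p x] by (simp add: fp.sym)
  have sym: "dd (\<lambda>q. dd w q (flat_anchor (v p))) p (flat_anchor (u p)) = dd (\<lambda>q. dd w q (flat_anchor (u p))) p (flat_anchor (v p))"
    "dd (\<lambda>q. dd v q (flat_anchor (w p))) p (flat_anchor (u p)) = dd (\<lambda>q. dd v q (flat_anchor (u p))) p (flat_anchor (w p))"
    "dd (\<lambda>q. dd u q (flat_anchor (w p))) p (flat_anchor (v p)) = dd (\<lambda>q. dd u q (flat_anchor (v p))) p (flat_anchor (w p))"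
    "dd (\<lambda>q. dd v q (flat_anchor t)) p (flat_anchor (u p)) = dd (\<lambda>q. dd v q (flat_anchor (u p))) p (flat_anchor t)"
    "dd (\<lambda>q. dd u q (flat_anchor t)) p (flat_anchor (v p)) = dd (\<lambda>q. dd u q (flat_anchor (v p))) p (flat_anchor t)"
    "dd (\<lambda>q. dd u q (flat_anchor t)) p (flat_anchor (w p)) = dd (\<lambda>q. dd u q (flat_anchor (w p))) p (flat_anchor t)"
    using second_derivative_symmetric[OF open_UNIV u UNIV_I] second_derivative_symmetric[OF open_UNIV v UNIV_I]
      second_derivative_symmetric[OF open_UNIV w UNIV_I] by blast+
  show "flat_pair (flat_dorfman u (flat_dorfman v w) p) t = flat_pair (flat_dorfman (flat_dorfman u v) w p + flat_dorfman v (flat_dorfman u w) p) t"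
    using u v w
    by (simp add: flat_dorfman_pairing flat_dorfman_smooth dd_flat_dorfman_pairing fp.form_simps flat_anchor_flat_dorfman lin J sym)
      (simp add: fp.sym)
qed

lemma smooth_on_flat_fibre_comb:
  "smooth_on UNIV u \<Longrightarrow> smooth_on UNIV v \<Longrightarrow> smooth_on UNIV (\<lambda>p. a *\<^sub>R u p + b *\<^sub>R v p)"
  by (intro smooth_on_add smooth_on_scaleR smooth_on_const) auto

lemma dd_comb:
  assumes "smooth_on UNIV u" "smooth_on UNIV v"
  shows "dd (\<lambda>p. a *\<^sub>R u p + b *\<^sub>R v p) p x = a *\<^sub>R dd u p x + b *\<^sub>R dd v p x"
  by (rule dd_eq) (intro has_derivative_add has_derivative_scaleR_right dd_has_derivative assms)

lemma flat_dorfman_combination: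
  assumes "smooth_on UNIV u" "smooth_on UNIV v" "smooth_on UNIV w"
  shows "flat_dorfman (\<lambda>p. a *\<^sub>R u p + b *\<^sub>R v p) w p = a *\<^sub>R flat_dorfman u w p + b *\<^sub>R flat_dorfman v w p"
    "flat_dorfman w (\<lambda>p. a *\<^sub>R u p + b *\<^sub>R v p) p = a *\<^sub>R flat_dorfman w u p + b *\<^sub>R flat_dorfman w v p"
  by (rule fp.eqI; use assms in \<open>simp add: flat_dorfman_pairing smooth_on_flat_fibre_comb fp.form_simps dd_comb
      linear_add[OF flat_anchor_linear] linear_cmul[OF flat_anchor_linear] linear_add[OF dd_linear] linear_cmul[OF dd_linear] algebra_simps\<close>)+

lemma flat_courant: "courant_algebroid (flatC :: (real^'n::finite, 'n, 'n + 'n) courant)"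
proof -
  let ?C = "flatC :: (real^'n, 'n, 'n + 'n) courant"
  have vb: "vector_bundle ?C"
    unfolding vector_bundle_def using linear_id bij_id inv_ident
    by (simp add: flatC_def smooth_on_const id_def[symmetric])
  have sm: "smooth_metric ?C (pairing ?C)"
    unfolding smooth_metric_def using fp.bil fp.sym fp.nondeg by (auto simp: flat_sections flat_pair_smooth)
  have vf: "anchor_sec ?C u \<in> vector_fields (atlas ?C)" if "u \<in> sections ?C" for u
    unfolding flatC_simps flat_vector_fields using that by (simp add: anchor_sec_def flat_sections flat_anchor_smooth)
  have an: "linear (\<lambda>u. anchor ?C p u f)" for p f
    using tv_comb[of p 1 _ 1] tv_comb[of p _ _ 0 0]
    by (simp add: linear_iff linear_add[OF flat_anchor_linear] linear_cmul[OF flat_anchor_linear])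
  show ?thesis
    unfolding courant_algebroid_def
  proof (intro conjI ballI allI)
    show "smooth_atlas (atlas ?C)" by (simp add: flat_smooth_atlas)
    fix u v w :: "real^'n \<Rightarrow> 'n flat_fibre" and p
    assume "u \<in> sections ?C" "v \<in> sections ?C" "w \<in> sections ?C"
    then have s: "smooth_on UNIV u" "smooth_on UNIV v" "smooth_on UNIV w" by (simp_all add: flat_sections)
    show "dorfman ?C u (dorfman ?C v w) = (\<lambda>p. dorfman ?C (dorfman ?C u v) w p + dorfman ?C v (dorfman ?C u w) p)"
      using flat_dorfman_jacobi[OF s] by (intro ext) simp
    show "dorfman ?C (\<lambda>p. a *\<^sub>R u p + b *\<^sub>R v p) w = (\<lambda>p. a *\<^sub>R dorfman ?C u w p + b *\<^sub>R dorfman ?C v w p)" for a b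
      using flat_dorfman_combination(1)[OF s] by (intro ext) simp
    show "dorfman ?C w (\<lambda>p. a *\<^sub>R u p + b *\<^sub>R v p) = (\<lambda>p. a *\<^sub>R dorfman ?C w u p + b *\<^sub>R dorfman ?C w v p)" for a b
      using flat_dorfman_combination(2)[OF s] by (intro ext) simp
    have d: "anchor ?C p (u p) (\<lambda>q. pairing ?C q (v q) (w q)) =
        flat_pair (v p) (dd w p (flat_anchor (u p))) + flat_pair (dd v p (flat_anchor (u p))) (w p)"
      using s by (simp add: tv_smooth flat_pair_smooth dd_flat_pair)
    show "anchor ?C p (u p) (\<lambda>q. pairing ?C q (v q) (w q)) =
        pairing ?C p (dorfman ?C u v p) (w p) + pairing ?C p (v p) (dorfman ?C u w p)"
      unfolding d using flat_dorfman_pairing[OF s(1), of v p "w p"] flat_dorfman_pairing[OF s(1), of w p "v p"]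
      by (simp add: fp.sym)
    show "anchor ?C p (u p) (\<lambda>q. pairing ?C q (v q) (w q)) =
        pairing ?C p (u p) (dorfman ?C v w p + dorfman ?C w v p)"
      unfolding d using flat_dorfman_pairing[OF s(2), of w p "u p"] flat_dorfman_pairing[OF s(3), of v p "u p"]
      by (simp add: fp.sym fp.form_simps)
  qed (use vb sm vf an in \<open>auto simp: flat_tangent_space flat_sections flat_dorfman_smooth\<close>)
qed

lemma flat_exact: "exact_courant_algebroid (flatC :: (real^'n::finite, 'n, 'n + 'n) courant)"
  unfolding exact_courant_algebroid_def
proof (intro conjI allI flat_courant)
  fix p :: "real^'n"
  let ?C = "flatC :: (real^'n, 'n, 'n + 'n) courant"
  have surj: "flat_anchor (dup ((1/2) *\<^sub>R x)) = x" for x :: "real^'n" by simp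
  show "range (anchor ?C p) = tangent_space (atlas ?C) p"
    unfolding flatC_simps flat_tangent_space
  proof
    show "range (tv p) \<subseteq> range (\<lambda>u. tv p (flat_anchor u))" using surj by (metis image_subsetI rangeI)
  qed auto
  show "{u. anchor ?C p u = (\<lambda>f. 0)} =
      {u. \<exists>\<xi>\<in>cotangent_space (atlas ?C) p. \<forall>v. pairing ?C p u v = \<xi> (anchor ?C p v) / 2}"
  proof (intro set_eqI iffI; unfold mem_Collect_eq)
    fix u assume "anchor ?C p u = (\<lambda>f. 0)"
    then have "flat_anchor u = 0" by (simp add: tv_zero_iff)
    then obtain a where a: "u = cov a" unfolding flat_anchor_eq_0_iff by blast
    have "co (\<lambda>f. c * X f + d * Y f) = c *\<^sub>R co X + d *\<^sub>R co Y" for c d and X Y :: "(real^'n) tangent"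
      by (simp add: co_def vec_eq_iff)
    \<comment> \<open>The factor \<open>2\<close> is the normalisation of covectors, as
      \<open>flat_pair (cov a) v\<close> equals \<open>a \<bullet> flat_anchor v\<close>.\<close>
    then have "(\<lambda>X. 2 * (a \<bullet> co X)) \<in> cotangent_space (atlas ?C) p"
      by (simp add: cotangent_space_def inner_add_right algebra_simps)
    then show "\<exists>\<xi>\<in>cotangent_space (atlas ?C) p. \<forall>v. pairing ?C p u v = \<xi> (anchor ?C p v) / 2"
      by (rule bexI[rotated]) (simp add: a flat_pair_cov)
  next
    fix u assume "\<exists>\<xi>\<in>cotangent_space (atlas ?C) p. \<forall>v. pairing ?C p u v = \<xi> (anchor ?C p v) / 2"
    then obtain \<xi> where \<xi>: "\<xi> \<in> cotangent_space (atlas ?C) p" "\<And>v. flat_pair u v = \<xi> (tv p (flat_anchor v)) / 2" by auto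
    have t: "tv p 0 \<in> tangent_space (atlas ?C) p" by (simp add: flat_tangent_space)
    have "\<xi> (\<lambda>f. 0 * tv p 0 f + 0 * tv p 0 f) = 0 * \<xi> (tv p 0) + 0 * \<xi> (tv p 0)"
      using \<xi>(1) t unfolding cotangent_space_def by blast
    moreover have "tv p 0 = (\<lambda>f. 0)" by (simp add: tv_zero_iff)
    ultimately have "\<xi> (tv p 0) = 0" by simp
    \<comment> \<open>The test vector is a covector, so its anchor is zero, and its pairing with
      \<open>u\<close> is the squared length of \<open>flat_anchor u\<close>.\<close>
    then have "flat_pair u (cov (flat_anchor u)) = 0" using \<xi>(2)[of "cov (flat_anchor u)"] by simp
    then have "flat_anchor u \<bullet> flat_anchor u = 0" using flat_pair_cov[of "flat_anchor u" u] by (simp add: fp.sym)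
    then show "anchor ?C p u = (\<lambda>f. 0)" by (simp add: tv_zero_iff)
  qed
qed

lemma flat_metric: "generalised_metric (flatC :: (real^'n::finite, 'n, 'n + 'n) courant) (\<lambda>p. (\<bullet>))"
  and flat_endo: "metric_endo (flatC :: (real^'n::finite, 'n, 'n + 'n) courant) (\<lambda>p. (\<bullet>)) p u = \<theta> u"
proof -
  let ?C = "flatC :: (real^'n, 'n, 'n + 'n) courant"
  show e: "metric_endo ?C (\<lambda>p. (\<bullet>)) p u = \<theta> u" for p u
    unfolding metric_endo_def
  proof (rule the_equality)
    show "\<forall>v. pairing ?C p (\<theta> u) v = u \<bullet> v" by (simp add: flat_pair_def)
    show "w = \<theta> u" if "\<forall>v. pairing ?C p w v = u \<bullet> v" for w
      by (rule fp.eqI) (use that in \<open>simp add: flat_pair_def\<close>)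
  qed
  interpret i: nondegenerate_form "(\<bullet>) :: 'n flat_fibre \<Rightarrow> _" by (rule inner_form)
  have "smooth_metric ?C (\<lambda>p. (\<bullet>))"
    unfolding smooth_metric_def using i.bil i.sym i.nondeg
    by (auto simp: flat_sections intro: bounded_bilinear.smooth_on_prod[OF bounded_bilinear_inner])
  then show "generalised_metric ?C (\<lambda>p. (\<bullet>))"
    unfolding generalised_metric_def by (auto simp: e)
qed

subsection \<open>A canonical connection with non-zero curvature\<close>

abbreviation flatG :: "(real^'n::finite, 'n + 'n) form" where "flatG \<equiv> (\<lambda>p. (\<bullet>))"

interpretation fl: generalised_metric_alg "flatC :: (real^'n::finite, 'n, 'n + 'n) courant" flatG
  by unfold_locales (rule flat_courant flat_exact flat_metric)+

interpretation ft: orthogonal_involution "flat_pair :: 'n::finite flat_fibre \<Rightarrow> _" \<theta>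
  unfolding orthogonal_involution_def orthogonal_involution_axioms_def
  using flat_pair_form theta_linear by (auto simp: flat_pair_def theta_adjoint)

lemma flat_endo_fun: "metric_endo flatC flatG p = \<theta>"
  by (rule ext) (rule flat_endo)

lemma flat_proj: "proj flatC flatG \<epsilon> p u = ft.eproj \<epsilon> u"
  by (simp add: proj_def ft.eproj_def flat_endo)

lemma flat_eig: "fl.invol.eig p \<epsilon> = ft.eig \<epsilon>"
  by (simp add: fl.invol.eig_def ft.eig_def flat_endo)

lemma flat_lift: "\<epsilon> \<in> {1, -1} \<Longrightarrow> lift flatC flatG \<epsilon> p (tv p (flat_anchor (ft.eproj \<epsilon> u))) = ft.eproj \<epsilon> u"
  by (rule fl.lift_eqI) (simp_all add: flat_eig ft.eproj_in_eig)

lemma flat_base_metric: "base_metric flatC flatG p (tv p x) (tv p y) = x \<bullet> y"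
proof -
  \<comment> \<open>This places \<open>x\<close> in \<open>E_+\<close> with no component in
    \<open>E_-\<close>: it is the lift of the tangent vector.\<close>
  let ?l = "\<lambda>x :: real^'n. (1/2) *\<^sub>R (dup x + cov x)"
  have "?l x \<in> fl.invol.eig p 1" for x
    by (simp add: flat_eig ft.eig_def linear_cmul[OF theta_linear] linear_add[OF theta_linear] add.commute)
  then have "base_metric flatC flatG p (anchor flatC p (?l x)) (anchor flatC p (?l y)) = ?l x \<bullet> ?l y"
    by (intro fl.base_metric_eq) auto
  moreover have "anchor flatC p (?l x) = tv p x" for x
    by (simp add: linear_cmul[OF flat_anchor_linear] linear_add[OF flat_anchor_linear])
  moreover have "?l x \<bullet> ?l y = x \<bullet> y"
    using dup_inner[of y "cov x"]
    by (simp add: inner_add_left inner_add_right dup_inner theta_inner inner_commute[of "cov x" "dup y"])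
  ultimately show ?thesis by (simp only:)
qed

lemma eproj_smooth: "smooth_on UNIV u \<Longrightarrow> smooth_on UNIV (\<lambda>p. ft.eproj \<epsilon> (u p))"
  by (rule smooth_on_linear_compose[OF ft.linear_eproj open_UNIV])

lemma dd_eproj: "smooth_on UNIV u \<Longrightarrow> dd (\<lambda>p. ft.eproj \<epsilon> (u p)) p x = ft.eproj \<epsilon> (dd u p x)"
  by (rule dd_linear_compose[OF ft.linear_eproj])

text \<open>The two bracket terms that differentiate \<open>u\<close> pair values in opposite
  eigenbundles and vanish.\<close>

lemma eproj_flat_dorfman_mixed:
  fixes u v :: "real^'n::finite \<Rightarrow> 'n flat_fibre"
  assumes \<epsilon>: "\<epsilon> \<in> {1, -1}" and u: "smooth_on UNIV u" and v: "smooth_on UNIV v"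
  shows "ft.eproj (-\<epsilon>) (flat_dorfman (\<lambda>p. ft.eproj \<epsilon> (u p)) (\<lambda>p. ft.eproj (-\<epsilon>) (v p)) p) =
    ft.eproj (-\<epsilon>) (dd v p (flat_anchor (ft.eproj \<epsilon> (u p))))"
proof (rule fp.eqI)
  fix w :: "'n flat_fibre"
  have m: "- \<epsilon> \<in> {1, -1}" using \<epsilon> by auto
  have z: "flat_pair (ft.eproj \<epsilon> x) (ft.eproj (-\<epsilon>) y) = 0" for x y
    by (rule ft.eig_orthogonal[OF \<epsilon> ft.eproj_in_eig[OF \<epsilon>] ft.eproj_in_eig[OF m]])
  have id: "flat_pair (ft.eproj (-\<epsilon>) x) (ft.eproj (-\<epsilon>) w) = flat_pair (ft.eproj (-\<epsilon>) x) w" for x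
    using ft.eproj_adjoint[of "-\<epsilon>" "ft.eproj (-\<epsilon>) x" w]
    by (simp add: ft.eproj_id[OF m ft.eproj_in_eig[OF m]])
  show "flat_pair (ft.eproj (-\<epsilon>) (flat_dorfman (\<lambda>p. ft.eproj \<epsilon> (u p)) (\<lambda>p. ft.eproj (-\<epsilon>) (v p)) p)) w =
      flat_pair (ft.eproj (-\<epsilon>) (dd v p (flat_anchor (ft.eproj \<epsilon> (u p))))) w"
    using id by (simp add: ft.eproj_adjoint[of "-\<epsilon>" "flat_dorfman _ _ _" w] flat_dorfman_pairing[OF eproj_smooth[OF u]] dd_eproj u v z)
qed

text \<open>On equal eigenbundles the Levi-Civita part, and on opposite ones the bracket part, is
  the componentwise derivative; summing over the projections of \<open>u\<close> and
  \<open>v\<close> recovers it entirely.\<close>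

lemma flat_pre_connection:
  assumes u: "smooth_on UNIV u" and v: "smooth_on UNIV v"
  shows "pre_connection flatC flatG flat_nabla u v p = dd v p (flat_anchor (u p))"
proof -
  let ?P = "ft.eproj"
  have N: "flat_nabla (anchor_sec flatC (proj_sec flatC flatG \<epsilon> u)) (anchor_sec flatC (proj_sec flatC flatG \<epsilon> v)) p =
      tv p (flat_anchor (?P \<epsilon> (dd v p (flat_anchor (?P \<epsilon> (u p))))))" for \<epsilon>
    by (simp add: flat_nabla_def anchor_sec_def proj_sec_def flat_proj
        dd_linear_compose[OF flat_anchor_linear eproj_smooth[OF v]] dd_eproj[OF v])
  have mixed: "proj flatC flatG (-\<epsilon>) p (flat_dorfman (proj_sec flatC flatG \<epsilon> u) (proj_sec flatC flatG (-\<epsilon>) v) p) =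
      ?P (-\<epsilon>) (dd v p (flat_anchor (?P \<epsilon> (u p))))" if "\<epsilon> \<in> {1, -1}" for \<epsilon>
    using eproj_flat_dorfman_mixed[OF that u v, of p] by (simp add: flat_proj proj_sec_def)
  have "pre_connection flatC flatG flat_nabla u v p =
      (\<Sum>\<epsilon>\<in>{1, -1}. ?P \<epsilon> (dd v p (flat_anchor (?P \<epsilon> (u p)))) + ?P (-\<epsilon>) (dd v p (flat_anchor (?P \<epsilon> (u p)))))"
    unfolding pre_connection_def N using mixed flat_lift by (intro sum.cong) simp_all
  also have "\<dots> = (\<Sum>\<epsilon>\<in>{1, -1}. dd v p (flat_anchor (?P \<epsilon> (u p))))"
    using ft.eproj_sum by (intro sum.cong) auto
  also have "\<dots> = dd v p (flat_anchor (?P 1 (u p) + ?P (-1) (u p)))"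
    by (simp add: linear_add[OF dd_linear[OF v]] linear_add[OF flat_anchor_linear])
  finally show ?thesis using ft.eproj_sum[of 1 "u p"] by simp
qed

definition flat_deriv :: "(real^'n::finite, 'n + 'n) conn" where
  "flat_deriv u v = (\<lambda>p. dd v p (flat_anchor (u p)))"

lemma flat_deriv_smooth: "smooth_on UNIV u \<Longrightarrow> smooth_on UNIV v \<Longrightarrow> smooth_on UNIV (flat_deriv u v)"
  unfolding flat_deriv_def by (intro smooth_dd flat_anchor_smooth)

text \<open>The derivative of \<open>u\<close> in the bracket is exactly what the last torsion term
  adds back. Hence the correction by a third of the torsion is zero and \<open>flat_deriv\<close> is
  itself the base connection.\<close>

lemma flat_deriv_torsion:
  assumes "smooth_on UNIV u" "smooth_on UNIV v" "smooth_on UNIV w"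
  shows "torsion flatC flat_deriv u v w p = 0"
  by (simp add: torsion_def flat_deriv_def fp.form_simps flat_dorfman_pairing[OF assms(1)])

lemma flat_base_connection:
  "base_connection (flatC :: (real^'n::finite, 'n, 'n + 'n) courant) flatG flat_deriv"
  unfolding base_connection_def
proof (intro exI conjI ballI allI)
  show "levi_civita (atlas flatC) (base_metric flatC flatG) (flat_nabla :: (real^'n) vfield \<Rightarrow> _)"
    unfolding flatC_simps by (rule flat_levi_civita) (rule flat_base_metric)
  fix u v w :: "real^'n \<Rightarrow> 'n flat_fibre" and p
  assume "u \<in> sections flatC" "v \<in> sections flatC"
  then have uv: "smooth_on UNIV u" "smooth_on UNIV v" by (simp_all add: flat_sections)
  then show "flat_deriv u v \<in> sections flatC" by (simp add: flat_sections flat_deriv_smooth)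
  assume "w \<in> sections flatC"
  then have w: "smooth_on UNIV w" by (simp add: flat_sections)
  have "torsion flatC (pre_connection flatC flatG flat_nabla) u v w p = torsion flatC flat_deriv u v w p"
    using uv w by (simp add: torsion_def flat_pre_connection flat_deriv_def)
  then show "pairing flatC p (flat_deriv u v p) (w p) =
      pairing flatC p (pre_connection flatC flatG flat_nabla u v p) (w p)
        - 1/3 * torsion flatC (pre_connection flatC flatG flat_nabla) u v w p"
    using uv w by (simp add: flat_deriv_torsion flat_pre_connection flat_deriv_def)
qed

section \<open>The connection twisted by a pure-trace tensor\<close>

context
  fixes \<tau> :: "'n::finite flat_fibre"
  assumes \<tau>: "\<tau> \<in> ft.eig 1"
begin

abbreviation "twist \<equiv> ft.pure_trace 1 \<tau>"

definition twisted_conn :: "(real^'n, 'n + 'n) conn" where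
  "twisted_conn u v = (\<lambda>p. flat_deriv u v p + twist (u p) (v p))"

lemma twist_prolongation: "ft.prolongation twist"
  by (rule ft.prolongation_pure_trace[OF _ \<tau>]) simp

lemma twist_bilinear: "bilinear twist" and twist_skew: "flat_pair (twist x y) z = - flat_pair y (twist x z)"
  and twist_cyc: "flat_pair (twist x y) z + flat_pair (twist y z) x + flat_pair (twist z x) y = 0"
  using twist_prolongation unfolding ft.prolongation_def by blast+

lemmas twist_simps = bilinear_ladd[OF twist_bilinear] bilinear_radd[OF twist_bilinear] bilinear_lmul[OF twist_bilinear]
  bilinear_rmul[OF twist_bilinear]

text \<open>The values of \<open>twist\<close> lie in \<open>E_+\<close>, where the Euclidean metric
  and the scalar product coincide. This is what makes \<open>twisted_conn\<close> compatible with
  \<open>G\<close>.\<close>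

lemma twist_inner_skew: "twist x y \<bullet> z = - (y \<bullet> twist x z)"
proof -
  have e: "w \<bullet> z = flat_pair w z" if "w \<in> ft.eig 1" for w z
    using that by (simp add: ft.eig_def flat_pair_def)
  show ?thesis
    using e[OF \<tau>] e[OF ft.eproj_in_eig[of 1 x]]
    by (simp add: ft.pure_trace_def inner_diff_left inner_diff_right inner_commute[of y])
qed

lemma twist_smooth: "smooth_on UNIV u \<Longrightarrow> smooth_on UNIV v \<Longrightarrow> smooth_on UNIV (\<lambda>p. twist (u p) (v p))"
  using twist_bilinear unfolding bilinear_conv_bounded_bilinear by (rule bounded_bilinear.smooth_on_prod) simp_all

lemma twisted_conn_connection: "generalised_connection flatC twisted_conn"
  unfolding generalised_connection_def flat_sections mem_Collect_eq flatC_simps flat_mfd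
proof (intro conjI ballI allI impI; (elim CollectE conjE)?)
  fix u v w :: "real^'n \<Rightarrow> 'n flat_fibre" and p a b
  assume s: "smooth_on UNIV u" "smooth_on UNIV v"
  then show "smooth_on UNIV (twisted_conn u v)"
    unfolding twisted_conn_def by (intro smooth_on_add flat_deriv_smooth twist_smooth) auto
  assume w: "smooth_on UNIV w"
  show "twisted_conn (\<lambda>p. a *\<^sub>R u p + b *\<^sub>R v p) w = (\<lambda>p. a *\<^sub>R twisted_conn u w p + b *\<^sub>R twisted_conn v w p)"
    by (simp add: twisted_conn_def flat_deriv_def twist_simps linear_add[OF flat_anchor_linear] linear_cmul[OF flat_anchor_linear]
        linear_add[OF dd_linear[OF w]] linear_cmul[OF dd_linear[OF w]] algebra_simps)
  show "twisted_conn w (\<lambda>p. a *\<^sub>R u p + b *\<^sub>R v p) = (\<lambda>p. a *\<^sub>R twisted_conn w u p + b *\<^sub>R twisted_conn w v p)"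
    by (simp add: twisted_conn_def flat_deriv_def twist_simps dd_comb s algebra_simps)
  show "tv p (flat_anchor (u p)) (\<lambda>q. flat_pair (v q) (w q)) = flat_pair (twisted_conn u v p) (w p) + flat_pair (v p) (twisted_conn u w p)"
    using twist_skew[of "u p" "v p" "w p"]
    by (simp add: twisted_conn_def flat_deriv_def tv_smooth flat_pair_smooth s w dd_flat_pair fp.form_simps)
next
  fix h :: "real^'n \<Rightarrow> real" and u v :: "real^'n \<Rightarrow> 'n flat_fibre"
  assume s: "smooth_on UNIV h" "smooth_on UNIV u" "smooth_on UNIV v"
  show "twisted_conn (\<lambda>p. h p *\<^sub>R u p) v = (\<lambda>p. h p *\<^sub>R twisted_conn u v p)"
    by (simp add: twisted_conn_def flat_deriv_def twist_simps linear_cmul[OF flat_anchor_linear] linear_cmul[OF dd_linear[OF s(3)]] algebra_simps)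
  show "twisted_conn u (\<lambda>p. h p *\<^sub>R v p) = (\<lambda>p. tv p (flat_anchor (u p)) h *\<^sub>R v p + h p *\<^sub>R twisted_conn u v p)"
    by (simp add: twisted_conn_def flat_deriv_def twist_simps dd_bilinear[OF bounded_bilinear_scaleR s(1,3)] tv_smooth[OF s(1)]
        algebra_simps)
qed

lemma twisted_conn_levi_civita: "generalised_levi_civita flatC flatG twisted_conn"
  unfolding generalised_levi_civita_def
proof (intro conjI twisted_conn_connection ballI allI)
  show "metric_connection flatC flatG twisted_conn"
    unfolding metric_connection_def flat_sections
  proof (intro ballI allI; elim CollectE)
    fix u v w :: "real^'n \<Rightarrow> 'n flat_fibre" and p
    assume s: "smooth_on UNIV u" "smooth_on UNIV v" "smooth_on UNIV w"
    have "smooth_on UNIV (\<lambda>q. v q \<bullet> w q)"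
      by (intro bounded_bilinear.smooth_on_prod[OF bounded_bilinear_inner] s) simp
    then show "anchor flatC p (u p) (\<lambda>q. v q \<bullet> w q) = twisted_conn u v p \<bullet> w p + v p \<bullet> twisted_conn u w p"
      using twist_inner_skew[of "u p" "v p" "w p"]
      by (simp add: twisted_conn_def flat_deriv_def tv_smooth dd_bilinear[OF bounded_bilinear_inner s(2,3)]
          inner_add_left inner_add_right)
  qed
  fix u v w :: "real^'n \<Rightarrow> 'n flat_fibre" and p
  assume "u \<in> sections flatC" "v \<in> sections flatC" "w \<in> sections flatC"
  then have s: "smooth_on UNIV u" "smooth_on UNIV v" "smooth_on UNIV w" by (simp_all add: flat_sections)
  have "torsion flatC twisted_conn u v w p = torsion flatC flat_deriv u v w p
      + (flat_pair (twist (u p) (v p)) (w p) - flat_pair (twist (v p) (u p)) (w p) + flat_pair (twist (w p) (u p)) (v p))"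
    by (simp add: torsion_def twisted_conn_def fp.form_simps)
  also have "\<dots> = 0"
    using flat_deriv_torsion[OF s] twist_skew[of "v p" "u p" "w p"] twist_cyc[of "u p" "v p" "w p"]
    by (simp add: fp.sym[of "u p"])
  finally show "torsion flatC twisted_conn u v w p = 0" .
qed

lemma twisted_conn_torsion_free: "torsion_free_connection flatC twisted_conn"
  using twisted_conn_levi_civita by unfold_locales (simp_all add: generalised_levi_civita_def)

interpretation twisted_conn: torsion_free_connection flatC twisted_conn
  by (rule twisted_conn_torsion_free)

text \<open>Taken from \<open>twisted_conn\<close> itself, so the divergence condition holds by
  definition and what has to be checked are the axioms of a divergence operator.\<close>

definition flat_div :: "(real^'n, 'n + 'n) sect \<Rightarrow> real^'n \<Rightarrow> real" where
  "flat_div v p = endo_trace (\<lambda>x. conn_at flatC twisted_conn p x v)"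

lemma twisted_conn_conn_at:
  assumes "smooth_on UNIV v"
  shows "conn_at flatC twisted_conn p x v = dd v p (flat_anchor x) + twist x (v p)"
  using twisted_conn.conn_at_eq[of "\<lambda>_. x" v p] assms
  by (simp add: flat_sections smooth_on_const twisted_conn_def flat_deriv_def)

lemma flat_div_eq:
  assumes "smooth_on UNIV v"
  shows "flat_div v p = (\<Sum>I\<in>UNIV. dd v p (flat_anchor (axis I 1)) $ I + twist (axis I 1) (v p) $ I)"
  by (simp add: flat_div_def twisted_conn_conn_at[OF assms] endo_trace_def trace_def matrix_def)

lemma flat_divergence_operator: "divergence_operator flatC flat_div"
  unfolding divergence_operator_def flat_sections flatC_simps flat_mfd
proof (intro conjI ballI allI impI; (elim CollectE conjE)?)
  fix u v :: "real^'n \<Rightarrow> 'n flat_fibre" and a b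
  assume v: "smooth_on UNIV v"
  have "smooth_on UNIV (\<lambda>p. \<Sum>I\<in>UNIV. dd v p (flat_anchor (axis I 1)) $ I + twist (axis I 1) (v p) $ I)"
    by (intro smooth_on_sum smooth_on_add smooth_on_vec_nth smooth_on_frechet_derivative twist_smooth smooth_on_const v) simp_all
  then show "smooth_on UNIV (flat_div v)"
    by (rule smooth_on_cong[OF open_UNIV]) (simp add: flat_div_eq[OF v])
  assume u: "smooth_on UNIV u"
  show "flat_div (\<lambda>p. a *\<^sub>R u p + b *\<^sub>R v p) = (\<lambda>p. a * flat_div u p + b * flat_div v p)"
    using u v by (intro ext) (simp add: flat_div_eq smooth_on_flat_fibre_comb dd_comb twist_simps sum.distrib sum_distrib_left algebra_simps)
next
  fix h :: "real^'n \<Rightarrow> real" and v :: "real^'n \<Rightarrow> 'n flat_fibre"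
  assume h: "smooth_on UNIV h" and v: "smooth_on UNIV v"
  have hv: "smooth_on UNIV (\<lambda>p. h p *\<^sub>R v p)" by (intro smooth_on_scaleR h v) simp
  show "flat_div (\<lambda>p. h p *\<^sub>R v p) = (\<lambda>p. tv p (flat_anchor (v p)) h + h p * flat_div v p)"
  proof
    fix p
    have "dd h p (flat_anchor (v p)) = dd h p (flat_anchor (\<Sum>I\<in>UNIV. v p $ I *\<^sub>R std_basis I))" by (simp only: std_basis_expansion)
    also have "\<dots> = (\<Sum>I\<in>UNIV. dd h p (flat_anchor (axis I 1)) * v p $ I)"
      by (simp add: linear_sum[OF flat_anchor_linear] linear_cmul[OF flat_anchor_linear] linear_sum[OF dd_linear[OF h]]
          linear_cmul[OF dd_linear[OF h]] std_basis_def mult.commute)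
    finally show "flat_div (\<lambda>p. h p *\<^sub>R v p) p = tv p (flat_anchor (v p)) h + h p * flat_div v p"
      by (simp add: flat_div_eq[OF hv] flat_div_eq[OF v] dd_bilinear[OF bounded_bilinear_scaleR h v] twist_simps
          tv_smooth[OF h] sum.distrib sum_distrib_left algebra_simps)
  qed
qed

lemma twisted_conn_canonical: "canonical_connection flatC flatG flat_div twisted_conn"
  unfolding canonical_connection_def
proof (intro conjI twisted_conn_levi_civita exI allI ballI)
  show "has_divergence flatC twisted_conn flat_div" by (simp add: has_divergence_def flat_div_def)
  show "base_connection flatC flatG (flat_deriv :: (real^'n, 'n + 'n) conn)" by (rule flat_base_connection)
  show "bilinear twist" by (rule twist_bilinear)
  show "twisted_conn u v p - flat_deriv u v p = twist (u p) (v p)" for u v p by (simp add: twisted_conn_def)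
  fix p and K :: "'n flat_fibre \<Rightarrow> 'n flat_fibre \<Rightarrow> 'n flat_fibre"
  assume "K \<in> trace_kernel flatC flatG p"
  then have K: "ft.prolongation K" "\<And>v. endo_trace (\<lambda>u. K u v) = 0"
    by (simp_all add: trace_kernel_def fl.so_prolong_eq flat_endo_fun)
  have Kb: "bilinear K" using K(1) by (simp add: ft.prolongation_def)
  let ?\<beta> = "\<lambda>a a' b b'. flat_pair (K a b) (twist a' b')"
  have b2: "bilinear (?\<beta> a a')" for a a'
    using Kb twist_bilinear by (simp add: bilinear_def linear_iff fp.form_simps)
  have b1: "bilinear (\<lambda>a a'. fp.ctr (?\<beta> a a'))"
    using Kb twist_bilinear by (simp add: bilinear_def linear_iff fp.form_simps fp.ctr_add fp.ctr_cmul)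
  \<comment> \<open>\<open>ctr_pure_trace\<close> has the pure-trace tensor in the second place; two
    flips bring it there.\<close>
  have "tensor_pairing flatC p twist K = fp.ctr (\<lambda>a a'. fp.ctr (\<lambda>b b'. ?\<beta> a' a b' b))"
    by (simp add: fl.tensor_pairing_eq fp.sym[of "twist _ _"])
  also have "\<dots> = fp.ctr (\<lambda>a a'. fp.ctr (?\<beta> a' a))" by (simp only: fp.ctr_flip[OF b2])
  also have "\<dots> = fp.ctr (\<lambda>a a'. fp.ctr (?\<beta> a a'))" by (rule fp.ctr_flip[OF b1])
  also have "\<dots> = - 2 * endo_trace (\<lambda>a. K a \<tau>)" by (rule ft.ctr_pure_trace[OF K(1) _ \<tau>]) simp
  finally show "tensor_pairing flatC p twist K = 0" by (simp add: K(2))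
qed

lemma flat_data: "kretschmann_data flatC flatG flat_div twisted_conn"
  unfolding kretschmann_data_def by (intro conjI flat_exact flat_metric flat_divergence_operator twisted_conn_canonical)

text \<open>By tensoriality constant sections may be inserted. Their derivatives vanish, so the
  connection acts on them algebraically through \<open>twist\<close>.\<close>

lemma twisted_conn_riemann_const:
  "riemann_at flatC twisted_conn p a b v w = 1/2 * (flat_pair (twist v (twist w b) - twist (twist v w) b - (twist w (twist v b) - twist (twist w v) b)) a
     + flat_pair (twist b (twist a v) - twist (twist b a) v - (twist a (twist b v) - twist (twist a b) v)) w
     - fp.ctr (\<lambda>x y. flat_pair (twist x v) w * flat_pair (twist y b) a))"
proof -
  have c: "twisted_conn (\<lambda>_. x) (\<lambda>_. y) = (\<lambda>_. twist x y)" for x y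
    by (rule ext) (simp add: twisted_conn_def flat_deriv_def)
  show ?thesis
    using twisted_conn.riemann_at_eq[of "\<lambda>_. a" "\<lambda>_. b" "\<lambda>_. v" "\<lambda>_. w" p]
    by (simp add: flat_sections smooth_on_const twisted_conn.riemann_eq_ctr second_deriv_def c twisted_conn_conn_at)
qed

end

section \<open>Positivity and a non-zero curvature component\<close>

lemma inner_dual_basis: "dual_basis (\<bullet>) std_basis i = (std_basis i :: real^'k::finite)"
proof -
  have "((\<chi> i j. (std_basis i :: real^'k) \<bullet> std_basis j) :: real^'k^'k) = mat 1"
    by (simp add: vec_eq_iff mat_def std_basis_def inner_axis_axis)
  moreover have "matrix_inv (mat 1 :: real^'k^'k) = mat 1"
    using matrix_inv_invertible(1)[of "mat 1 :: real^'k^'k"] by (simp add: invertible_def matrix_mul_lid exI[of _ "mat 1"])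
  ultimately show ?thesis
    by (simp add: dual_basis_def gram_inv_def mat_def if_distrib[of "\<lambda>c. c *\<^sub>R _"] cong: if_cong)
qed

lemma inner_square4_pos:
  fixes R :: "real^'k::finite \<Rightarrow> real^'k \<Rightarrow> real^'k \<Rightarrow> real^'k \<Rightarrow> real"
  assumes "R (std_basis i) (std_basis j) (std_basis k) (std_basis l) \<noteq> 0"
  shows "nondegenerate_form.square4 (\<bullet>) R > 0"
proof -
  interpret i: nondegenerate_form "(\<bullet>) :: real^'k \<Rightarrow> _" by (rule inner_form)
  let ?R = "\<lambda>i j k l. R (std_basis i) (std_basis j) (std_basis k) (std_basis l)"
  have "0 < ?R i j k l * ?R i j k l" using assms by (simp add: zero_less_mult_iff) linarith
  also have "\<dots> \<le> (\<Sum>l\<in>UNIV. ?R i j k l * ?R i j k l)"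
    by (rule member_le_sum[of l UNIV "\<lambda>l. ?R i j k l * ?R i j k l"]) auto
  also have "\<dots> \<le> (\<Sum>k\<in>UNIV. \<Sum>l\<in>UNIV. ?R i j k l * ?R i j k l)"
    by (rule member_le_sum[of k UNIV "\<lambda>k. \<Sum>l\<in>UNIV. ?R i j k l * ?R i j k l"]) (auto intro: sum_nonneg)
  also have "\<dots> \<le> (\<Sum>j\<in>UNIV. \<Sum>k\<in>UNIV. \<Sum>l\<in>UNIV. ?R i j k l * ?R i j k l)"
    by (rule member_le_sum[of j UNIV "\<lambda>j. \<Sum>k\<in>UNIV. \<Sum>l\<in>UNIV. ?R i j k l * ?R i j k l"]) (auto intro!: sum_nonneg)
  also have "\<dots> \<le> (\<Sum>i\<in>UNIV. \<Sum>j\<in>UNIV. \<Sum>k\<in>UNIV. \<Sum>l\<in>UNIV. ?R i j k l * ?R i j k l)"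
    by (rule member_le_sum[of i UNIV "\<lambda>i. \<Sum>j\<in>UNIV. \<Sum>k\<in>UNIV. \<Sum>l\<in>UNIV. ?R i j k l * ?R i j k l"]) (auto intro!: sum_nonneg)
  also have "\<dots> = i.square4 R" by (simp add: i.square4_def i.ctr_def inner_dual_basis)
  finally show ?thesis .
qed

lemma flat_kretschmann_nonzero:
  assumes dim: "CARD('n::finite) \<ge> 2"
  shows "\<exists>(C :: (real^'n, 'n, 'n + 'n) courant) G dv D. kretschmann_data C G dv D \<and> (\<exists>p. kretschmann C G D p \<noteq> 0)"
proof -
  \<comment> \<open>Two distinct directions give orthonormal \<open>e1\<close> and \<open>e2\<close>
    in \<open>E_+\<close>. In dimension one \<open>pure_trace\<close> would be the wedge of two
    vectors on a line, hence zero.\<close>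
  obtain i j :: 'n where ij: "i \<noteq> j"
    using dim card_le_Suc0_iff_eq[of "UNIV :: 'n set"] by fastforce
  define e1 e2 :: "'n flat_fibre" where "e1 = std_basis (Inl i)" and "e2 = std_basis (Inl j)"
  have eig: "e1 \<in> ft.eig 1" "e2 \<in> ft.eig 1"
    by (simp_all add: e1_def e2_def ft.eig_def \<theta>_def std_basis_def axis_def vec_eq_iff split: sum.split)
  have P: "ft.eproj 1 e1 = e1" "ft.eproj 1 e2 = e2" using ft.eproj_id[OF _ eig(1)] ft.eproj_id[OF _ eig(2)] by simp_all
  have pr: "flat_pair e1 e1 = 1" "flat_pair e2 e2 = 1" "flat_pair e1 e2 = 0" "flat_pair e2 e1 = 0"
    using eig ij by (simp_all add: flat_pair_def ft.eig_def) (simp_all add: e1_def e2_def std_basis_def inner_axis_axis)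
  let ?S = "ft.pure_trace 1 e1"
  have S: "?S e1 e1 = 0" "?S e1 e2 = 0" "?S e2 e1 = - e2" "?S e2 e2 = e1" "?S e1 0 = 0" "?S 0 e1 = 0" "?S 0 e2 = 0" "?S e2 0 = 0"
    "?S e1 (- e2) = 0" "?S (- e2) e1 = e2" "?S (- e2) e2 = - e1"
    by (simp_all add: ft.pure_trace_def P pr fp.form_simps linear_0[OF ft.linear_eproj] linear_neg[OF ft.linear_eproj])
  have x: "flat_pair (?S x e1) e2 = - flat_pair e2 x" "flat_pair (?S x e2) e1 = flat_pair e2 x" for x
    using ft.eproj_adjoint[of 1 x e2] P by (simp_all add: ft.pure_trace_def fp.form_simps pr fp.sym[of e2 x])
  \<comment> \<open>Both factors are multiples of \<open>flat_pair e2\<close>, so the contraction is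
    \<open>- flat_pair e2 e2\<close>.\<close>
  have "fp.ctr (\<lambda>x y. flat_pair (?S x e1) e2 * flat_pair (?S y e2) e1) = - 1"
    using fp.ctr_cmul[of "-1" "\<lambda>x y. flat_pair e2 x * flat_pair e2 y"] by (simp add: x fp.ctr_elementary pr)
  \<comment> \<open>Each of the two second-derivative terms contributes \<open>-1\<close>, and so
    does the contraction that is subtracted: \<open>(-1 - 1 + 1) / 2\<close>.\<close>
  then have "riemann_at flatC (twisted_conn e1) 0 e1 e2 e1 e2 = - 1/2"
    by (simp add: twisted_conn_riemann_const[OF eig(1)] S fp.form_simps pr)
  then have "nondegenerate_form.square4 (\<bullet>) (riemann_at flatC (twisted_conn e1) 0) > 0"
    unfolding e1_def e2_def by (intro inner_square4_pos[of _ "Inl i" "Inl j" "Inl i" "Inl j"]) simp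
  then have "kretschmann flatC flatG (twisted_conn e1) 0 \<noteq> 0"
    using torsion_free_connection.kretschmann_eq[OF twisted_conn_torsion_free[OF eig(1)], of flatG 0, OF inner_form] by simp
  with flat_data[OF eig(1)] show ?thesis by blast
qed

theorem proposition4p6:
  assumes dim: "CARD('n::finite) \<ge> 2"
  shows
    "(\<forall>(C :: ('m::{t2_space,second_countable_topology}, 'n, 'k::finite) courant) G dv D.
        kretschmann_data C G dv D \<longrightarrow> smooth_fun (atlas C) (kretschmann C G D))
     \<and>
     (\<forall>(C :: ('m, 'n, 'k) courant) G dv D
       (C' :: ('m2::{t2_space,second_countable_topology}, 'n, 'k) courant) G' dv' D' f F.
        kretschmann_data C G dv D \<and> kretschmann_data C' G' dv' D' \<and>
        courant_isomorphism C C' f F \<and> maps_metric_div C f F G dv G' dv' \<longrightarrow>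
        kretschmann C' G' D' \<circ> f = kretschmann C G D)
     \<and>
     (\<exists>(C :: (real^'n, 'n, 'n + 'n) courant) G dv D.
        kretschmann_data C G dv D \<and> (\<exists>p. kretschmann C G D p \<noteq> 0))"
  using kretschmann_data_smooth kretschmann_natural flat_kretschmann_nonzero[OF dim] by blast

end
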